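(* The extended oriented graphical category $\widetilde{\mathbf U}_{/\mathfrak o}$ is equivalent to the wheeled properadic graphical category which includes the nodeless loop. Moreover, morphisms $(G,x)\to(G',x')$ of $\widetilde{\mathbf U}_{/\mathfrak o}$ may be described as pairs $(\bar\varphi_0,\hat\varphi)$ of functions $\bar\varphi_0\colon E_G\to E_{G'}$ and $\hat\varphi\colon\mathrm{Emb}(G)\to\mathrm{Emb}(G')$ such that $\hat\varphi$ sends edges to edges, $\hat\varphi$ preserves unions (if $[\ell]$ is a union of $[h]$ and $[k]$, then $\hat\varphi[\ell]$ is a union of $\hat\varphi[h]$ and $\hat\varphi[k]$), $\hat\varphi$ takes vertex disjoint pairs to vertex disjoint pairs, and $\mathrm{in}(\hat\varphi[h])=(\mathbb N\bar\varphi_0)(\mathrm{in}[h])$, $\mathrm{out}(\hat\varphi[h])=(\mathbb N\bar\varphi_0)(\mathrm{out}[h])$ in $\mathbb NE_{G'}$ for all $[h]\in\mathrm{Emb}(G)$.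
   Context: **Undirected graphs and $\widetilde{\mathbf U}$.** A graph $G$ consists of finite sets $A_G$ (arcs) and $V_G$ (vertices), a fixpoint-free involution $a\mapsto a^\dagger$ on $A_G$, a subset $D_G\subseteq A_G$, and a function $t\colon D_G\to V_G$. For $v\in V_G$, $\mathrm{nb}(v)=t^{-1}(v)$; the boundary is $\partial(G)=A_G\setminus D_G$; $E_G$ is the set of $\dagger$-orbits. Connected means non-empty and not a disjoint union of two non-empty graphs. The edge $\updownarrow$ has two arcs and $D=V=\varnothing$. An étale map $f\colon H\to G$ consists of functions on $A$, $D$, $V$ compatible with all structure, restricting to bijections $\mathrm{nb}(v)\to\mathrm{nb}(f(v))$. An embedding is an étale map between connected graphs, injective on vertices. $\mathrm{Emb}(G)$ is the set of classes $[f]$ of embeddings with codomain $G$ ($f\sim h$ iff $f=hz$ for an isomorphism $z$), ordered by $[h]\le[k]$ iff $h=kj$ for an embedding $j$; $[f\colon H\to G]$ is an edge if $H\cong\updownarrow$; $\varsigma[f]=f(V_H)$, $\partial([f])=f(\partial(H))$. A nodeless loop is an additional connected graph $K$ with two arcs, $D_K=V_K=\varnothing$, and $\partial(K)=\varnothing$ by definition; the only embeddings out of $K$ are isomorphisms of nodeless loops, and $\mathrm{Emb}(K)=\{[\updownarrow]<[\mathrm{id}_K]\}$ with $\partial([\updownarrow])=A_K$, $\partial([\mathrm{id}_K])=\varnothing$, only the first being an edge. $\ell\colon L\to G$ is a union of $h\colon H\to G$ and $k\colon K\to G$ if $[h],[k]\le[\ell]$ and $\ell(V_L)=h(V_H)\cup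 k(V_K)$; $h,k$ are vertex disjoint if $h(V_H)\cap k(V_K)=\varnothing$. The category $\widetilde{\mathbf U}$ has connected graphs, including nodeless loops, as objects; a morphism $\varphi\colon G\to G'$ is a pair of an involutive function $\varphi_0\colon A_G\to A_{G'}$ and a function $\varphi_1\colon V_G\to\mathrm{Emb}(G')$ such that: (a) the sets $\varsigma(\varphi_1(v))$ are pairwise disjoint; (b) for each $v$, $a\mapsto\varphi_0(a^\dagger)$ gives a bijection $\mathrm{nb}(v)\to\partial(\varphi_1(v))$; (c') if $\partial(G)=\varnothing$ and every $\varphi_1(v)$ is an edge, then $G'$ is a nodeless loop. The composite with $\psi\colon G'\to G''$ has $(\psi\varphi)_0=\psi_0\varphi_0$, and $(\psi\varphi)_1(v)$ is the unique class in $\mathrm{Emb}(G'')$ with boundary $\psi_0(\partial(\varphi_1(v)))$ and vertex set $\coprod_{w\in\varsigma(\varphi_1(v))}\varsigma(\psi_1(w))$. **$\widetilde{\mathbf U}_{/\mathfrak o}$.** Objects: pairs $(G,x)$ with $G\in\widetilde{\mathbf U}$ and $x\colon A_G\to\{+1,-1\}$ with $x(a^\dagger)=-x(a)$. Morphisms $(G,x)\to(G',x')$: graphical maps $\varphi$ with $x'\varphi_0=x$. With $A_G^{\pm}=x^{-1}(\pm1)\cong E_G$, put $\mathrm{in}([f])=\partial([f])\cap A_G^+$ and $\mathrm{out}([f])=\partial([f])\cap A_G^-$, regarded as subsets of $E_G$, hence as elements of the free commutative monoid $\mathbb NE_G$. The function $\bar\varphi_0\colon E_G\to E_{G'}$ is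 the one induced by $\varphi_0$. (Objects correspond to connected directed graphs as below, with $I_G=D_G\cap A_G^-$, $O_G=D_G\cap A_G^+$, mapped injectively to $E_G$.) **Directed graphs.** A connected directed graph $G$ is either an ordinary one, consisting of finite sets $E_G,I_G,V_G,O_G$, inclusions $I_G,O_G\subseteq E_G$ and functions $I_G\to V_G$, $O_G\to V_G$ (connected in the evident sense), with $\mathrm{in}(G)=E_G\setminus O_G$, $\mathrm{out}(G)=E_G\setminus I_G$; or a nodeless loop: $E_G$ a point, $I_G=V_G=O_G=\mathrm{in}(G)=\mathrm{out}(G)=\varnothing$. $\mathrm{in}(v)\subseteq I_G$, $\mathrm{out}(v)\subseteq O_G$ are the preimages of $v\in V_G$. A *local map* $H\to G$ is a natural transformation of the diagrams $(E,I,V,O)$ with the squares for $I\to V$ and $O\to V$ pullbacks. An embedding of directed graphs is a local map between connected directed graphs, injective on vertices, such that if the domain is a nodeless loop then so is the codomain. **Graph substitution.** Given a connected directed graph $H$ and for each $v\in V_H$ a connected directed graph $K_v$ with bijections $\mathrm{in}(K_v)\cong\mathrm{in}(v)$, $\mathrm{out}(K_v)\cong\mathrm{out}(v)$, the graph $H\{K_v\}$ has $V=\coprod V_{K_v}$, $I=\coprod I_{K_v}$, $O=\coprod O_{K_v}$, $E$ the quotient of $E_H\amalg\coprod_vE_{K_v}$ identifying each input (resp. output) edge of $K_v$ with the corresponding edge in $\mathrm{in}(v)$ (resp. $\mathrm{out}(v)$), and $\mathrm{in}$, $\mathrm{out}$ the images of $\mathrm{in}(H)$, $\mathrm{out}(H)$.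 **Wheeled properadic graphical category (including the nodeless loop).** Objects are all connected directed graphs, including nodeless loops. Let $F(G)$ be the free $E_G$-coloured wheeled properad with one generator for each $v\in V_G$, with inputs $\mathrm{in}(v)$ and outputs $\mathrm{out}(v)$. A map of wheeled properads $f\colon F(G)\to F(G')$ amounts to a function $f_0\colon E_G\to E_{G'}$ and, for each $v\in V_G$, an isomorphism class $f_1(v)$ of a connected directed graph $K_v$ (possibly a nodeless loop) with a local map $\kappa_v\colon K_v\to G'$ and bijections $\mathrm{in}(K_v)\cong\mathrm{in}(v)$, $\mathrm{out}(K_v)\cong\mathrm{out}(v)$ under which $\kappa_v$ on $\mathrm{in}(K_v)$ and $\mathrm{out}(K_v)$ agrees with $f_0$. For an embedding $h\colon H\to G$ there is an induced local map $H\{K_{h(v)}\}_{v\in V_H}\to G'$. Morphisms $G\to G'$ are the maps of wheeled properads $F(G)\to F(G')$ such that for every embedding $h\colon H\to G$ this induced local map is an embedding. Composition is that of wheeled properad maps: $(gf)_0=g_0f_0$, and $(gf)_1(v)$ is the induced map $K_v\{L_{\kappa_v(w)}\}_{w\in V_{K_v}}\to G''$, where $g_1(u)$ is represented by $L_u\to G''$. *)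

theory Defs
  imports
    "HOL-Library.FuncSet"
    "HOL-Library.Multiset"
    "HOL-Library.Infinite_Typeclass"
begin

section \<open>Categories and equivalences of categories\<close>

text \<open>
  Hom-sets are indexed by pairs of objects and need not be disjoint, so composition
  takes the three objects as arguments: \<open>Comp C x y z g f\<close> is the composite of
  \<open>f : x \<rightarrow> y\<close> and \<open>g : y \<rightarrow> z\<close>.
\<close>

record ('o, 'm) cat =
  Obj :: "'o set"
  Hom :: "'o \<Rightarrow> 'o \<Rightarrow> 'm set"
  Comp :: "'o \<Rightarrow> 'o \<Rightarrow> 'o \<Rightarrow> 'm \<Rightarrow> 'm \<Rightarrow> 'm"

definition is_ident :: "('o, 'm) cat \<Rightarrow> 'o \<Rightarrow> 'm \<Rightarrow> bool" where
  "is_ident C x i \<longleftrightarrow> i \<in> Hom C x x \<and>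
     (\<forall>y\<in>Obj C. (\<forall>f\<in>Hom C x y. Comp C x x y f i = f) \<and>
                 (\<forall>f\<in>Hom C y x. Comp C y x x i f = f))"

definition is_category :: "('o, 'm) cat \<Rightarrow> bool" where
  "is_category C \<longleftrightarrow>
     (\<forall>x\<in>Obj C. \<forall>y\<in>Obj C. \<forall>z\<in>Obj C. \<forall>f\<in>Hom C x y. \<forall>g\<in>Hom C y z.
        Comp C x y z g f \<in> Hom C x z) \<and>
     (\<forall>w\<in>Obj C. \<forall>x\<in>Obj C. \<forall>y\<in>Obj C. \<forall>z\<in>Obj C.
        \<forall>f\<in>Hom C w x. \<forall>g\<in>Hom C x y. \<forall>h\<in>Hom C y z.
        Comp C w x z (Comp C x y z h g) f = Comp C w y z h (Comp C w x y g f)) \<and>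
     (\<forall>x\<in>Obj C. \<exists>i. is_ident C x i)"

definition is_functor ::
  "('o, 'm) cat \<Rightarrow> ('p, 'n) cat \<Rightarrow> ('o \<Rightarrow> 'p) \<Rightarrow> ('o \<Rightarrow> 'o \<Rightarrow> 'm \<Rightarrow> 'n) \<Rightarrow> bool" where
  "is_functor C D Fo Fm \<longleftrightarrow>
     (\<forall>x\<in>Obj C. Fo x \<in> Obj D) \<and>
     (\<forall>x\<in>Obj C. \<forall>y\<in>Obj C. \<forall>f\<in>Hom C x y. Fm x y f \<in> Hom D (Fo x) (Fo y)) \<and>
     (\<forall>x\<in>Obj C. \<forall>i. is_ident C x i \<longrightarrow> is_ident D (Fo x) (Fm x x i)) \<and>
     (\<forall>x\<in>Obj C. \<forall>y\<in>Obj C. \<forall>z\<in>Obj C. \<forall>f\<in>Hom C x y. \<forall>g\<in>Hom C y z.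
        Fm x z (Comp C x y z g f) = Comp D (Fo x) (Fo y) (Fo z) (Fm y z g) (Fm x y f))"

definition is_iso_arrow :: "('o, 'm) cat \<Rightarrow> 'o \<Rightarrow> 'o \<Rightarrow> 'm \<Rightarrow> bool" where
  "is_iso_arrow C x y f \<longleftrightarrow> f \<in> Hom C x y \<and>
     (\<exists>g\<in>Hom C y x. is_ident C x (Comp C x y x g f) \<and> is_ident C y (Comp C y x y f g))"

definition is_natural_iso ::
  "('o, 'm) cat \<Rightarrow> ('p, 'n) cat \<Rightarrow> ('o \<Rightarrow> 'p) \<Rightarrow> ('o \<Rightarrow> 'o \<Rightarrow> 'm \<Rightarrow> 'n) \<Rightarrow>
     ('o \<Rightarrow> 'p) \<Rightarrow> ('o \<Rightarrow> 'o \<Rightarrow> 'm \<Rightarrow> 'n) \<Rightarrow> ('o \<Rightarrow> 'n) \<Rightarrow> bool" where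
  "is_natural_iso C D Fo Fm Go Gm \<eta> \<longleftrightarrow>
     (\<forall>x\<in>Obj C. is_iso_arrow D (Fo x) (Go x) (\<eta> x)) \<and>
     (\<forall>x\<in>Obj C. \<forall>y\<in>Obj C. \<forall>f\<in>Hom C x y.
        Comp D (Fo x) (Fo y) (Go y) (\<eta> y) (Fm x y f) =
        Comp D (Fo x) (Go x) (Go y) (Gm x y f) (\<eta> x))"

definition equivalent_categories :: "('o, 'm) cat \<Rightarrow> ('p, 'n) cat \<Rightarrow> bool" where
  "equivalent_categories C D \<longleftrightarrow> is_category C \<and> is_category D \<and>
     (\<exists>Fo Fm Go Gm \<eta> \<epsilon>.
        is_functor C D Fo Fm \<and> is_functor D C Go Gm \<and>
        is_natural_iso C C (\<lambda>x. x) (\<lambda>x y f. f)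
          (\<lambda>x. Go (Fo x)) (\<lambda>x y f. Gm (Fo x) (Fo y) (Fm x y f)) \<eta> \<and>
        is_natural_iso D D (\<lambda>x. Fo (Go x)) (\<lambda>x y f. Fm (Go x) (Go y) (Gm x y f))
          (\<lambda>x. x) (\<lambda>x y f. f) \<epsilon>)"


section \<open>Undirected graphs\<close>

text \<open>
  The boundary is stored as a field: it is \<open>arcs - darts\<close> for an ordinary graph, and
  empty by definition for a nodeless loop, which otherwise has the same data as an edge.
  The field \<open>darts\<close> is the domain of the partial map \<open>tgt\<close> from arcs to vertices.
  Functions on a carrier are \<open>undefined\<close> outside of it throughout, so that
  equality of records and morphisms is equality of the mathematical data.
\<close>

record ('a, 'v) ugraph =
  arcs :: "'a set"
  verts :: "'v set"
  dag :: "'a \<Rightarrow> 'a"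
  darts :: "'a set"
  tgt :: "'a \<Rightarrow> 'v"
  bnd :: "'a set"

definition nodeless_loop :: "('a, 'v) ugraph \<Rightarrow> bool" where
  "nodeless_loop G \<longleftrightarrow> card (arcs G) = 2 \<and> darts G = {} \<and> verts G = {} \<and> bnd G = {}"

definition ugraph :: "('a, 'v) ugraph \<Rightarrow> bool" where
  "ugraph G \<longleftrightarrow> finite (arcs G) \<and> finite (verts G) \<and>
     dag G \<in> arcs G \<rightarrow>\<^sub>E arcs G \<and> (\<forall>a\<in>arcs G. dag G (dag G a) = a \<and> dag G a \<noteq> a) \<and>
     darts G \<subseteq> arcs G \<and> tgt G \<in> darts G \<rightarrow>\<^sub>E verts G \<and>
     (bnd G = arcs G - darts G \<or> nodeless_loop G)"

text \<open>
  The pair \<open>A\<close>, \<open>W\<close> below, together with its complement, is a decomposition of \<open>G\<close> as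
  a disjoint union of two graphs. Nodeless loops are connected.
\<close>

definition connected_ugraph :: "('a, 'v) ugraph \<Rightarrow> bool" where
  "connected_ugraph G \<longleftrightarrow> ugraph G \<and> (arcs G \<noteq> {} \<or> verts G \<noteq> {}) \<and>
     (\<forall>A W. A \<subseteq> arcs G \<longrightarrow> W \<subseteq> verts G \<longrightarrow> (\<forall>a\<in>A. dag G a \<in> A) \<longrightarrow>
        (\<forall>a\<in>darts G. a \<in> A \<longleftrightarrow> tgt G a \<in> W) \<longrightarrow>
        (A = {} \<and> W = {}) \<or> (A = arcs G \<and> W = verts G))"

definition nb :: "('a, 'v) ugraph \<Rightarrow> 'v \<Rightarrow> 'a set" where
  "nb G v = {a \<in> darts G. tgt G a = v}"

definition edge_graph :: "('a, 'v) ugraph \<Rightarrow> bool" where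
  "edge_graph G \<longleftrightarrow> ugraph G \<and> card (arcs G) = 2 \<and> darts G = {} \<and> verts G = {} \<and>
     bnd G = arcs G"

text \<open>The map on \<open>darts\<close> is the restriction of the map on arcs.\<close>

definition etale ::
  "('a, 'v) ugraph \<Rightarrow> ('b, 'w) ugraph \<Rightarrow> ('a \<Rightarrow> 'b) \<times> ('v \<Rightarrow> 'w) \<Rightarrow> bool" where
  "etale H G f \<longleftrightarrow>
     fst f \<in> arcs H \<rightarrow>\<^sub>E arcs G \<and> snd f \<in> verts H \<rightarrow>\<^sub>E verts G \<and>
     (\<forall>a\<in>arcs H. fst f (dag H a) = dag G (fst f a)) \<and>
     (\<forall>a\<in>darts H. fst f a \<in> darts G \<and> tgt G (fst f a) = snd f (tgt H a)) \<and>
     (\<forall>v\<in>verts H. bij_betw (fst f) (nb H v) (nb G (snd f v)))"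

text \<open>
  An etale map from an ordinary connected graph to a nodeless loop can only start at an
  edge, and one between nodeless loops is an isomorphism. So the last condition
  gives exactly the prescribed embeddings out of and into nodeless loops.
\<close>

definition embedding ::
  "('a, 'v) ugraph \<Rightarrow> ('b, 'w) ugraph \<Rightarrow> ('a \<Rightarrow> 'b) \<times> ('v \<Rightarrow> 'w) \<Rightarrow> bool" where
  "embedding H G f \<longleftrightarrow> connected_ugraph H \<and> connected_ugraph G \<and> etale H G f \<and>
     inj_on (snd f) (verts H) \<and> (nodeless_loop H \<longrightarrow> nodeless_loop G)"

definition ugraph_iso ::
  "('a, 'v) ugraph \<Rightarrow> ('b, 'w) ugraph \<Rightarrow> ('a \<Rightarrow> 'b) \<times> ('v \<Rightarrow> 'w) \<Rightarrow> bool" where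
  "ugraph_iso H G z \<longleftrightarrow> etale H G z \<and>
     bij_betw (fst z) (arcs H) (arcs G) \<and> bij_betw (snd z) (verts H) (verts G) \<and>
     fst z ` darts H = darts G \<and> fst z ` bnd H = bnd G"


section \<open>The poset of embeddings\<close>

text \<open>
  An embedding is recorded with its domain, and a class is a set of embeddings with
  domain in the same type of graphs as the codomain. As the arc and vertex types
  are infinite in the theorem, every embedding with finite domain is isomorphic to one of these.
\<close>

type_synonym ('a, 'v) emb = "('a, 'v) ugraph \<times> ('a \<Rightarrow> 'a) \<times> ('v \<Rightarrow> 'v)"

definition factors_through ::
  "('a, 'v) emb \<Rightarrow> ('a, 'v) emb \<Rightarrow> ('a \<Rightarrow> 'a) \<times> ('v \<Rightarrow> 'v) \<Rightarrow> bool" where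
  "factors_through f h j \<longleftrightarrow>
     (\<forall>a\<in>arcs (fst f). fst (snd f) a = fst (snd h) (fst j a)) \<and>
     (\<forall>v\<in>verts (fst f). snd (snd f) v = snd (snd h) (snd j v))"

definition emb_class :: "('a, 'v) ugraph \<Rightarrow> ('a, 'v) emb \<Rightarrow> ('a, 'v) emb set" where
  "emb_class G h = {f. embedding (fst f) G (snd f) \<and>
     (\<exists>z. ugraph_iso (fst f) (fst h) z \<and> factors_through f h z)}"

definition Emb :: "('a, 'v) ugraph \<Rightarrow> ('a, 'v) emb set set" where
  "Emb G = emb_class G ` {h. embedding (fst h) G (snd h)}"

definition emb_le :: "('a, 'v) emb set \<Rightarrow> ('a, 'v) emb set \<Rightarrow> bool" where
  "emb_le c d \<longleftrightarrow>
     (\<exists>h\<in>c. \<exists>k\<in>d. \<exists>j. embedding (fst h) (fst k) j \<and> factors_through h k j)"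

text \<open>All representatives of a class have the same image, so these unions are constant.\<close>

definition emb_verts :: "('a, 'v) emb set \<Rightarrow> 'v set" where
  "emb_verts c = (\<Union>f\<in>c. snd (snd f) ` verts (fst f))"

definition emb_bnd :: "('a, 'v) emb set \<Rightarrow> 'a set" where
  "emb_bnd c = (\<Union>f\<in>c. fst (snd f) ` bnd (fst f))"

definition emb_is_edge :: "('a, 'v) emb set \<Rightarrow> bool" where
  "emb_is_edge c \<longleftrightarrow> (\<exists>f\<in>c. edge_graph (fst f))"

definition emb_is_union ::
  "('a, 'v) emb set \<Rightarrow> ('a, 'v) emb set \<Rightarrow> ('a, 'v) emb set \<Rightarrow> bool" where
  "emb_is_union l h k \<longleftrightarrow> emb_le h l \<and> emb_le k l \<and> emb_verts l = emb_verts h \<union> emb_verts k"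

definition emb_vdisjoint :: "('a, 'v) emb set \<Rightarrow> ('a, 'v) emb set \<Rightarrow> bool" where
  "emb_vdisjoint h k \<longleftrightarrow> emb_verts h \<inter> emb_verts k = {}"


section \<open>The extended graphical category and its oriented version\<close>

type_synonym ('a, 'v) umor = "('a \<Rightarrow> 'a) \<times> ('v \<Rightarrow> ('a, 'v) emb set)"

definition graphical_map :: "('a, 'v) ugraph \<Rightarrow> ('a, 'v) ugraph \<Rightarrow> ('a, 'v) umor \<Rightarrow> bool" where
  "graphical_map G G' \<phi> \<longleftrightarrow>
     fst \<phi> \<in> arcs G \<rightarrow>\<^sub>E arcs G' \<and> (\<forall>a\<in>arcs G. fst \<phi> (dag G a) = dag G' (fst \<phi> a)) \<and>
     snd \<phi> \<in> verts G \<rightarrow>\<^sub>E Emb G' \<and>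
     (\<forall>v\<in>verts G. \<forall>w\<in>verts G. v \<noteq> w \<longrightarrow> emb_verts (snd \<phi> v) \<inter> emb_verts (snd \<phi> w) = {}) \<and>
     (\<forall>v\<in>verts G. bij_betw (\<lambda>a. fst \<phi> (dag G a)) (nb G v) (emb_bnd (snd \<phi> v))) \<and>
     (bnd G = {} \<and> (\<forall>v\<in>verts G. emb_is_edge (snd \<phi> v)) \<longrightarrow> nodeless_loop G')"

text \<open>
  The function \<open>Emb G \<rightarrow> Emb G'\<close> induced by a graphical map into \<open>G'\<close>; composition of
  graphical maps applies it to the values of the first map.
\<close>

definition emb_hat :: "('a, 'v) ugraph \<Rightarrow> ('a, 'v) umor \<Rightarrow> ('a, 'v) emb set \<Rightarrow> ('a, 'v) emb set" where
  "emb_hat G' \<phi> c = (THE d. d \<in> Emb G' \<and> emb_bnd d = fst \<phi> ` emb_bnd c \<and>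
     emb_verts d = (\<Union>w\<in>emb_verts c. emb_verts (snd \<phi> w)))"

definition umor_comp ::
  "('a, 'v) ugraph \<Rightarrow> ('a, 'v) ugraph \<Rightarrow> ('a, 'v) umor \<Rightarrow> ('a, 'v) umor \<Rightarrow> ('a, 'v) umor" where
  "umor_comp G G'' \<psi> \<phi> =
     (restrict (\<lambda>a. fst \<psi> (fst \<phi> a)) (arcs G),
      restrict (\<lambda>v. emb_hat G'' \<psi> (snd \<phi> v)) (verts G))"

definition ext_graphical_cat :: "(('a, 'v) ugraph, ('a, 'v) umor) cat" where
  "ext_graphical_cat =
     \<lparr>Obj = {G. connected_ugraph G},
      Hom = (\<lambda>G G'. {\<phi>. graphical_map G G' \<phi>}),
      Comp = (\<lambda>G G' G''. umor_comp G G'')\<rparr>"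

type_synonym ('a, 'v) ograph = "('a, 'v) ugraph \<times> ('a \<Rightarrow> int)"

definition orientation :: "('a, 'v) ugraph \<Rightarrow> ('a \<Rightarrow> int) \<Rightarrow> bool" where
  "orientation G x \<longleftrightarrow> x \<in> arcs G \<rightarrow>\<^sub>E {1, -1} \<and> (\<forall>a\<in>arcs G. x (dag G a) = - x a)"

definition ext_oriented_cat :: "(('a, 'v) ograph, ('a, 'v) umor) cat" where
  "ext_oriented_cat =
     \<lparr>Obj = {X. fst X \<in> Obj ext_graphical_cat \<and> orientation (fst X) (snd X)},
      Hom = (\<lambda>X X'. {\<phi> \<in> Hom ext_graphical_cat (fst X) (fst X').
                        \<forall>a\<in>arcs (fst X). snd X' (fst \<phi> a) = snd X a}),
      Comp = (\<lambda>X X' X''. Comp ext_graphical_cat (fst X) (fst X') (fst X''))\<rparr>"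

definition edge_of :: "('a, 'v) ugraph \<Rightarrow> 'a \<Rightarrow> 'a set" where
  "edge_of G a = {a, dag G a}"

definition edges :: "('a, 'v) ugraph \<Rightarrow> 'a set set" where
  "edges G = edge_of G ` arcs G"

text \<open>
  Finite subsets of the edge set as elements of the free commutative monoid on it; \<open>edge_of\<close>
  is injective on positive arcs and on negative arcs.
\<close>

definition emb_in :: "('a, 'v) ograph \<Rightarrow> ('a, 'v) emb set \<Rightarrow> 'a set multiset" where
  "emb_in X c = mset_set (edge_of (fst X) ` (emb_bnd c \<inter> {a \<in> arcs (fst X). snd X a = 1}))"

definition emb_out :: "('a, 'v) ograph \<Rightarrow> ('a, 'v) emb set \<Rightarrow> 'a set multiset" where
  "emb_out X c = mset_set (edge_of (fst X) ` (emb_bnd c \<inter> {a \<in> arcs (fst X). snd X a = -1}))"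

definition edge_emb_pair ::
  "('a, 'v) ograph \<Rightarrow> ('a, 'v) ograph \<Rightarrow>
     ('a set \<Rightarrow> 'a set) \<times> (('a, 'v) emb set \<Rightarrow> ('a, 'v) emb set) \<Rightarrow> bool" where
  "edge_emb_pair X X' p \<longleftrightarrow>
     fst p \<in> edges (fst X) \<rightarrow>\<^sub>E edges (fst X') \<and>
     snd p \<in> Emb (fst X) \<rightarrow>\<^sub>E Emb (fst X') \<and>
     (\<forall>h\<in>Emb (fst X). emb_is_edge h \<longrightarrow> emb_is_edge (snd p h)) \<and>
     (\<forall>l\<in>Emb (fst X). \<forall>h\<in>Emb (fst X). \<forall>k\<in>Emb (fst X).
        emb_is_union l h k \<longrightarrow> emb_is_union (snd p l) (snd p h) (snd p k)) \<and>
     (\<forall>h\<in>Emb (fst X). \<forall>k\<in>Emb (fst X).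
        emb_vdisjoint h k \<longrightarrow> emb_vdisjoint (snd p h) (snd p k)) \<and>
     (\<forall>h\<in>Emb (fst X).
        emb_in X' (snd p h) = image_mset (fst p) (emb_in X h) \<and>
        emb_out X' (snd p h) = image_mset (fst p) (emb_out X h))"

definition induced_pair ::
  "('a, 'v) ograph \<Rightarrow> ('a, 'v) ograph \<Rightarrow> ('a, 'v) umor \<Rightarrow>
     ('a set \<Rightarrow> 'a set) \<times> (('a, 'v) emb set \<Rightarrow> ('a, 'v) emb set)" where
  "induced_pair X X' \<phi> =
     (restrict (\<lambda>e. fst \<phi> ` e) (edges (fst X)),
      restrict (emb_hat (fst X') \<phi>) (Emb (fst X)))"


section \<open>Directed graphs\<close>

text \<open>
  Again the global inputs and outputs are fields, in order to distinguish a nodeless loop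
  from an edge: both have one edge and no vertices.
\<close>

record ('e, 'v) digraph =
  dE :: "'e set"
  dI :: "'e set"
  dO :: "'e set"
  dV :: "'v set"
  dtI :: "'e \<Rightarrow> 'v"
  dtO :: "'e \<Rightarrow> 'v"
  din :: "'e set"
  dout :: "'e set"

definition dnodeless_loop :: "('e, 'v) digraph \<Rightarrow> bool" where
  "dnodeless_loop G \<longleftrightarrow> card (dE G) = 1 \<and> dI G = {} \<and> dO G = {} \<and> dV G = {} \<and>
     din G = {} \<and> dout G = {}"

definition digraph :: "('e, 'v) digraph \<Rightarrow> bool" where
  "digraph G \<longleftrightarrow> finite (dE G) \<and> finite (dV G) \<and> dI G \<subseteq> dE G \<and> dO G \<subseteq> dE G \<and>
     dtI G \<in> dI G \<rightarrow>\<^sub>E dV G \<and> dtO G \<in> dO G \<rightarrow>\<^sub>E dV G \<and>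
     (din G = dE G - dO G \<and> dout G = dE G - dI G \<or> dnodeless_loop G)"

definition connected_digraph :: "('e, 'v) digraph \<Rightarrow> bool" where
  "connected_digraph G \<longleftrightarrow> digraph G \<and> (dE G \<noteq> {} \<or> dV G \<noteq> {}) \<and>
     (\<forall>A W. A \<subseteq> dE G \<longrightarrow> W \<subseteq> dV G \<longrightarrow>
        (\<forall>e\<in>dI G. e \<in> A \<longleftrightarrow> dtI G e \<in> W) \<longrightarrow> (\<forall>e\<in>dO G. e \<in> A \<longleftrightarrow> dtO G e \<in> W) \<longrightarrow>
        (A = {} \<and> W = {}) \<or> (A = dE G \<and> W = dV G))"

definition in_at :: "('e, 'v) digraph \<Rightarrow> 'v \<Rightarrow> 'e set" where
  "in_at G v = {e \<in> dI G. dtI G e = v}"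

definition out_at :: "('e, 'v) digraph \<Rightarrow> 'v \<Rightarrow> 'e set" where
  "out_at G v = {e \<in> dO G. dtO G e = v}"

text \<open>The two bijections say that the squares for \<open>I \<rightarrow> V\<close> and \<open>O \<rightarrow> V\<close> are pullbacks.\<close>

definition local_map ::
  "('e, 'v) digraph \<Rightarrow> ('f, 'w) digraph \<Rightarrow> ('e \<Rightarrow> 'f) \<times> ('v \<Rightarrow> 'w) \<Rightarrow> bool" where
  "local_map H G f \<longleftrightarrow>
     fst f \<in> dE H \<rightarrow>\<^sub>E dE G \<and> snd f \<in> dV H \<rightarrow>\<^sub>E dV G \<and>
     (\<forall>e\<in>dI H. fst f e \<in> dI G \<and> dtI G (fst f e) = snd f (dtI H e)) \<and>
     (\<forall>e\<in>dO H. fst f e \<in> dO G \<and> dtO G (fst f e) = snd f (dtO H e)) \<and>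
     bij_betw (\<lambda>e. (fst f e, dtI H e)) (dI H)
       {(e, v). e \<in> dI G \<and> v \<in> dV H \<and> dtI G e = snd f v} \<and>
     bij_betw (\<lambda>e. (fst f e, dtO H e)) (dO H)
       {(e, v). e \<in> dO G \<and> v \<in> dV H \<and> dtO G e = snd f v}"

definition dembedding ::
  "('e, 'v) digraph \<Rightarrow> ('f, 'w) digraph \<Rightarrow> ('e \<Rightarrow> 'f) \<times> ('v \<Rightarrow> 'w) \<Rightarrow> bool" where
  "dembedding H G f \<longleftrightarrow> connected_digraph H \<and> connected_digraph G \<and> local_map H G f \<and>
     inj_on (snd f) (dV H) \<and> (dnodeless_loop H \<longrightarrow> dnodeless_loop G)"

definition digraph_iso ::
  "('e, 'v) digraph \<Rightarrow> ('f, 'w) digraph \<Rightarrow> ('e \<Rightarrow> 'f) \<times> ('v \<Rightarrow> 'w) \<Rightarrow> bool" where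
  "digraph_iso H G z \<longleftrightarrow> local_map H G z \<and>
     bij_betw (fst z) (dE H) (dE G) \<and> bij_betw (snd z) (dV H) (dV G) \<and>
     fst z ` dI H = dI G \<and> fst z ` dO H = dO G \<and>
     fst z ` din H = din G \<and> fst z ` dout H = dout G"


section \<open>Graph substitution\<close>

text \<open>
  The bijections \<open>\<alpha> v : in(K v) \<rightarrow> in(v)\<close> and \<open>\<beta> v : out(K v) \<rightarrow> out(v)\<close> are arguments. Edges of the
  substituted graph are classes of elements of \<open>E(H) + (\<Sum>v. E(K v))\<close>.
\<close>

definition subst_eq ::
  "('e, 'v) digraph \<Rightarrow> ('v \<Rightarrow> ('k, 'w) digraph) \<Rightarrow> ('v \<Rightarrow> 'k \<Rightarrow> 'e) \<Rightarrow> ('v \<Rightarrow> 'k \<Rightarrow> 'e) \<Rightarrow>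
     ('e + 'v \<times> 'k) rel" where
  "subst_eq H K \<alpha> \<beta> =
     (let R = {(Inr (v, e), Inl (\<alpha> v e)) | v e. v \<in> dV H \<and> e \<in> din (K v)} \<union>
              {(Inr (v, e), Inl (\<beta> v e)) | v e. v \<in> dV H \<and> e \<in> dout (K v)}
      in (R \<union> R\<inverse>)\<^sup>*)"

definition subst_edge ::
  "('e, 'v) digraph \<Rightarrow> ('v \<Rightarrow> ('k, 'w) digraph) \<Rightarrow> ('v \<Rightarrow> 'k \<Rightarrow> 'e) \<Rightarrow> ('v \<Rightarrow> 'k \<Rightarrow> 'e) \<Rightarrow>
     'e + 'v \<times> 'k \<Rightarrow> ('e + 'v \<times> 'k) set" where
  "subst_edge H K \<alpha> \<beta> x = subst_eq H K \<alpha> \<beta> `` {x}"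

text \<open>
  Distinct elements of the coproduct of the \<open>I(K v)\<close> lie in distinct edges of the substituted
  graph, so the coproduct is encoded by a set of edges, and the description in \<open>dtI\<close>
  is a definite one; likewise for \<open>O\<close>.
\<close>

definition graph_subst ::
  "('e, 'v) digraph \<Rightarrow> ('v \<Rightarrow> ('k, 'w) digraph) \<Rightarrow> ('v \<Rightarrow> 'k \<Rightarrow> 'e) \<Rightarrow> ('v \<Rightarrow> 'k \<Rightarrow> 'e) \<Rightarrow>
     (('e + 'v \<times> 'k) set, 'v \<times> 'w) digraph" where
  "graph_subst H K \<alpha> \<beta> =
     (let q = subst_edge H K \<alpha> \<beta>;
          I = q ` Inr ` (SIGMA v:dV H. dI (K v));
          O' = q ` Inr ` (SIGMA v:dV H. dO (K v))
      in \<lparr>dE = q ` (Inl ` dE H \<union> Inr ` (SIGMA v:dV H. dE (K v))),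
          dI = I,
          dO = O',
          dV = (SIGMA v:dV H. dV (K v)),
          dtI = restrict (\<lambda>c. THE u. \<exists>v e. v \<in> dV H \<and> e \<in> dI (K v) \<and> Inr (v, e) \<in> c \<and>
                                         u = (v, dtI (K v) e)) I,
          dtO = restrict (\<lambda>c. THE u. \<exists>v e. v \<in> dV H \<and> e \<in> dO (K v) \<and> Inr (v, e) \<in> c \<and>
                                         u = (v, dtO (K v) e)) O',
          din = q ` Inl ` din H,
          dout = q ` Inl ` dout H\<rparr>)"


section \<open>The wheeled properadic graphical category\<close>

text \<open>
  A \<open>piece\<close> is a connected directed graph over \<open>G'\<close> (by \<open>pmap\<close>), with bijections \<open>pin\<close> and \<open>pout\<close>
  from its inputs and outputs to those of a vertex of \<open>G\<close>. Isomorphism classes of pieces are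
  operations of the free wheeled properad on \<open>G'\<close>. As for embeddings, a class consists of pieces
  whose graph lives in the same type as \<open>G\<close> and \<open>G'\<close>, whereas the isomorphism relation is
  also used for graphs living in other types, such as substituted ones.
\<close>

record ('k, 'w, 'e, 'v) piece =
  pgraph :: "('k, 'w) digraph"
  pmap :: "('k \<Rightarrow> 'e) \<times> ('w \<Rightarrow> 'v)"
  pin :: "'k \<Rightarrow> 'e"
  pout :: "'k \<Rightarrow> 'e"

definition piece_iso :: "('k, 'w, 'e, 'v) piece \<Rightarrow> ('l, 'u, 'e, 'v) piece \<Rightarrow> bool" where
  "piece_iso P Q \<longleftrightarrow> (\<exists>z. digraph_iso (pgraph P) (pgraph Q) z \<and>
     (\<forall>e\<in>dE (pgraph P). fst (pmap P) e = fst (pmap Q) (fst z e)) \<and>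
     (\<forall>w\<in>dV (pgraph P). snd (pmap P) w = snd (pmap Q) (snd z w)) \<and>
     (\<forall>e\<in>din (pgraph P). pin P e = pin Q (fst z e)) \<and>
     (\<forall>e\<in>dout (pgraph P). pout P e = pout Q (fst z e)))"

definition pieces ::
  "('e, 'v) digraph \<Rightarrow> 'v \<Rightarrow> ('e, 'v) digraph \<Rightarrow> ('e, 'v, 'e, 'v) piece set" where
  "pieces G v G' = {P. connected_digraph (pgraph P) \<and> local_map (pgraph P) G' (pmap P) \<and>
     pin P \<in> extensional (din (pgraph P)) \<and> bij_betw (pin P) (din (pgraph P)) (in_at G v) \<and>
     pout P \<in> extensional (dout (pgraph P)) \<and> bij_betw (pout P) (dout (pgraph P)) (out_at G v)}"

definition piece_class ::
  "('e, 'v) digraph \<Rightarrow> 'v \<Rightarrow> ('e, 'v) digraph \<Rightarrow> ('k, 'w, 'e, 'v) piece \<Rightarrow>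
     ('e, 'v, 'e, 'v) piece set" where
  "piece_class G v G' P = {Q \<in> pieces G v G'. piece_iso Q P}"

type_synonym ('e, 'v) dmor = "('e \<Rightarrow> 'e) \<times> ('v \<Rightarrow> ('e, 'v, 'e, 'v) piece set)"

text \<open>
  As \<open>F(G)\<close> is free on the vertices of \<open>G\<close>, a map of wheeled properads \<open>F(G) \<rightarrow> F(G')\<close> consists of
  a map of colours and, for each vertex, an operation of \<open>F(G')\<close> with matching profile.
\<close>

definition properad_map :: "('e, 'v) digraph \<Rightarrow> ('e, 'v) digraph \<Rightarrow> ('e, 'v) dmor \<Rightarrow> bool" where
  "properad_map G G' f \<longleftrightarrow>
     fst f \<in> dE G \<rightarrow>\<^sub>E dE G' \<and>
     snd f \<in> (\<Pi>\<^sub>E v\<in>dV G. piece_class G v G' ` pieces G v G') \<and>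
     (\<forall>v\<in>dV G. \<forall>P\<in>snd f v.
        (\<forall>e\<in>din (pgraph P). fst (pmap P) e = fst f (pin P e)) \<and>
        (\<forall>e\<in>dout (pgraph P). fst (pmap P) e = fst f (pout P e)))"

definition prep :: "('e, 'v) dmor \<Rightarrow> 'v \<Rightarrow> ('e, 'v, 'e, 'v) piece" where
  "prep f u = (SOME P. P \<in> snd f u)"

text \<open>
  For a local map \<open>h : H \<rightarrow> G\<close> and a map \<open>f : F(G) \<rightarrow> F(G')\<close> whose value at \<open>u\<close> is represented by
  \<open>K u\<close>, these are the graph obtained from \<open>H\<close> by substituting \<open>K (h v)\<close> for \<open>v\<close>
  (using that \<open>h\<close> restricts to bijections \<open>in(v) \<rightarrow> in(h v)\<close> and \<open>out(v) \<rightarrow> out(h v)\<close>) and its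
  induced local map to \<open>G'\<close>.
\<close>

definition induced_graph ::
  "('e, 'v) digraph \<Rightarrow> ('e \<Rightarrow> 'e) \<times> ('v \<Rightarrow> 'v) \<Rightarrow> ('e, 'v) dmor \<Rightarrow>
     (('e + 'v \<times> 'e) set, 'v \<times> 'v) digraph" where
  "induced_graph H h f = graph_subst H (\<lambda>v. pgraph (prep f (snd h v)))
     (\<lambda>v e. inv_into (in_at H v) (fst h) (pin (prep f (snd h v)) e))
     (\<lambda>v e. inv_into (out_at H v) (fst h) (pout (prep f (snd h v)) e))"

definition induced_map ::
  "('e, 'v) digraph \<Rightarrow> ('e \<Rightarrow> 'e) \<times> ('v \<Rightarrow> 'v) \<Rightarrow> ('e, 'v) dmor \<Rightarrow>
     (('e + 'v \<times> 'e) set \<Rightarrow> 'e) \<times> ('v \<times> 'v \<Rightarrow> 'v)" where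
  "induced_map H h f =
     (restrict
        (\<lambda>c. the_elem
          (case_sum (\<lambda>e. fst f (fst h e)) (\<lambda>(v, k). fst (pmap (prep f (snd h v))) k) ` c))
        (dE (induced_graph H h f)),
      restrict (\<lambda>(v, w). snd (pmap (prep f (snd h v))) w) (dV (induced_graph H h f)))"

definition wheeled_map :: "('e, 'v) digraph \<Rightarrow> ('e, 'v) digraph \<Rightarrow> ('e, 'v) dmor \<Rightarrow> bool" where
  "wheeled_map G G' f \<longleftrightarrow> properad_map G G' f \<and>
     (\<forall>(H :: ('e, 'v) digraph) h. dembedding H G h \<longrightarrow>
        dembedding (induced_graph H h f) G' (induced_map H h f))"

definition subst_piece ::
  "('e, 'v) dmor \<Rightarrow> ('e, 'v, 'e, 'v) piece \<Rightarrow> (('e + 'v \<times> 'e) set, 'v \<times> 'v, 'e, 'v) piece" where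
  "subst_piece g P =
     \<lparr>pgraph = induced_graph (pgraph P) (pmap P) g,
      pmap = induced_map (pgraph P) (pmap P) g,
      pin = (\<lambda>c. THE x. \<exists>e\<in>din (pgraph P). Inl e \<in> c \<and> x = pin P e),
      pout = (\<lambda>c. THE x. \<exists>e\<in>dout (pgraph P). Inl e \<in> c \<and> x = pout P e)\<rparr>"

definition dmor_comp ::
  "('e, 'v) digraph \<Rightarrow> ('e, 'v) digraph \<Rightarrow> ('e, 'v) dmor \<Rightarrow> ('e, 'v) dmor \<Rightarrow> ('e, 'v) dmor" where
  "dmor_comp G G'' g f =
     (restrict (\<lambda>e. fst g (fst f e)) (dE G),
      restrict (\<lambda>v. piece_class G v G'' (subst_piece g (prep f v))) (dV G))"

definition wheeled_properadic_cat :: "(('e, 'v) digraph, ('e, 'v) dmor) cat" where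
  "wheeled_properadic_cat =
     \<lparr>Obj = {G. connected_digraph G},
      Hom = (\<lambda>G G'. {f. wheeled_map G G' f}),
      Comp = (\<lambda>G G' G''. dmor_comp G G'')\<rparr>"

end

theory Submission
  imports Defs
begin

text \<open>
  A class of embeddings is determined by its vertex set and its boundary, because an arc of the
  domain is determined by its image and by which ends of its edge are attached. Orienting
  domains by pullback turns embeddings of undirected graphs into embeddings of directed graphs and
  back. A map of wheeled properads therefore carries the same data as an oriented graphical
  map as soon as its pieces are embedded, and the condition on all induced local maps
  reduces to disjointness of the pieces and the condition on nodeless loops: the edges of a
  substituted graph are directed paths, and a directed cycle only arises if everything
  collapses to a single nodeless loop. This gives a functor, bijective on morphisms and
  surjective on objects, along which the category structure is transported.

  Graph substitution also provides the function on classes of embeddings induced by a graphical map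
  and shows that it is monotone. Conversely, a union-preserving function is
  determined by its values on edges and stars, since a connected graph can be built by
  adding one vertex at a time.
\<close>

section \<open>Equivalences of categories\<close>

text \<open>The obstacle is that an embedding is not a subgraph. It need not be injective on arcs,
  because an edge joining vertices of its image may be cut in the domain, and an edge and a nodeless
  loop have the same arcs and vertices. Both phenomena are visible only in the boundary, which is
  why arguments about equality are comparisons of vertex sets and boundaries. A substituted graph
  has equivalence classes as edges and pairs as vertices; its embeddings are brought back to the
  given types by renaming arcs injectively into an infinite type and vertices by their images. A
  piece carries in addition two bijections with the inputs and outputs of a vertex. For embedded
  pieces these are forced, since matching colours makes the colour map injective on the inputs and
  on the outputs of the vertex. Thus, with colours fixed, the class of an embedded piece is known
  from its vertices alone. Finally, an embedding whose domain has no boundary is onto on vertices,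
  so the condition on nodeless loops concerns only the whole graph.\<close>

lemma is_ident_unique:
  assumes "is_ident C x i" "is_ident C x j" "x \<in> Obj C"
  shows "i = j"
proof -
  have "Comp C x x x i j = i" "Comp C x x x i j = j"
    using assms unfolding is_ident_def by blast+
  then show ?thesis by simp
qed

text \<open>Every object and every arrow of \<open>D\<close> is an image, so identities and
  associativity of \<open>D\<close> are inherited from \<open>C\<close>, and identities are
  preserved by \<open>Fm\<close>. A preimage chosen for each object, together with the unique lifts
  of arrows, is the inverse equivalence.\<close>

lemma equivalent_categoriesI:
  fixes C :: "('o, 'm) cat" and D :: "('p, 'n) cat"
  assumes C: "is_category C"
    and surj: "Fo ` Obj C = Obj D"
    and bij: "\<And>x y. x \<in> Obj C \<Longrightarrow> y \<in> Obj C \<Longrightarrow>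
      bij_betw (Fm x y) (Hom C x y) (Hom D (Fo x) (Fo y))"
    and comp: "\<And>x y z f g. x \<in> Obj C \<Longrightarrow> y \<in> Obj C \<Longrightarrow> z \<in> Obj C \<Longrightarrow>
      f \<in> Hom C x y \<Longrightarrow> g \<in> Hom C y z \<Longrightarrow>
      Fm x z (Comp C x y z g f) = Comp D (Fo x) (Fo y) (Fo z) (Fm y z g) (Fm x y f)"
  shows "equivalent_categories C D"
proof -
  have Ccomp: "Comp C x y z g f \<in> Hom C x z"
    if "x \<in> Obj C" "y \<in> Obj C" "z \<in> Obj C" "f \<in> Hom C x y" "g \<in> Hom C y z" for x y z f g
    using C that unfolding is_category_def by blast
  have Cassoc: "Comp C w x z (Comp C x y z h g) f = Comp C w y z h (Comp C w x y g f)"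
    if "w \<in> Obj C" "x \<in> Obj C" "y \<in> Obj C" "z \<in> Obj C"
      "f \<in> Hom C w x" "g \<in> Hom C x y" "h \<in> Hom C y z" for w x y z f g h
    using C that unfolding is_category_def by blast
  define one where "one x = (SOME i. is_ident C x i)" for x
  have one: "is_ident C x (one x)" if "x \<in> Obj C" for x
    unfolding one_def by (rule someI_ex) (use C that in \<open>unfold is_category_def, blast\<close>)
  have oneH: "one x \<in> Hom C x x" if "x \<in> Obj C" for x
    using one[OF that] unfolding is_ident_def by blast
  have oneL: "Comp C x x y f (one x) = f" if "x \<in> Obj C" "y \<in> Obj C" "f \<in> Hom C x y" for x y f
    using one[OF that(1)] that unfolding is_ident_def by blast
  have oneR: "Comp C x y y (one y) f = f" if "x \<in> Obj C" "y \<in> Obj C" "f \<in> Hom C x y" for x y f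
    using one[OF that(2)] that unfolding is_ident_def by blast
  have FH: "Fm x y f \<in> Hom D (Fo x) (Fo y)" if "x \<in> Obj C" "y \<in> Obj C" "f \<in> Hom C x y" for x y f
    using bij_betwE[OF bij[OF that(1,2)]] that(3) by blast
  have lift: "\<exists>f\<in>Hom C x y. Fm x y f = h"
    if "x \<in> Obj C" "y \<in> Obj C" "h \<in> Hom D (Fo x) (Fo y)" for x y h
    using bij_betw_imp_surj_on[OF bij[OF that(1,2)]] that(3) by (metis imageE)
  have inj: "f = g" if "x \<in> Obj C" "y \<in> Obj C" "f \<in> Hom C x y" "g \<in> Hom C x y" "Fm x y f = Fm x y g"
    for x y f g
    using bij_betw_imp_inj_on[OF bij[OF that(1,2)]] that(3-5) by (simp add: inj_on_def)
  have FoD: "Fo x \<in> Obj D" if "x \<in> Obj C" for x using surj that by blast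
  have ident: "is_ident D (Fo x) (Fm x x (one x))" if x: "x \<in> Obj C" for x
    unfolding is_ident_def
  proof (intro conjI ballI)
    show "Fm x x (one x) \<in> Hom D (Fo x) (Fo x)" using FH x oneH by blast
  next
    fix y f assume y: "y \<in> Obj D" and f: "f \<in> Hom D (Fo x) y"
    obtain y' where y': "y' \<in> Obj C" "y = Fo y'" using y surj by blast
    obtain f' where f': "f' \<in> Hom C x y'" "Fm x y' f' = f" using lift[OF x y'(1)] f y'(2) by blast
    show "Comp D (Fo x) (Fo x) y f (Fm x x (one x)) = f"
      using comp[OF x x y'(1) oneH[OF x] f'(1)] oneL[OF x y'(1) f'(1)] y'(2) f'(2) by simp
  next
    fix y f assume y: "y \<in> Obj D" and f: "f \<in> Hom D y (Fo x)"
    obtain y' where y': "y' \<in> Obj C" "y = Fo y'" using y surj by blast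
    obtain f' where f': "f' \<in> Hom C y' x" "Fm y' x f' = f" using lift[OF y'(1) x] f y'(2) by blast
    show "Comp D y (Fo x) (Fo x) (Fm x x (one x)) f = f"
      using comp[OF y'(1) x x f'(1) oneH[OF x]] oneR[OF y'(1) x f'(1)] y'(2) f'(2) by simp
  qed
  define Go where "Go y = (SOME x. x \<in> Obj C \<and> Fo x = y)" for y
  have Go: "Go y \<in> Obj C" "Fo (Go y) = y" if "y \<in> Obj D" for y
  proof -
    have "\<exists>x. x \<in> Obj C \<and> Fo x = y" using that surj by (metis imageE)
    from someI_ex[OF this] show "Go y \<in> Obj C" "Fo (Go y) = y" unfolding Go_def by simp_all
  qed
  define L where "L x y h = (SOME f. f \<in> Hom C x y \<and> Fm x y f = h)" for x y h
  have L: "L x y h \<in> Hom C x y" "Fm x y (L x y h) = h"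
    if "x \<in> Obj C" "y \<in> Obj C" "h \<in> Hom D (Fo x) (Fo y)" for x y h
  proof -
    have "\<exists>f. f \<in> Hom C x y \<and> Fm x y f = h" using lift[OF that] by blast
    from someI_ex[OF this] show "L x y h \<in> Hom C x y" "Fm x y (L x y h) = h" unfolding L_def by simp_all
  qed
  have Lcomp: "L x z (Comp D (Fo x) (Fo y) (Fo z) g f) = Comp C x y z (L y z g) (L x y f)"
    and Dcomp: "Comp D (Fo x) (Fo y) (Fo z) g f \<in> Hom D (Fo x) (Fo z)"
    if o: "x \<in> Obj C" "y \<in> Obj C" "z \<in> Obj C"
      and f: "f \<in> Hom D (Fo x) (Fo y)" and g: "g \<in> Hom D (Fo y) (Fo z)" for x y z f g
  proof -
    have e: "Fm x z (Comp C x y z (L y z g) (L x y f)) = Comp D (Fo x) (Fo y) (Fo z) g f"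
      using comp[OF o L(1)[OF o(1,2) f] L(1)[OF o(2,3) g]] L(2)[OF o(1,2) f] L(2)[OF o(2,3) g] by simp
    have m: "Comp C x y z (L y z g) (L x y f) \<in> Hom C x z"
      using Ccomp[OF o L(1)[OF o(1,2) f] L(1)[OF o(2,3) g]] .
    show d: "Comp D (Fo x) (Fo y) (Fo z) g f \<in> Hom D (Fo x) (Fo z)"
      using FH[OF o(1,3) m] e by simp
    show "L x z (Comp D (Fo x) (Fo y) (Fo z) g f) = Comp C x y z (L y z g) (L x y f)"
      using inj[OF o(1,3) L(1)[OF o(1,3) d] m] L(2)[OF o(1,3) d] e by simp
  qed
  have D: "is_category D"
    unfolding is_category_def
  proof (intro conjI ballI)
    fix x y z f g
    assume "x \<in> Obj D" "y \<in> Obj D" "z \<in> Obj D" "f \<in> Hom D x y" "g \<in> Hom D y z"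
    then show "Comp D x y z g f \<in> Hom D x z"
      using Dcomp[of "Go x" "Go y" "Go z" f g] Go by simp
  next
    fix w x y z f g h
    assume o: "w \<in> Obj D" "x \<in> Obj D" "y \<in> Obj D" "z \<in> Obj D"
      and m: "f \<in> Hom D w x" "g \<in> Hom D x y" "h \<in> Hom D y z"
    obtain w' x' y' z' where p: "w' \<in> Obj C" "x' \<in> Obj C" "y' \<in> Obj C" "z' \<in> Obj C"
      "w = Fo w'" "x = Fo x'" "y = Fo y'" "z = Fo z'"
      using o unfolding surj[symmetric] by blast
    obtain f' g' h' where q: "f' \<in> Hom C w' x'" "g' \<in> Hom C x' y'" "h' \<in> Hom C y' z'"
      "f = Fm w' x' f'" "g = Fm x' y' g'" "h = Fm y' z' h'"
      using lift[OF p(1,2), of f] lift[OF p(2,3), of g] lift[OF p(3,4), of h] m that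
      unfolding p(5-8) by blast
    show "Comp D w x z (Comp D x y z h g) f = Comp D w y z h (Comp D w x y g f)"
      unfolding p(5-8) q(4-6)
      using comp[OF p(2-4) q(2,3)] comp[OF p(1-3) q(1,2)]
        comp[OF p(1,2,4) q(1) Ccomp[OF p(2-4) q(2,3)]] comp[OF p(1,3,4) Ccomp[OF p(1-3) q(1,2)] q(3)]
        Cassoc[OF p(1-4) q(1-3)]
      by simp
  next
    fix x assume "x \<in> Obj D" then show "\<exists>i. is_ident D x i" using ident Go by metis
  qed
  define Gm where "Gm x y = L (Go x) (Go y)" for x y
  have GmH: "Gm x y f \<in> Hom C (Go x) (Go y)" "Fm (Go x) (Go y) (Gm x y f) = f"
    if "x \<in> Obj D" "y \<in> Obj D" "f \<in> Hom D x y" for x y f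
    using L[of "Go x" "Go y" f] Go that unfolding Gm_def by auto
  have F: "is_functor C D Fo Fm"
    unfolding is_functor_def
  proof (intro conjI ballI allI impI)
    fix x i assume "x \<in> Obj C" "is_ident C x i"
    then show "is_ident D (Fo x) (Fm x x i)" using is_ident_unique[OF _ one, of x i] ident by metis
  qed (use FoD FH comp in auto)
  have G: "is_functor D C Go Gm"
    unfolding is_functor_def
  proof (intro conjI ballI allI impI)
    fix x i assume x: "x \<in> Obj D" and i: "is_ident D x i"
    have "i = Fm (Go x) (Go x) (one (Go x))"
      using is_ident_unique[OF i _ x] ident[of "Go x"] Go[OF x] by simp
    moreover have "i \<in> Hom D x x" using i unfolding is_ident_def by blast
    ultimately have "Gm x x i = one (Go x)"
      using inj[OF Go(1)[OF x] Go(1)[OF x] GmH(1)[OF x x] oneH[OF Go(1)[OF x]]] GmH(2)[OF x x] by auto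
    then show "is_ident C (Go x) (Gm x x i)" using one[OF Go(1)[OF x]] by simp
  next
    fix x y z f g
    assume "x \<in> Obj D" "y \<in> Obj D" "z \<in> Obj D" "f \<in> Hom D x y" "g \<in> Hom D y z"
    then show "Gm x z (Comp D x y z g f) = Comp C (Go x) (Go y) (Go z) (Gm y z g) (Gm x y f)"
      using Lcomp[of "Go x" "Go y" "Go z" f g] Go unfolding Gm_def by simp
  qed (use Go GmH in auto)
  \<comment> \<open>\<open>x\<close> and \<open>Go (Fo x)\<close> have the same image under
    \<open>Fo\<close>, so the identity of that image lifts to arrows in both directions, inverse to
    each other by faithfulness.\<close>
  define \<eta> where "\<eta> x = L x (Go (Fo x)) (Fm x x (one x))" for x
  define \<eta>' where "\<eta>' x = L (Go (Fo x)) x (Fm x x (one x))" for x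
  have \<eta>: "\<eta> x \<in> Hom C x (Go (Fo x))" "Fm x (Go (Fo x)) (\<eta> x) = Fm x x (one x)"
    "\<eta>' x \<in> Hom C (Go (Fo x)) x" "Fm (Go (Fo x)) x (\<eta>' x) = Fm x x (one x)" if "x \<in> Obj C" for x
    using L[of x "Go (Fo x)"] L[of "Go (Fo x)" x] FH[OF that that oneH[OF that]] Go[OF FoD[OF that]] that
    unfolding \<eta>_def \<eta>'_def by auto
  have Dl: "Comp D (Fo x) (Fo x) y f (Fm x x (one x)) = f" if "x \<in> Obj C" "y \<in> Obj D" "f \<in> Hom D (Fo x) y" for x y f
    using ident[OF that(1)] that unfolding is_ident_def by blast
  have Dr: "Comp D y (Fo x) (Fo x) (Fm x x (one x)) f = f" if "x \<in> Obj C" "y \<in> Obj D" "f \<in> Hom D y (Fo x)" for x y f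
    using ident[OF that(1)] that unfolding is_ident_def by blast
  have one_lift: "i = one x" if "x \<in> Obj C" "i \<in> Hom C x x" "is_ident D (Fo x) (Fm x x i)" for x i
    using inj[OF that(1,1,2) oneH[OF that(1)]] is_ident_unique[OF that(3) ident[OF that(1)] FoD[OF that(1)]]
    by blast
  have E: "is_natural_iso C C (\<lambda>x. x) (\<lambda>x y f. f)
          (\<lambda>x. Go (Fo x)) (\<lambda>x y f. Gm (Fo x) (Fo y) (Fm x y f)) \<eta>"
    unfolding is_natural_iso_def is_iso_arrow_def
  proof (intro conjI ballI)
    fix x assume x: "x \<in> Obj C"
    let ?y = "Go (Fo x)"
    have y: "?y \<in> Obj C" "Fo ?y = Fo x" using Go FoD x by auto
    show "\<eta> x \<in> Hom C x ?y" using \<eta> x by blast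
    have "Fm x x (Comp C x ?y x (\<eta>' x) (\<eta> x)) = Fm x x (one x)"
      using comp[OF x y(1) x \<eta>(1)[OF x] \<eta>(3)[OF x]] \<eta>(2,4)[OF x] y Dl[OF x FoD[OF x] FH[OF x x oneH[OF x]]]
      by simp
    then have 1: "Comp C x ?y x (\<eta>' x) (\<eta> x) = one x"
      using one_lift[OF x Ccomp[OF x y(1) x \<eta>(1)[OF x] \<eta>(3)[OF x]]] ident[OF x] by simp
    have "Fm ?y ?y (Comp C ?y x ?y (\<eta> x) (\<eta>' x)) = Fm x x (one x)"
      using comp[OF y(1) x y(1) \<eta>(3)[OF x] \<eta>(1)[OF x]] \<eta>(2,4)[OF x] y Dl[OF x FoD[OF x] FH[OF x x oneH[OF x]]]
      by simp
    then have 2: "Comp C ?y x ?y (\<eta> x) (\<eta>' x) = one ?y"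
      using one_lift[OF y(1) Ccomp[OF y(1) x y(1) \<eta>(3)[OF x] \<eta>(1)[OF x]]] ident[OF x] y(2) by simp
    show "\<exists>g\<in>Hom C ?y x. is_ident C x (Comp C x ?y x g (\<eta> x)) \<and> is_ident C ?y (Comp C ?y x ?y (\<eta> x) g)"
      using 1 2 one[OF x] one[OF y(1)] \<eta>(3)[OF x] by (intro bexI[of _ "\<eta>' x"]) simp_all
  next
    fix x y f assume x: "x \<in> Obj C" and y: "y \<in> Obj C" and f: "f \<in> Hom C x y"
    let ?x = "Go (Fo x)" and ?y = "Go (Fo y)"
    have x': "?x \<in> Obj C" "Fo ?x = Fo x" and y': "?y \<in> Obj C" "Fo ?y = Fo y" using Go FoD x y by auto
    let ?f = "Gm (Fo x) (Fo y) (Fm x y f)"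
    have f': "?f \<in> Hom C ?x ?y" "Fm ?x ?y ?f = Fm x y f"
      using GmH[OF FoD[OF x] FoD[OF y] FH[OF x y f]] by auto
    have "Fm x ?y (Comp C x y ?y (\<eta> y) f) = Fm x y f"
      using comp[OF x y y'(1) f \<eta>(1)[OF y]] \<eta>(2)[OF y] y' Dr[OF y FoD[OF x] FH[OF x y f]] by simp
    moreover have "Fm x ?y (Comp C x ?x ?y ?f (\<eta> x)) = Fm x y f"
      using comp[OF x x'(1) y'(1) \<eta>(1)[OF x] f'(1)] \<eta>(2)[OF x] x' y' f' Dl[OF x FoD[OF y] FH[OF x y f]] by simp
    ultimately show "Comp C x y ?y (\<eta> y) f = Comp C x ?x ?y ?f (\<eta> x)"
      using inj[OF x y'(1) Ccomp[OF x y y'(1) f \<eta>(1)[OF y]] Ccomp[OF x x'(1) y'(1) \<eta>(1)[OF x] f'(1)]] by simp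
  qed
  \<comment> \<open>\<open>Fo (Go y)\<close> equals \<open>y\<close>, so the counit can be the
    identity.\<close>
  define \<epsilon> where "\<epsilon> y = Fm (Go y) (Go y) (one (Go y))" for y
  have \<epsilon>: "is_ident D y (\<epsilon> y)" if "y \<in> Obj D" for y
    using ident[OF Go(1)[OF that]] Go(2)[OF that] unfolding \<epsilon>_def by simp
  have "is_natural_iso D D (\<lambda>x. Fo (Go x)) (\<lambda>x y f. Fm (Go x) (Go y) (Gm x y f)) (\<lambda>x. x) (\<lambda>x y f. f) \<epsilon>"
    unfolding is_natural_iso_def is_iso_arrow_def
  proof (intro conjI ballI)
    fix x assume x: "x \<in> Obj D"
    have h: "\<epsilon> x \<in> Hom D x x" "Comp D x x x (\<epsilon> x) (\<epsilon> x) = \<epsilon> x"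
      using \<epsilon>[OF x] x unfolding is_ident_def by blast+
    show "\<epsilon> x \<in> Hom D (Fo (Go x)) x" using h Go(2)[OF x] by simp
    show "\<exists>g\<in>Hom D x (Fo (Go x)).
        is_ident D (Fo (Go x)) (Comp D (Fo (Go x)) x (Fo (Go x)) g (\<epsilon> x)) \<and>
        is_ident D x (Comp D x (Fo (Go x)) x (\<epsilon> x) g)"
      unfolding Go(2)[OF x] using h \<epsilon>[OF x] by (intro bexI[of _ "\<epsilon> x"]) simp_all
  next
    fix x y f assume x: "x \<in> Obj D" and y: "y \<in> Obj D" and f: "f \<in> Hom D x y"
    show "Comp D (Fo (Go x)) (Fo (Go y)) y (\<epsilon> y) (Fm (Go x) (Go y) (Gm x y f)) = Comp D (Fo (Go x)) x y f (\<epsilon> x)"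
      using GmH[OF x y f] \<epsilon>[OF x] \<epsilon>[OF y] x y f Go unfolding is_ident_def by simp
  qed
  then show ?thesis unfolding equivalent_categories_def using C D F G E by blast
qed

section \<open>Embeddings of undirected graphs\<close>

lemma ugraphD:
  assumes "ugraph G"
  shows "finite (arcs G)" "finite (verts G)"
    "dag G \<in> arcs G \<rightarrow>\<^sub>E arcs G" "a \<in> arcs G \<Longrightarrow> dag G a \<in> arcs G"
    "a \<in> arcs G \<Longrightarrow> dag G (dag G a) = a" "a \<in> arcs G \<Longrightarrow> dag G a \<noteq> a"
    "darts G \<subseteq> arcs G" "tgt G \<in> darts G \<rightarrow>\<^sub>E verts G" "a \<in> darts G \<Longrightarrow> tgt G a \<in> verts G"
    "bnd G = arcs G - darts G \<or> nodeless_loop G"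
    "bnd G \<subseteq> arcs G" "bnd G \<inter> darts G = {}"
  using assms unfolding ugraph_def nodeless_loop_def by (auto simp: PiE_iff)

lemma connected_ugraphD:
  assumes "connected_ugraph G"
  shows "ugraph G" "arcs G \<noteq> {} \<or> verts G \<noteq> {}"
  using assms unfolding connected_ugraph_def by auto

lemma connected_ugraph_closed:
  assumes "connected_ugraph G" "A \<subseteq> arcs G" "W \<subseteq> verts G" "\<And>a. a \<in> A \<Longrightarrow> dag G a \<in> A"
    "\<And>a. a \<in> darts G \<Longrightarrow> a \<in> A \<longleftrightarrow> tgt G a \<in> W"
    "A \<noteq> {} \<or> W \<noteq> {}"
  shows "A = arcs G" "W = verts G"
  using assms unfolding connected_ugraph_def by (metis (no_types))+

text \<open>The arc and its partner, with no vertices, are closed under all structure; by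
  connectedness they are the whole graph, which is then an edge or a nodeless loop.\<close>

lemma connected_isolated_arc:
  assumes G: "connected_ugraph G" and a: "a \<in> arcs G" "a \<notin> darts G" "dag G a \<notin> darts G"
  shows "verts G = {}" "arcs G = {a, dag G a}"
proof -
  note u = ugraphD[OF connected_ugraphD(1)[OF G]]
  have "{a, dag G a} = arcs G \<and> {} = verts G"
    by (intro conjI connected_ugraph_closed[OF G, of "{a, dag G a}" "{}"]) (use u a in auto)
  then show "verts G = {}" "arcs G = {a, dag G a}" by auto
qed

lemma connected_no_verts:
  assumes G: "connected_ugraph G" and v: "verts G = {}"
  shows "darts G = {}" "card (arcs G) = 2" "a \<in> arcs G \<Longrightarrow> arcs G = {a, dag G a}"
    "bnd G = arcs G \<or> nodeless_loop G"
proof -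
  note u = ugraphD[OF connected_ugraphD(1)[OF G]]
  show d: "darts G = {}" using u(9) v by auto
  show 1: "arcs G = {a, dag G a}" if "a \<in> arcs G" for a
    using connected_isolated_arc[OF G that] d by simp
  obtain a where a: "a \<in> arcs G" using connected_ugraphD(2)[OF G] v by auto
  show "card (arcs G) = 2"
    using u(6)[OF a] by (subst 1[OF a]) (simp add: card_insert_if)
  show "bnd G = arcs G \<or> nodeless_loop G" using u(10) d by auto
qed

lemma connected_verts_dart:
  assumes "connected_ugraph G" "verts G \<noteq> {}" "a \<in> arcs G"
  shows "a \<in> darts G \<or> dag G a \<in> darts G"
  using connected_isolated_arc[OF assms(1,3)] assms(2) by blast

lemma connected_verts_bnd:
  assumes "connected_ugraph G" "verts G \<noteq> {}"
  shows "bnd G = arcs G - darts G"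
  using ugraphD(10)[OF connected_ugraphD(1)[OF assms(1)]] assms(2) unfolding nodeless_loop_def by auto

lemma nodeless_loop_iff:
  assumes "connected_ugraph G"
  shows "nodeless_loop G \<longleftrightarrow> verts G = {} \<and> bnd G = {}"
  using connected_no_verts[OF assms] connected_ugraphD[OF assms] unfolding nodeless_loop_def by auto

lemma edge_graph_iff:
  assumes "connected_ugraph G"
  shows "edge_graph G \<longleftrightarrow> verts G = {} \<and> bnd G \<noteq> {}"
  using connected_no_verts[OF assms] connected_ugraphD[OF assms]
  unfolding edge_graph_def nodeless_loop_def by auto

text \<open>When every edge is attached at some end, the arcs of a decomposition are determined by
  its vertices, so only vertex sets have to be tested.\<close>

lemma connected_ugraph_by_vertsI:
  assumes "ugraph G" "verts G \<noteq> {}"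
    and "\<And>a. a \<in> arcs G \<Longrightarrow> a \<in> darts G \<or> dag G a \<in> darts G"
    and *: "\<And>W. W \<subseteq> verts G \<Longrightarrow>
      (\<And>a. a \<in> darts G \<Longrightarrow> dag G a \<in> darts G \<Longrightarrow> tgt G a \<in> W \<Longrightarrow> tgt G (dag G a) \<in> W) \<Longrightarrow>
      W = {} \<or> W = verts G"
  shows "connected_ugraph G"
proof -
  note u = ugraphD[OF assms(1)]
  have "A = {} \<and> W = {} \<or> A = arcs G \<and> W = verts G"
    if A: "A \<subseteq> arcs G" "W \<subseteq> verts G" "\<forall>a\<in>A. dag G a \<in> A" "\<forall>a\<in>darts G. a \<in> A \<longleftrightarrow> tgt G a \<in> W" for A W
  proof -
    have dA: "a \<in> A \<longleftrightarrow> dag G a \<in> A" if "a \<in> arcs G" for a using A(3) u(5)[OF that] by metis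
    have "W = {} \<or> W = verts G"
      by (rule *[OF A(2)]) (use A(3,4) in blast)
    then show ?thesis
    proof
      assume W: "W = {}"
      have "A = {}" using assms(3) dA A(1,4) W by blast
      then show ?thesis using W by blast
    next
      assume W: "W = verts G"
      have "a \<in> A" if "a \<in> arcs G" for a
        using assms(3)[OF that] dA[OF that] A(4) W u(9) by blast
      then show ?thesis using W A(1) by blast
    qed
  qed
  then show ?thesis unfolding connected_ugraph_def using assms(1,2) by blast
qed

lemma etaleD:
  assumes "etale H G f"
  shows "fst f \<in> arcs H \<rightarrow>\<^sub>E arcs G" "snd f \<in> verts H \<rightarrow>\<^sub>E verts G"
    "a \<in> arcs H \<Longrightarrow> fst f a \<in> arcs G" "v \<in> verts H \<Longrightarrow> snd f v \<in> verts G"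
    "a \<in> arcs H \<Longrightarrow> fst f (dag H a) = dag G (fst f a)"
    "a \<in> darts H \<Longrightarrow> fst f a \<in> darts G"
    "a \<in> darts H \<Longrightarrow> tgt G (fst f a) = snd f (tgt H a)"
    "v \<in> verts H \<Longrightarrow> bij_betw (fst f) (nb H v) (nb G (snd f v))"
  using assms unfolding etale_def by (auto simp: PiE_iff)

lemma embeddingD:
  assumes "embedding H G f"
  shows "connected_ugraph H" "connected_ugraph G" "etale H G f" "inj_on (snd f) (verts H)"
    "nodeless_loop H \<Longrightarrow> nodeless_loop G"
  using assms unfolding embedding_def by auto

text \<open>Darts with the same image sit at vertices with the same image, hence at the same vertex,
  and an etale map is injective on the darts at one vertex.\<close>

lemma embedding_inj_darts:
  assumes f: "embedding H G f" and "a \<in> darts H" "b \<in> darts H" "fst f a = fst f b"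
  shows "a = b"
proof -
  note e = etaleD[OF embeddingD(3)[OF f]]
  note u = ugraphD[OF connected_ugraphD(1)[OF embeddingD(1)[OF f]]]
  have "tgt H a = tgt H b"
    using e(7)[OF assms(2)] e(7)[OF assms(3)] assms(4) embeddingD(4)[OF f] u(9)[OF assms(2)] u(9)[OF assms(3)]
    by (metis inj_onD)
  then have "a \<in> nb H (tgt H a)" "b \<in> nb H (tgt H a)" using assms unfolding nb_def by auto
  then show ?thesis using e(8)[OF u(9)[OF assms(2)]] assms(4) by (meson bij_betw_imp_inj_on inj_onD)
qed

lemma etale_lift_dart:
  assumes f: "etale H G f" and "y \<in> darts G" "tgt G y \<in> snd f ` verts H"
  obtains a where "a \<in> darts H" "fst f a = y"
proof -
  obtain v where v: "v \<in> verts H" "tgt G y = snd f v" using assms(3) by auto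
  have "y \<in> nb G (snd f v)" using assms(2) v unfolding nb_def by auto
  then obtain a where "a \<in> nb H v" "fst f a = y"
    using bij_betw_imp_surj_on[OF etaleD(8)[OF f v(1)]] by (metis imageE)
  then show ?thesis using that unfolding nb_def by auto
qed

text \<open>An arc of the domain of an embedding is determined by its image and by which of the two
  arcs of its edge are attached to vertices; which combinations occur can be read off from the
  images of the vertices and of the boundary.\<close>

lemma embedding_arc_eqI:
  assumes f: "embedding H G f" and a: "a \<in> arcs H" and b: "b \<in> arcs H" and eq: "fst f a = fst f b"
    and d: "a \<in> darts H \<longleftrightarrow> b \<in> darts H" "dag H a \<in> darts H \<longleftrightarrow> dag H b \<in> darts H"
  shows "a = b"
proof -
  note e = etaleD[OF embeddingD(3)[OF f]]
  note u = ugraphD[OF connected_ugraphD(1)[OF embeddingD(1)[OF f]]]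
  note u' = ugraphD[OF connected_ugraphD(1)[OF embeddingD(2)[OF f]]]
  consider "a \<in> darts H" | "dag H a \<in> darts H" | "a \<notin> darts H" "dag H a \<notin> darts H" by blast
  then show ?thesis
  proof cases
    case 1 then show ?thesis using embedding_inj_darts[OF f 1] d eq by blast
  next
    case 2
    have "dag H a = dag H b"
      by (rule embedding_inj_darts[OF f]) (use 2 d e(5)[OF a] e(5)[OF b] eq in auto)
    then show ?thesis using u(5)[OF a] u(5)[OF b] by metis
  next
    case 3
    then have "b = a \<or> b = dag H a" using connected_isolated_arc(2)[OF embeddingD(1)[OF f] a 3] b by auto
    then show ?thesis using e(5)[OF a] eq u'(6)[OF e(3)[OF a]] by auto
  qed
qed

text \<open>A boundary arc is never a dart, and its partner is a dart exactly when the graph has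
  vertices. All boundary arcs are thus attached in the same way, and their images tell them
  apart.\<close>

lemma embedding_inj_bnd:
  assumes f: "embedding H G f"
  shows "inj_on (fst f) (bnd H)"
proof (rule inj_onI)
  fix a b assume a: "a \<in> bnd H" and b: "b \<in> bnd H" and eq: "fst f a = fst f b"
  note H = embeddingD(1)[OF f]
  note u = ugraphD[OF connected_ugraphD(1)[OF H]]
  show "a = b"
  proof (rule embedding_arc_eqI[OF f _ _ eq])
    show "dag H a \<in> darts H \<longleftrightarrow> dag H b \<in> darts H"
      using connected_verts_dart[OF H, of a] connected_verts_dart[OF H, of b] connected_no_verts(1)[OF H] a b u(11,12)
      by (cases "verts H = {}") auto
  qed (use a b u(11,12) in auto)
qed

text \<open>A dart lifts through the vertex it is attached to. Suppose the lift and the dart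
  differed at the opposite end. One opposite end would be a boundary arc, and equality of the
  boundary images would yield a boundary arc of the other graph whose partner, by injectivity on
  darts, is the given dart; so that boundary arc would be a dart. Without vertices the boundary
  decides between an edge and a nodeless loop.\<close>

lemma embedding_arc_lift:
  assumes f: "embedding H G f" and g: "embedding K G g"
    and V: "snd f ` verts H = snd g ` verts K" and B: "fst f ` bnd H = fst g ` bnd K" and a: "a \<in> arcs H"
  shows "\<exists>b\<in>arcs K. fst g b = fst f a \<and> (b \<in> darts K \<longleftrightarrow> a \<in> darts H) \<and> (dag K b \<in> darts K \<longleftrightarrow> dag H a \<in> darts H)"
proof -
  note H = embeddingD(1)[OF f] and K = embeddingD(1)[OF g] and G = embeddingD(2)[OF f]
  note ef = etaleD[OF embeddingD(3)[OF f]] and eg = etaleD[OF embeddingD(3)[OF g]]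
  note uH = ugraphD[OF connected_ugraphD(1)[OF H]] and uK = ugraphD[OF connected_ugraphD(1)[OF K]]
    and uG = ugraphD[OF connected_ugraphD(1)[OF G]]
  show ?thesis
  proof (cases "verts H = {}")
    case True
    then have K0: "verts K = {}" using V by auto
    note nH = connected_no_verts[OF H True] and nK = connected_no_verts[OF K K0]
    have "fst f a \<in> fst g ` arcs K"
    proof (cases "bnd H = {}")
      case False
      then have "bnd H = arcs H" using nH(4) unfolding nodeless_loop_def by auto
      then have "fst f a \<in> fst g ` bnd K" using B a by auto
      then show ?thesis using uK(11) by auto
    next
      case True
      then have "nodeless_loop G" using nodeless_loop_iff[OF H] \<open>verts H = {}\<close> embeddingD(5)[OF f] by auto
      then have "verts G = {}" unfolding nodeless_loop_def by auto
      moreover obtain b where b: "b \<in> arcs K" using nK(2) by (metis card.empty ex_in_conv zero_neq_numeral)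
      ultimately have "arcs G = {fst g b, dag G (fst g b)}"
        using connected_no_verts(3)[OF G, of "fst g b"] eg(3)[OF b] by auto
      also have "\<dots> \<subseteq> fst g ` arcs K" using b eg(5)[OF b, symmetric] uK(4) by auto
      finally show ?thesis using ef(3)[OF a] by auto
    qed
    then show ?thesis using nH nK by fastforce
  next
    case False
    then have K0: "verts K \<noteq> {}" using V by auto
    note bH = connected_verts_bnd[OF H False] and bK = connected_verts_bnd[OF K K0]
    have key: "\<exists>b\<in>arcs K. fst g b = fst f a \<and> b \<in> darts K \<and> (dag K b \<in> darts K \<longleftrightarrow> dag H a \<in> darts H)"
      if a: "a \<in> darts H" for a
    proof -
      have aH: "a \<in> arcs H" using a uH by auto
      have "tgt G (fst f a) \<in> snd g ` verts K" using V ef(7)[OF a] uH(9)[OF a] by auto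
      then obtain b where b: "b \<in> darts K" "fst g b = fst f a" using etale_lift_dart[OF embeddingD(3)[OF g] ef(6)[OF a]] by metis
      have bK': "b \<in> arcs K" using b uK by auto
      have eqd: "fst g (dag K b) = fst f (dag H a)" using eg(5)[OF bK'] ef(5)[OF aH] b by simp
      have "dag K b \<in> darts K" if d: "dag H a \<in> darts H"
      proof (rule ccontr)
        assume "dag K b \<notin> darts K"
        then have "dag K b \<in> bnd K" using bK uK(4)[OF bK'] by auto
        then obtain c where c: "c \<in> bnd H" "fst f c = fst f (dag H a)" using B eqd by (metis imageE imageI)
        then have cH: "c \<in> arcs H" "c \<notin> darts H" "dag H c \<in> darts H"
          using bH connected_verts_dart[OF H False, of c] by auto
        have "dag H c = a"
          by (rule embedding_inj_darts[OF f cH(3) a]) (use c ef(5) cH uH aH uG ef in metis)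
        then show False using cH uH d by metis
      qed
      moreover have "dag H a \<in> darts H" if d: "dag K b \<in> darts K"
      proof (rule ccontr)
        assume "dag H a \<notin> darts H"
        then have "dag H a \<in> bnd H" using bH uH(4)[OF aH] by auto
        then obtain c where c: "c \<in> bnd K" "fst g c = fst g (dag K b)" using B eqd by (metis imageE imageI)
        then have cK: "c \<in> arcs K" "c \<notin> darts K" "dag K c \<in> darts K"
          using bK connected_verts_dart[OF K K0, of c] by auto
        have "dag K c = b"
          by (rule embedding_inj_darts[OF g cK(3) b(1)]) (use c eg(5) cK uK bK' uG eg in metis)
        then show False using cK uK d by metis
      qed
      ultimately show ?thesis using b bK' by blast
    qed
    show ?thesis
    proof (cases "a \<in> darts H")
      case True then show ?thesis using key[OF True] by blast
    next
      case False
      then have d: "dag H a \<in> darts H" using connected_verts_dart[OF H \<open>verts H \<noteq> {}\<close> a] by blast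
      obtain b where b: "b \<in> arcs K" "fst g b = fst f (dag H a)" "b \<in> darts K" "dag K b \<in> darts K \<longleftrightarrow> a \<in> darts H"
        using key[OF d] uH(5)[OF a] by auto
      have "fst g (dag K b) = fst f a" using eg(5)[OF b(1)] b(2) ef(5)[OF a] uG(5)[OF ef(3)[OF a]] by simp
      then show ?thesis using b d False uK(4,5)[OF b(1)] by (intro bexI[of _ "dag K b"]) auto
    qed
  qed
qed

text \<open>The relation \<open>P\<close> pairs arcs with equal images and equal attachment at both
  ends. It is total and single-valued in both directions by the two preceding facts on arcs, hence
  the graph of a bijection, and this bijection automatically respects vertices because the second
  embedding is injective on them.\<close>

lemma embedding_isoI:
  assumes f: "embedding H G f" and g: "embedding K G g"
    and V: "snd f ` verts H = snd g ` verts K" and B: "fst f ` bnd H = fst g ` bnd K"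
  shows "\<exists>z. ugraph_iso H K z \<and> (\<forall>a\<in>arcs H. fst f a = fst g (fst z a)) \<and>
    (\<forall>v\<in>verts H. snd f v = snd g (snd z v))"
proof -
  note H = embeddingD(1)[OF f] and K = embeddingD(1)[OF g] and G = embeddingD(2)[OF f]
  note ef = etaleD[OF embeddingD(3)[OF f]] and eg = etaleD[OF embeddingD(3)[OF g]]
  note uH = ugraphD[OF connected_ugraphD(1)[OF H]] and uK = ugraphD[OF connected_ugraphD(1)[OF K]]
  note injV = embeddingD(4)[OF g] and injVf = embeddingD(4)[OF f]
  define P where "P a b \<longleftrightarrow> b \<in> arcs K \<and> fst g b = fst f a \<and> (b \<in> darts K \<longleftrightarrow> a \<in> darts H) \<and>
    (dag K b \<in> darts K \<longleftrightarrow> dag H a \<in> darts H)" for a b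
  have uniq: "b = c" if "P a b" "P a c" for a b c
    using that unfolding P_def by (auto intro: embedding_arc_eqI[OF g])
  have uniq': "a = a'" if "P a b" "P a' b" "a \<in> arcs H" "a' \<in> arcs H" for a a' b
    using that unfolding P_def by (auto intro: embedding_arc_eqI[OF f])
  have ex': "\<exists>a\<in>arcs H. P a b" if "b \<in> arcs K" for b
    using embedding_arc_lift[OF g f V[symmetric] B[symmetric] that] that unfolding P_def by metis
  define z0 where "z0 = restrict (\<lambda>a. SOME b. P a b) (arcs H)"
  have z0: "P a (z0 a)" if "a \<in> arcs H" for a
    unfolding z0_def restrict_apply'[OF that]
    by (rule someI_ex) (use embedding_arc_lift[OF f g V B that] in \<open>unfold P_def, blast\<close>)
  have z0I: "z0 a = b" if "a \<in> arcs H" "P a b" for a b using uniq z0 that by blast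
  define z1 where "z1 = restrict (\<lambda>v. inv_into (verts K) (snd g) (snd f v)) (verts H)"
  have z1: "z1 v \<in> verts K" "snd g (z1 v) = snd f v" if "v \<in> verts H" for v
  proof -
    have "snd f v \<in> snd g ` verts K" using V that by auto
    then show "z1 v \<in> verts K" "snd g (z1 v) = snd f v"
      using that unfolding z1_def by (simp_all add: inv_into_into f_inv_into_f)
  qed
  have z0K: "z0 a \<in> arcs K" "fst g (z0 a) = fst f a" if "a \<in> arcs H" for a
    using z0[OF that] unfolding P_def by auto
  have dag: "z0 (dag H a) = dag K (z0 a)" if a: "a \<in> arcs H" for a
    by (rule z0I) (use z0[OF a] uH(4,5)[OF a] uK(4,5) ef(5)[OF a] eg(5) in \<open>auto simp: P_def\<close>)
  have dart: "z0 a \<in> darts K" "tgt K (z0 a) = z1 (tgt H a)" if a: "a \<in> darts H" for a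
  proof -
    have aH: "a \<in> arcs H" using a uH by auto
    show d: "z0 a \<in> darts K" using z0[OF aH] a unfolding P_def by auto
    have "snd g (tgt K (z0 a)) = snd g (z1 (tgt H a))"
      using eg(7)[OF d] z0K[OF aH] ef(7)[OF a] z1(2)[OF uH(9)[OF a]] by simp
    then show "tgt K (z0 a) = z1 (tgt H a)"
      using injV uK(9)[OF d] z1(1)[OF uH(9)[OF a]] by (meson inj_onD)
  qed
  have inj0: "inj_on z0 (arcs H)" using z0 uniq' by (metis inj_onI)
  have lift: "\<exists>a\<in>arcs H. z0 a = b" if b: "b \<in> arcs K" for b using ex'[OF b] z0I by blast
  have dartiff: "z0 a \<in> darts K \<longleftrightarrow> a \<in> darts H" if "a \<in> arcs H" for a using z0[OF that] unfolding P_def by auto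
  have "inj_on z1 (verts H)" using z1 injVf by (metis inj_on_def)
  have z1surj: "z1 ` verts H = verts K"
  proof
    show "z1 ` verts H \<subseteq> verts K" using z1 by auto
    show "verts K \<subseteq> z1 ` verts H"
    proof
      fix w assume w: "w \<in> verts K"
      then obtain v where v: "v \<in> verts H" "snd g w = snd f v" using V by (metis imageE imageI)
      then have "z1 v = w" using z1[OF v(1)] injV w by (metis inj_onD)
      then show "w \<in> z1 ` verts H" using v by auto
    qed
  qed
  have "bij_betw z0 (nb H v) (nb K (z1 v))" if v: "v \<in> verts H" for v
    unfolding bij_betw_def
  proof
    show "inj_on z0 (nb H v)" using inj0 uH(7) unfolding nb_def by (auto simp: inj_on_def)
    show "z0 ` nb H v = nb K (z1 v)"
    proof
      show "z0 ` nb H v \<subseteq> nb K (z1 v)" using dart unfolding nb_def by auto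
      show "nb K (z1 v) \<subseteq> z0 ` nb H v"
      proof
        fix b assume b: "b \<in> nb K (z1 v)"
        then obtain a where a: "a \<in> arcs H" "z0 a = b" using lift uK unfolding nb_def by blast
        then have d: "a \<in> darts H" using b dartiff unfolding nb_def by auto
        have "z1 (tgt H a) = z1 v" using dart[OF d] a b unfolding nb_def by auto
        then have "tgt H a = v" using \<open>inj_on z1 (verts H)\<close> v uH(9)[OF d] by (meson inj_onD)
        then show "b \<in> z0 ` nb H v" using a d unfolding nb_def by auto
      qed
    qed
  qed
  then have "etale H K (z0, z1)"
    unfolding etale_def using z0K z1 dag dart by (auto simp: z0_def z1_def)
  moreover have "bij_betw z0 (arcs H) (arcs K)"
    unfolding bij_betw_def using inj0 z0K lift by blast
  moreover have "bij_betw z1 (verts H) (verts K)"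
    unfolding bij_betw_def using \<open>inj_on z1 (verts H)\<close> z1surj by blast
  moreover have dim: "z0 ` darts H = darts K"
    using dart(1) dartiff lift uK(7) by blast
  moreover have "z0 ` bnd H = bnd K"
  proof (cases "verts H = {}")
    case False
    then have "verts K \<noteq> {}" using V by auto
    then have "bnd H = arcs H - darts H" "bnd K = arcs K - darts K"
      using connected_verts_bnd H K False by auto
    moreover have "z0 ` (arcs H - darts H) = arcs K - darts K" using z0K lift dartiff by blast
    ultimately show ?thesis by simp
  next
    case True
    then have "verts K = {}" using V by auto
    \<comment> \<open>Without vertices each graph is an edge or a nodeless loop, and these differ
      only in whether the boundary is everything or empty; assumption \<open>B\<close> excludes the
      mixed case.\<close>
    then have "bnd H = arcs H \<or> bnd H = {}" "bnd K = arcs K \<or> bnd K = {}"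
      using connected_no_verts(4) H K True unfolding nodeless_loop_def by auto
    moreover have "bnd H = {} \<longleftrightarrow> bnd K = {}" using B by auto
    moreover have "z0 ` arcs H = arcs K" using z0K lift by blast
    ultimately show ?thesis by auto
  qed
  ultimately have "ugraph_iso H K (z0, z1)" unfolding ugraph_iso_def by simp
  then show ?thesis using z0K z1 by (intro exI[of _ "(z0, z1)"]) auto
qed

section \<open>Composition and isomorphisms of embeddings\<close>

definition comp_map :: "('a, 'v) ugraph \<Rightarrow> ('b \<Rightarrow> 'c) \<times> ('w \<Rightarrow> 'u) \<Rightarrow> ('a \<Rightarrow> 'b) \<times> ('v \<Rightarrow> 'w) \<Rightarrow> ('a \<Rightarrow> 'c) \<times> ('v \<Rightarrow> 'u)" where
  "comp_map H k j = (restrict (\<lambda>a. fst k (fst j a)) (arcs H), restrict (\<lambda>v. snd k (snd j v)) (verts H))"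

lemma comp_map_simps [simp]:
  "a \<in> arcs H \<Longrightarrow> fst (comp_map H k j) a = fst k (fst j a)"
  "v \<in> verts H \<Longrightarrow> snd (comp_map H k j) v = snd k (snd j v)"
  by (simp_all add: comp_map_def)

lemma etale_comp:
  assumes H: "ugraph H" and j: "etale H K j" and k: "etale K G k"
  shows "etale H G (comp_map H k j)"
proof -
  note u = ugraphD[OF H] and j' = etaleD[OF j] and k' = etaleD[OF k]
  have "bij_betw (fst (comp_map H k j)) (nb H v) (nb G (snd k (snd j v)))" if "v \<in> verts H" for v
  proof -
    have "bij_betw (fst k \<circ> fst j) (nb H v) (nb G (snd k (snd j v)))"
      by (rule bij_betw_trans[OF j'(8)[OF that] k'(8)[OF j'(4)[OF that]]])
    then show ?thesis
      by (rule bij_betw_cong[THEN iffD1, rotated]) (use u(7) in \<open>auto simp: nb_def\<close>)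
  qed
  then show ?thesis
    unfolding etale_def using u j' k' by (auto simp: comp_map_def)
qed

lemma embedding_comp:
  assumes j: "embedding H K j" and k: "embedding K G k"
  shows "embedding H G (comp_map H k j)"
proof -
  note e = embeddingD[OF j] and e' = embeddingD[OF k]
  have "inj_on (snd (comp_map H k j)) (verts H)"
    using e(4) e'(4) etaleD(4)[OF e(3)] by (auto simp: inj_on_def)
  then show ?thesis
    using etale_comp[OF connected_ugraphD(1)[OF e(1)] e(3) e'(3)] e e' unfolding embedding_def by blast
qed

lemma comp_map_image:
  assumes "ugraph H"
  shows "snd (comp_map H k j) ` verts H = snd k ` snd j ` verts H"
    "fst (comp_map H k j) ` bnd H = fst k ` fst j ` bnd H"
  using ugraphD(11)[OF assms] by (auto simp: image_image intro!: image_cong)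

lemma ugraph_iso_nodeless:
  assumes "ugraph_iso H G z" "nodeless_loop H"
  shows "nodeless_loop G"
  using assms bij_betw_same_card[of "fst z" "arcs H" "arcs G"]
  unfolding ugraph_iso_def nodeless_loop_def by (auto simp: bij_betw_def)

lemma ugraph_iso_embedding:
  assumes "ugraph_iso H G z" "connected_ugraph H" "connected_ugraph G"
  shows "embedding H G z"
  using assms ugraph_iso_nodeless[OF assms(1)] unfolding embedding_def ugraph_iso_def bij_betw_def by blast

lemma ugraph_iso_connected:
  assumes z: "ugraph_iso H G z" and H: "ugraph H" and G: "connected_ugraph G"
  shows "connected_ugraph H"
proof -
  have e: "etale H G z" and b0: "bij_betw (fst z) (arcs H) (arcs G)" and b1: "bij_betw (snd z) (verts H) (verts G)"
    and d: "fst z ` darts H = darts G" using z unfolding ugraph_iso_def by auto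
  note e' = etaleD[OF e] and u = ugraphD[OF H]
  have inj: "inj_on (fst z) (arcs H)" "inj_on (snd z) (verts H)"
    and surj: "fst z ` arcs H = arcs G" "snd z ` verts H = verts G"
    using b0 b1 unfolding bij_betw_def by auto
  have "A = {} \<and> W = {} \<or> A = arcs H \<and> W = verts H"
    if A: "A \<subseteq> arcs H" "W \<subseteq> verts H" "\<forall>a\<in>A. dag H a \<in> A" "\<forall>a\<in>darts H. a \<in> A \<longleftrightarrow> tgt H a \<in> W" for A W
  proof -
    have mA: "fst z a \<in> fst z ` A \<longleftrightarrow> a \<in> A" if "a \<in> arcs H" for a
      using inj_on_image_mem_iff[OF inj(1) that A(1)] .
    have mW: "snd z a \<in> snd z ` W \<longleftrightarrow> a \<in> W" if "a \<in> verts H" for a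
      using inj_on_image_mem_iff[OF inj(2) that A(2)] .
    have "fst z ` A = {} \<and> snd z ` W = {} \<or> fst z ` A = arcs G \<and> snd z ` W = verts G"
    proof -
      have "\<forall>b\<in>fst z ` A. dag G b \<in> fst z ` A" using A(1,3) e'(5)[symmetric] by auto
      moreover have "\<forall>b\<in>darts G. b \<in> fst z ` A \<longleftrightarrow> tgt G b \<in> snd z ` W"
      proof
        fix b assume "b \<in> darts G"
        then obtain a where a: "a \<in> darts H" "b = fst z a" using d by auto
        have "b \<in> fst z ` A \<longleftrightarrow> a \<in> A" using mA[OF subsetD[OF u(7) a(1)]] unfolding a(2) .
        also have "\<dots> \<longleftrightarrow> tgt H a \<in> W" using A a by auto
        also have "\<dots> \<longleftrightarrow> tgt G b \<in> snd z ` W" using mW[OF u(9)[OF a(1)]] e'(7)[OF a(1)] a by simp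
        finally show "b \<in> fst z ` A \<longleftrightarrow> tgt G b \<in> snd z ` W" .
      qed
      ultimately show ?thesis
        using G A(1,2) surj unfolding connected_ugraph_def by (metis image_mono)
    qed
    then show ?thesis
      unfolding surj[symmetric] inj_on_image_eq_iff[OF inj(1) A(1) subset_refl]
        inj_on_image_eq_iff[OF inj(2) A(2) subset_refl] by simp
  qed
  moreover have "arcs H \<noteq> {} \<or> verts H \<noteq> {}" using connected_ugraphD(2)[OF G] surj by auto
  ultimately show ?thesis using H unfolding connected_ugraph_def by blast
qed

section \<open>Classes of embeddings\<close>

text \<open>Equal images of vertices and boundary produce an isomorphism over \<open>G\<close> by
  \<open>embedding_isoI\<close>. Membership in a class thereby becomes a test on two sets, which is
  the form used from here on.\<close>

lemma emb_class_eq: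
  assumes h: "embedding (fst h) G (snd h)"
  shows "emb_class G h = {f. embedding (fst f) G (snd f) \<and>
    snd (snd f) ` verts (fst f) = snd (snd h) ` verts (fst h) \<and>
    fst (snd f) ` bnd (fst f) = fst (snd h) ` bnd (fst h)}" (is "_ = ?R")
proof (intro equalityI subsetI)
  fix f assume "f \<in> emb_class G h"
  then obtain z where f: "embedding (fst f) G (snd f)" and z: "ugraph_iso (fst f) (fst h) z"
    and ft: "factors_through f h z" unfolding emb_class_def by auto
  have "snd (snd f) ` verts (fst f) = snd (snd h) ` snd z ` verts (fst f)"
    using ft unfolding factors_through_def by (auto simp: image_image intro!: image_cong)
  moreover have "fst (snd f) ` bnd (fst f) = fst (snd h) ` fst z ` bnd (fst f)"
    using ft ugraphD(11)[OF connected_ugraphD(1)[OF embeddingD(1)[OF f]]]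
    unfolding factors_through_def by (auto simp: image_image intro!: image_cong)
  ultimately show "f \<in> ?R" using f z unfolding ugraph_iso_def by (auto simp: bij_betw_def)
next
  fix f assume "f \<in> ?R"
  then show "f \<in> emb_class G h"
    using embedding_isoI[of "fst f" G "snd f" "fst h" "snd h"] h
    unfolding emb_class_def factors_through_def by auto
qed

lemma EmbD:
  assumes "c \<in> Emb G"
  shows "\<exists>h. h \<in> c"
    and "f \<in> c \<Longrightarrow> embedding (fst f) G (snd f)"
    and "f \<in> c \<Longrightarrow> emb_verts c = snd (snd f) ` verts (fst f)"
    and "f \<in> c \<Longrightarrow> emb_bnd c = fst (snd f) ` bnd (fst f)"
    and "embedding (fst f) G (snd f) \<Longrightarrow> snd (snd f) ` verts (fst f) = emb_verts c \<Longrightarrow>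
      fst (snd f) ` bnd (fst f) = emb_bnd c \<Longrightarrow> f \<in> c"
proof -
  obtain h where h: "embedding (fst h) G (snd h)" "c = emb_class G h"
    using assms unfolding Emb_def by auto
  note eq = emb_class_eq[OF h(1)]
  have hc: "h \<in> c" using h eq by auto
  have memh: "f \<in> c \<longleftrightarrow> embedding (fst f) G (snd f) \<and> snd (snd f) ` verts (fst f) = snd (snd h) ` verts (fst h) \<and>
    fst (snd f) ` bnd (fst f) = fst (snd h) ` bnd (fst h)" for f
    unfolding h(2) eq by (rule mem_Collect_eq)
  have V: "emb_verts c = snd (snd h) ` verts (fst h)"
    unfolding emb_verts_def by (rule SUP_eq_const) (use hc memh in blast)+
  have B: "emb_bnd c = fst (snd h) ` bnd (fst h)"
    unfolding emb_bnd_def by (rule SUP_eq_const) (use hc memh in blast)+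
  have mem: "f \<in> c \<longleftrightarrow> embedding (fst f) G (snd f) \<and>
    snd (snd f) ` verts (fst f) = emb_verts c \<and> fst (snd f) ` bnd (fst f) = emb_bnd c"
    unfolding V B by (rule memh)
  show "\<exists>h. h \<in> c" using hc ..
  show "f \<in> c \<Longrightarrow> embedding (fst f) G (snd f)" "f \<in> c \<Longrightarrow> emb_verts c = snd (snd f) ` verts (fst f)"
    "f \<in> c \<Longrightarrow> emb_bnd c = fst (snd f) ` bnd (fst f)"
    unfolding mem by simp_all
  show "embedding (fst f) G (snd f) \<Longrightarrow> snd (snd f) ` verts (fst f) = emb_verts c \<Longrightarrow>
      fst (snd f) ` bnd (fst f) = emb_bnd c \<Longrightarrow> f \<in> c"
    unfolding mem by simp
qed

lemma Emb_connected: "c \<in> Emb G \<Longrightarrow> connected_ugraph G"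
  using EmbD(1,2) embeddingD(2) by blast

lemma Emb_eqI:
  assumes "c \<in> Emb G" "d \<in> Emb G" "emb_verts c = emb_verts d" "emb_bnd c = emb_bnd d"
  shows "c = d"
  using EmbD[OF assms(1)] EmbD[OF assms(2)] assms(3,4) by (metis subsetI subset_antisym)

lemma Emb_subset:
  assumes "c \<in> Emb G"
  shows "emb_verts c \<subseteq> verts G" "emb_bnd c \<subseteq> arcs G" "finite (emb_bnd c)"
proof -
  obtain h where h: "h \<in> c" using EmbD(1)[OF assms] ..
  note e = EmbD(2)[OF assms h]
  note e' = etaleD[OF embeddingD(3)[OF e]]
  show "emb_verts c \<subseteq> verts G" using EmbD(3)[OF assms h] e'(4) by auto
  show B: "emb_bnd c \<subseteq> arcs G"
    using EmbD(4)[OF assms h] e'(3) ugraphD(11)[OF connected_ugraphD(1)[OF embeddingD(1)[OF e]]] by auto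
  then show "finite (emb_bnd c)"
    using ugraphD(1)[OF connected_ugraphD(1)[OF embeddingD(2)[OF e]]] finite_subset by blast
qed

lemma emb_is_edge_iff:
  assumes c: "c \<in> Emb G"
  shows "emb_is_edge c \<longleftrightarrow> emb_verts c = {} \<and> emb_bnd c \<noteq> {}"
proof -
  have "edge_graph (fst f) \<longleftrightarrow> emb_verts c = {} \<and> emb_bnd c \<noteq> {}" if "f \<in> c" for f
    using edge_graph_iff[OF embeddingD(1)[OF EmbD(2)[OF c that]]] EmbD(3,4)[OF c that] by auto
  then show ?thesis using EmbD(1)[OF c] unfolding emb_is_edge_def by blast
qed

text \<open>A representative has neither vertices nor boundary, so its domain is a nodeless loop,
  and such a domain only embeds in a nodeless loop. This is how the conclusion of the condition on
  nodeless loops is reached later.\<close>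

lemma Emb_empty_nodeless:
  assumes c: "c \<in> Emb G" "emb_verts c = {}" "emb_bnd c = {}"
  shows "nodeless_loop G"
proof -
  obtain f where f: "f \<in> c" using EmbD(1)[OF c(1)] ..
  have "nodeless_loop (fst f)"
    using nodeless_loop_iff[OF embeddingD(1)[OF EmbD(2)[OF c(1) f]]] EmbD(3,4)[OF c(1) f] c by auto
  then show ?thesis using embeddingD(5)[OF EmbD(2)[OF c(1) f]] by blast
qed

section \<open>Relabelling graphs, and classes given by embeddings from other types\<close>

definition relabel :: "('a \<Rightarrow> 'b) \<Rightarrow> ('v \<Rightarrow> 'w) \<Rightarrow> ('a, 'v) ugraph \<Rightarrow> ('b, 'w) ugraph" where
  "relabel \<iota> \<mu> H = \<lparr>arcs = \<iota> ` arcs H, verts = \<mu> ` verts H,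
     dag = restrict (\<lambda>a. \<iota> (dag H (inv_into (arcs H) \<iota> a))) (\<iota> ` arcs H),
     darts = \<iota> ` darts H,
     tgt = restrict (\<lambda>a. \<mu> (tgt H (inv_into (arcs H) \<iota> a))) (\<iota> ` darts H),
     bnd = \<iota> ` bnd H\<rparr>"

text \<open>Transport of structure along injections. Classes consist of graphs on the types of their
  codomain, whereas star graphs and substituted graphs are built on other types.\<close>

lemma relabel:
  assumes H: "ugraph H" and \<iota>: "inj_on \<iota> (arcs H)" and \<mu>: "inj_on \<mu> (verts H)"
  shows "ugraph (relabel \<iota> \<mu> H)"
    and "ugraph_iso (relabel \<iota> \<mu> H) H
      (restrict (inv_into (arcs H) \<iota>) (\<iota> ` arcs H), restrict (inv_into (verts H) \<mu>) (\<mu> ` verts H))"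
proof -
  note u = ugraphD[OF H]
  have inv[simp]: "inv_into (arcs H) \<iota> (\<iota> a) = a" if "a \<in> arcs H" for a using \<iota> that by simp
  have invd[simp]: "inv_into (arcs H) \<iota> (\<iota> a) = a" if "a \<in> darts H" for a using \<iota> that u(7) by auto
  have invb[simp]: "inv_into (arcs H) \<iota> (\<iota> a) = a" if "a \<in> bnd H" for a using \<iota> that u(11) by auto
  have \<iota>eq: "\<iota> a = \<iota> b \<longleftrightarrow> a = b" if "a \<in> arcs H" "b \<in> arcs H" for a b
    using \<iota> that by (auto dest: inj_onD)
  have \<mu>eq: "\<mu> a = \<mu> b \<longleftrightarrow> a = b" if "a \<in> verts H" "b \<in> verts H" for a b
    using \<mu> that by (auto dest: inj_onD)
  have dA: "a \<in> arcs H" if "a \<in> darts H" for a using that u(7) by auto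
  have b: "\<iota> ` bnd H = \<iota> ` arcs H - \<iota> ` darts H" if "bnd H = arcs H - darts H"
    unfolding that using \<iota>eq dA by auto
  have n: "nodeless_loop (relabel \<iota> \<mu> H)" if "nodeless_loop H"
    using that card_image[OF \<iota>] unfolding nodeless_loop_def relabel_def by simp
  show "ugraph (relabel \<iota> \<mu> H)"
    unfolding ugraph_def using u(1,2,4-7,9,10) b n by (auto simp: relabel_def \<iota>eq PiE_iff)
  have i0: "inj_on (inv_into (arcs H) \<iota>) (\<iota> ` S)" if "S \<subseteq> arcs H" for S
    by (rule inj_on_inv_into) (use that in auto)
  have \<iota>eqd: "\<iota> a = \<iota> b \<longleftrightarrow> a = b" if "a \<in> darts H" "b \<in> darts H" for a b
    using \<iota>eq dA that by blast
  have "bij_betw (inv_into (arcs H) \<iota>) (nb (relabel \<iota> \<mu> H) (\<mu> v)) (nb H v)" if v: "v \<in> verts H" for v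
  proof -
    have "nb (relabel \<iota> \<mu> H) (\<mu> v) = \<iota> ` nb H v"
      using v u(9) by (auto simp: nb_def relabel_def \<mu>eq \<iota>eqd)
    moreover have "inv_into (arcs H) \<iota> ` \<iota> ` nb H v = nb H v"
      using dA by (force simp: nb_def)
    moreover have "nb H v \<subseteq> arcs H" using dA by (auto simp: nb_def)
    ultimately show ?thesis unfolding bij_betw_def using i0 by metis
  qed
  then have nbb: "bij_betw (restrict (inv_into (arcs H) \<iota>) (\<iota> ` arcs H)) (nb (relabel \<iota> \<mu> H) (\<mu> v)) (nb H v)"
    if v: "v \<in> verts H" for v
    using v u(7) by (subst bij_betw_cong[of _ _ "inv_into (arcs H) \<iota>"]) (auto simp: nb_def relabel_def)
  have "inv_into (arcs H) \<iota> ` \<iota> ` arcs H = arcs H" "inv_into (arcs H) \<iota> ` \<iota> ` darts H = darts H"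
    "inv_into (arcs H) \<iota> ` \<iota> ` bnd H = bnd H"
    by (auto simp: image_image)
  moreover have "restrict (inv_into (arcs H) \<iota>) (\<iota> ` arcs H) ` \<iota> ` S = inv_into (arcs H) \<iota> ` \<iota> ` S" if "S \<subseteq> arcs H" for S
    using that by (intro image_cong) auto
  ultimately have im: "restrict (inv_into (arcs H) \<iota>) (\<iota> ` arcs H) ` \<iota> ` arcs H = arcs H"
    "restrict (inv_into (arcs H) \<iota>) (\<iota> ` arcs H) ` \<iota> ` darts H = darts H"
    "restrict (inv_into (arcs H) \<iota>) (\<iota> ` arcs H) ` \<iota> ` bnd H = bnd H"
    using u(7,11) by auto
  have b0: "bij_betw (restrict (inv_into (arcs H) \<iota>) (\<iota> ` arcs H)) (\<iota> ` arcs H) (arcs H)"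
    using bij_betw_inv_into[OF inj_on_imp_bij_betw[OF \<iota>]] by simp
  have b1: "bij_betw (restrict (inv_into (verts H) \<mu>) (\<mu> ` verts H)) (\<mu> ` verts H) (verts H)"
    using bij_betw_inv_into[OF inj_on_imp_bij_betw[OF \<mu>]] by simp
  show "ugraph_iso (relabel \<iota> \<mu> H) H
      (restrict (inv_into (arcs H) \<iota>) (\<iota> ` arcs H), restrict (inv_into (verts H) \<mu>) (\<mu> ` verts H))"
    unfolding ugraph_iso_def etale_def
    using im b0 b1 nbb u(4,9) dA \<mu> by (auto simp: relabel_def)
qed

lemma finite_inj_infinite:
  assumes "finite (A :: 'b set)"
  shows "\<exists>f :: 'b \<Rightarrow> 'a::infinite. inj_on f A"
proof -
  obtain B :: "'a set" where "finite B" "card B = card A"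
    using infinite_arbitrarily_large[OF infinite_UNIV] by blast
  then show ?thesis using assms finite_same_card_bij[of A B] by (auto simp: bij_betw_def)
qed

text \<open>The finitely many arcs of \<open>H\<close> are renamed by any injection into the
  infinite type of arcs, and each vertex is renamed to its image under \<open>f\<close>, which is
  injective on vertices. So an embedding with a domain in arbitrary types has a class.\<close>

lemma embedding_Emb:
  fixes G :: "('a::infinite, 'v) ugraph" and H :: "('b, 'w) ugraph"
  assumes f: "embedding H G f"
  shows "\<exists>c\<in>Emb G. emb_verts c = snd f ` verts H \<and> emb_bnd c = fst f ` bnd H"
proof -
  note H = embeddingD(1)[OF f]
  note u = ugraphD[OF connected_ugraphD(1)[OF H]]
  obtain \<iota> :: "'b \<Rightarrow> 'a" where \<iota>: "inj_on \<iota> (arcs H)" using finite_inj_infinite[OF u(1)] ..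
  let ?H = "relabel \<iota> (snd f) H"
  obtain z where z: "ugraph ?H" "ugraph_iso ?H H z"
    using relabel[OF connected_ugraphD(1)[OF H] \<iota> embeddingD(4)[OF f]] by blast
  note e = embedding_comp[OF ugraph_iso_embedding[OF z(2) ugraph_iso_connected[OF z(2,1) H] H] f]
  let ?h = "(?H, comp_map ?H f z)"
  have c: "emb_class G ?h \<in> Emb G" "?h \<in> emb_class G ?h"
    unfolding Emb_def using e emb_class_eq[of ?h G] by (intro imageI, simp, simp)
  have "snd z ` verts ?H = verts H" "fst z ` bnd ?H = bnd H"
    using z(2) unfolding ugraph_iso_def by (auto simp: bij_betw_def)
  then show ?thesis
    using c EmbD(3,4)[OF c] comp_map_image[OF z(1), of f z] by (intro bexI[OF _ c(1)]) simp
qed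

text \<open>The order on classes refers to representatives in the types of \<open>G\<close>. Both
  given embeddings are isomorphic over \<open>G\<close> to such representatives by
  \<open>embedding_isoI\<close>, so a factorisation through graphs in any types is enough.\<close>

lemma emb_leI:
  assumes j: "embedding K M j" and m: "embedding M G m"
    and c: "c \<in> Emb G" "emb_verts c = snd m ` snd j ` verts K" "emb_bnd c = fst m ` fst j ` bnd K"
    and d: "d \<in> Emb G" "emb_verts d = snd m ` verts M" "emb_bnd d = fst m ` bnd M"
  shows "emb_le c d"
proof -
  obtain h k where h: "h \<in> c" and k: "k \<in> d" using EmbD(1) c(1) d(1) by metis
  note eh = EmbD(2)[OF c(1) h] and ek = EmbD(2)[OF d(1) k]
  note K = embeddingD(1)[OF j] and M = embeddingD(1)[OF m]
  obtain z1 where z1: "ugraph_iso (fst h) K z1"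
    "\<forall>a\<in>arcs (fst h). fst (snd h) a = fst (comp_map K m j) (fst z1 a)"
    "\<forall>v\<in>verts (fst h). snd (snd h) v = snd (comp_map K m j) (snd z1 v)"
    using embedding_isoI[OF eh embedding_comp[OF j m]] comp_map_image[OF connected_ugraphD(1)[OF K], of m j]
      EmbD(3,4)[OF c(1) h] c by auto
  obtain z2 where z2: "ugraph_iso M (fst k) z2"
    "\<forall>a\<in>arcs M. fst m a = fst (snd k) (fst z2 a)" "\<forall>v\<in>verts M. snd m v = snd (snd k) (snd z2 v)"
    using embedding_isoI[OF m ek] EmbD(3,4)[OF d(1) k] d by auto
  note e1 = ugraph_iso_embedding[OF z1(1) embeddingD(1)[OF eh] K]
    and e2 = ugraph_iso_embedding[OF z2(1) M embeddingD(1)[OF ek]]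
  let ?i = "comp_map (fst h) z2 (comp_map (fst h) j z1)"
  have "embedding (fst h) (fst k) ?i"
    by (rule embedding_comp[OF embedding_comp[OF e1 j] e2])
  moreover have "factors_through h k ?i"
    unfolding factors_through_def
    using z1(2,3) z2(2,3) etaleD(3,4)[OF embeddingD(3)[OF e1]] etaleD(3,4)[OF embeddingD(3)[OF j]] by simp
  ultimately show ?thesis unfolding emb_le_def using h k by blast
qed

lemma emb_leE:
  assumes "emb_le c d" and c: "c \<in> Emb G" and d: "d \<in> Emb G"
  obtains h k j where "h \<in> c" "k \<in> d" "embedding (fst h) (fst k) j"
    "\<And>a. a \<in> arcs (fst h) \<Longrightarrow> fst (snd h) a = fst (snd k) (fst j a)"
    "\<And>v. v \<in> verts (fst h) \<Longrightarrow> snd (snd h) v = snd (snd k) (snd j v)"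
  using assms(1) unfolding emb_le_def factors_through_def by blast

section \<open>Identities, stars and graphs without boundary\<close>

lemma embedding_id:
  assumes "connected_ugraph G"
  shows "embedding G G (restrict id (arcs G), restrict id (verts G))"
proof -
  note u = ugraphD[OF connected_ugraphD(1)[OF assms]]
  have "bij_betw (restrict id (arcs G)) (nb G v) (nb G v)" for v
    using u(7) by (subst bij_betw_cong[of _ _ id]) (auto simp: nb_def)
  then have "etale G G (restrict id (arcs G), restrict id (verts G))"
    unfolding etale_def using u(4,7,9) by auto
  then show ?thesis unfolding embedding_def using assms by (auto simp: inj_on_def)
qed

text \<open>The class of the identity. When a graph collapses under a map, the value at this class
  has neither vertices nor boundary, and that detects a nodeless loop as codomain.\<close>

lemma Emb_total:
  fixes G :: "('a::infinite, 'v) ugraph"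
  assumes "connected_ugraph G"
  shows "\<exists>c\<in>Emb G. emb_verts c = verts G \<and> emb_bnd c = bnd G"
proof -
  have "restrict id (arcs G) ` bnd G = bnd G"
    using ugraphD(11)[OF connected_ugraphD(1)[OF assms]] by force
  then show ?thesis using embedding_Emb[OF embedding_id[OF assms]] by simp
qed

text \<open>Both arcs of every edge at \<open>v\<close> are taken afresh, so that loops at \<open>v\<close> are cut open.\<close>

definition star_graph :: "('a, 'v) ugraph \<Rightarrow> 'v \<Rightarrow> ('a \<times> bool, 'v) ugraph" where
  "star_graph G v = \<lparr>arcs = nb G v \<times> UNIV, verts = {v},
     dag = restrict (\<lambda>(a, s). (a, \<not> s)) (nb G v \<times> UNIV), darts = nb G v \<times> {True},
     tgt = restrict (\<lambda>_. v) (nb G v \<times> {True}), bnd = nb G v \<times> {False}\<rparr>"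

text \<open>\<open>(a, True)\<close> lies over the dart \<open>a\<close> and
  \<open>(a, False)\<close> over its partner; a loop at \<open>v\<close> is therefore covered by
  four arcs.\<close>

definition star_map :: "('a, 'v) ugraph \<Rightarrow> 'v \<Rightarrow> ('a \<times> bool \<Rightarrow> 'a) \<times> ('v \<Rightarrow> 'v)" where
  "star_map G v = (restrict (\<lambda>(a, s). if s then a else dag G a) (nb G v \<times> UNIV), restrict id {v})"

lemma star_embedding:
  assumes G: "connected_ugraph G" and v: "v \<in> verts G"
  shows "embedding (star_graph G v) G (star_map G v)"
    "snd (star_map G v) ` verts (star_graph G v) = {v}"
    "fst (star_map G v) ` bnd (star_graph G v) = dag G ` nb G v"
proof -
  note u = ugraphD[OF connected_ugraphD(1)[OF G]]
  have nbA: "a \<in> arcs G" if "a \<in> nb G w" for a w using that u(7) unfolding nb_def by auto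
  have "finite (nb G v)" using u(1,7) finite_subset unfolding nb_def by (metis (no_types, lifting) mem_Collect_eq subsetI)
  then have U: "ugraph (star_graph G v)" unfolding ugraph_def star_graph_def by auto
  have C: "connected_ugraph (star_graph G v)"
    by (rule connected_ugraph_by_vertsI[OF U]) (auto simp: star_graph_def)
  have sm: "fst (star_map G v) (a, s) = (if s then a else dag G a)" if "a \<in> nb G v" for a s
    using that by (simp add: star_map_def)
  have prod: "nb G v \<times> {s} = (\<lambda>a. (a, s)) ` nb G v" for s :: bool by auto
  have "nb (star_graph G v) v = (\<lambda>a. (a, True)) ` nb G v" by (auto simp: star_graph_def nb_def)
  then have "bij_betw (fst (star_map G v)) (nb (star_graph G v) v) (nb G v)"
    unfolding bij_betw_def by (auto simp: sm image_image inj_on_def cong: image_cong)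
  then have "etale (star_graph G v) G (star_map G v)"
    unfolding etale_def using nbA u(4,5) v
    by (auto simp: star_graph_def star_map_def nb_def)
  then show "embedding (star_graph G v) G (star_map G v)"
    unfolding embedding_def using C G by (auto simp: star_graph_def nodeless_loop_def)
  show "snd (star_map G v) ` verts (star_graph G v) = {v}" by (simp add: star_map_def star_graph_def)
  show "fst (star_map G v) ` bnd (star_graph G v) = dag G ` nb G v"
    by (auto simp: star_graph_def prod image_image sm cong: image_cong)
qed

text \<open>Chosen by its vertex set and boundary, which determine it. Stars play the role of
  generators: the value of a graphical map at a vertex is the value of its induced function at the
  star.\<close>

definition star_class :: "('a::infinite, 'v) ugraph \<Rightarrow> 'v \<Rightarrow> ('a, 'v) emb set" where
  "star_class G v = (SOME c. c \<in> Emb G \<and> emb_verts c = {v} \<and> emb_bnd c = dag G ` nb G v)"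

lemma star_class:
  assumes "connected_ugraph G" "v \<in> verts G"
  shows "star_class G v \<in> Emb G" "emb_verts (star_class G v) = {v}"
    "emb_bnd (star_class G v) = dag G ` nb G v"
proof -
  have "\<exists>c. c \<in> Emb G \<and> emb_verts c = {v} \<and> emb_bnd c = dag G ` nb G v"
    using embedding_Emb[OF star_embedding(1)[OF assms]] star_embedding(2,3)[OF assms] by auto
  from someI_ex[OF this] show "star_class G v \<in> Emb G" "emb_verts (star_class G v) = {v}"
    "emb_bnd (star_class G v) = dag G ` nb G v" unfolding star_class_def by simp_all
qed

text \<open>If \<open>H\<close> has vertices and no boundary, all of its arcs are darts, so its
  image is closed under the involution and under attachment in both directions; connectedness of
  \<open>L\<close> makes it everything. If \<open>H\<close> has no vertices, it is a nodeless loop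
  and so is \<open>L\<close>.\<close>

lemma embedding_closed:
  assumes j: "embedding H L j" and b: "bnd H = {}"
  shows "bnd L = {}" "snd j ` verts H = verts L"
proof -
  note H = embeddingD(1)[OF j] and L = embeddingD(2)[OF j]
  note e = etaleD[OF embeddingD(3)[OF j]]
  note u = ugraphD[OF connected_ugraphD(1)[OF H]] and uL = ugraphD[OF connected_ugraphD(1)[OF L]]
  have "bnd L = {} \<and> snd j ` verts H = verts L"
  proof (cases "verts H = {}")
    case True
    then have "nodeless_loop L" using nodeless_loop_iff[OF H] b embeddingD(5)[OF j] by auto
    then show ?thesis using True unfolding nodeless_loop_def by auto
  next
    case False
    have dH: "darts H = arcs H" using connected_verts_bnd[OF H False] b u(7) by auto
    have "fst j ` arcs H = arcs L \<and> snd j ` verts H = verts L"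
    proof (intro conjI connected_ugraph_closed[OF L])
      show "a \<in> fst j ` arcs H \<Longrightarrow> dag L a \<in> fst j ` arcs H" for a using e(5)[symmetric] u(4) by auto
      then show "a \<in> fst j ` arcs H \<Longrightarrow> dag L a \<in> fst j ` arcs H" for a .
      show d: "a \<in> fst j ` arcs H \<longleftrightarrow> tgt L a \<in> snd j ` verts H" if "a \<in> darts L" for a
      proof
        assume "a \<in> fst j ` arcs H"
        then show "tgt L a \<in> snd j ` verts H" using dH e(7) u(9) by auto
      next
        assume "tgt L a \<in> snd j ` verts H"
        then show "a \<in> fst j ` arcs H"
          using etale_lift_dart[OF embeddingD(3)[OF j] that] dH by (metis imageI)
      qed
      then show "a \<in> fst j ` arcs H \<longleftrightarrow> tgt L a \<in> snd j ` verts H" if "a \<in> darts L" for a using that .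
    qed (use e(3,4) False in auto)
    moreover have "fst j ` darts H \<subseteq> darts L" using e(6) by auto
    ultimately show ?thesis using dH uL(11,12) by auto
  qed
  then show "bnd L = {}" "snd j ` verts H = verts L" by auto
qed

section \<open>Directed graphs as oriented graphs\<close>

lemma digraphD:
  assumes "digraph G"
  shows "finite (dE G)" "finite (dV G)" "dI G \<subseteq> dE G" "dO G \<subseteq> dE G"
    "dtI G \<in> dI G \<rightarrow>\<^sub>E dV G" "dtO G \<in> dO G \<rightarrow>\<^sub>E dV G"
    "e \<in> dI G \<Longrightarrow> dtI G e \<in> dV G" "e \<in> dO G \<Longrightarrow> dtO G e \<in> dV G"
    "din G = dE G - dO G \<and> dout G = dE G - dI G \<or> dnodeless_loop G"
    "din G \<subseteq> dE G" "dout G \<subseteq> dE G" "din G \<inter> dO G = {}" "dout G \<inter> dI G = {}"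
  using assms unfolding digraph_def dnodeless_loop_def by (auto simp: PiE_iff)

lemma connected_digraphD:
  assumes "connected_digraph G"
  shows "digraph G" "dE G \<noteq> {} \<or> dV G \<noteq> {}"
  using assms unfolding connected_digraph_def by auto

text \<open>A square of sets is a pullback exactly when it is bijective on the fibres over each
  vertex. In this form a local map is compared with an etale map.\<close>

lemma local_map_iff:
  assumes "digraph H"
  shows "local_map H G f \<longleftrightarrow>
    fst f \<in> dE H \<rightarrow>\<^sub>E dE G \<and> snd f \<in> dV H \<rightarrow>\<^sub>E dV G \<and>
    (\<forall>e\<in>dI H. fst f e \<in> dI G \<and> dtI G (fst f e) = snd f (dtI H e)) \<and>
    (\<forall>e\<in>dO H. fst f e \<in> dO G \<and> dtO G (fst f e) = snd f (dtO H e)) \<and>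
    (\<forall>v\<in>dV H. bij_betw (fst f) (in_at H v) (in_at G (snd f v))) \<and>
    (\<forall>v\<in>dV H. bij_betw (fst f) (out_at H v) (out_at G (snd f v)))"
proof -
  have aux: "bij_betw (\<lambda>e. (g e, t e)) I {(e, v). e \<in> I' \<and> v \<in> V \<and> t' e = k v} \<longleftrightarrow>
    (\<forall>v\<in>V. bij_betw g {e \<in> I. t e = v} {e \<in> I'. t' e = k v})"
    if t: "\<And>e. e \<in> I \<Longrightarrow> t e \<in> V" and g: "\<And>e. e \<in> I \<Longrightarrow> g e \<in> I' \<and> t' (g e) = k (t e)"
    for g :: "'x \<Rightarrow> 'y" and t :: "'x \<Rightarrow> 'u" and I I' V and t' :: "'y \<Rightarrow> 'z" and k
  proof
    assume b: "bij_betw (\<lambda>e. (g e, t e)) I {(e, v). e \<in> I' \<and> v \<in> V \<and> t' e = k v}"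
    show "\<forall>v\<in>V. bij_betw g {e \<in> I. t e = v} {e \<in> I'. t' e = k v}"
    proof
      fix v assume v: "v \<in> V"
      have "inj_on g {e \<in> I. t e = v}" using b unfolding bij_betw_def inj_on_def by blast
      moreover have "y \<in> g ` {e \<in> I. t e = v}" if y: "y \<in> I'" "t' y = k v" for y
      proof -
        have "(y, v) \<in> (\<lambda>e. (g e, t e)) ` I" using y v bij_betw_imp_surj_on[OF b] by auto
        then show ?thesis by auto
      qed
      ultimately show "bij_betw g {e \<in> I. t e = v} {e \<in> I'. t' e = k v}"
        unfolding bij_betw_def using g by auto
    qed
  next
    assume b: "\<forall>v\<in>V. bij_betw g {e \<in> I. t e = v} {e \<in> I'. t' e = k v}"
    show "bij_betw (\<lambda>e. (g e, t e)) I {(e, v). e \<in> I' \<and> v \<in> V \<and> t' e = k v}"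
      unfolding bij_betw_def
    proof
      show "inj_on (\<lambda>e. (g e, t e)) I"
      proof (rule inj_onI)
        fix x y assume x: "x \<in> I" and y: "y \<in> I" and eq: "(g x, t x) = (g y, t y)"
        have "inj_on g {e \<in> I. t e = t x}" using b t[OF x] bij_betw_imp_inj_on by blast
        then show "x = y" using x y eq by (auto dest: inj_onD)
      qed
      show "(\<lambda>e. (g e, t e)) ` I = {(e, v). e \<in> I' \<and> v \<in> V \<and> t' e = k v}"
      proof
        show "(\<lambda>e. (g e, t e)) ` I \<subseteq> {(e, v). e \<in> I' \<and> v \<in> V \<and> t' e = k v}" using t g by auto
        show "{(e, v). e \<in> I' \<and> v \<in> V \<and> t' e = k v} \<subseteq> (\<lambda>e. (g e, t e)) ` I"
        proof clarify
          fix y v assume y: "y \<in> I'" "v \<in> V" "t' y = k v"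
          then have "y \<in> g ` {e \<in> I. t e = v}" using b bij_betw_imp_surj_on by blast
          then show "(y, v) \<in> (\<lambda>e. (g e, t e)) ` I" by auto
        qed
      qed
    qed
  qed
  show ?thesis
    unfolding local_map_def in_at_def out_at_def
    using aux[of "dI H" "dtI H" "dV H" "fst f" "dI G" "dtI G" "snd f"]
      aux[of "dO H" "dtO H" "dV H" "fst f" "dO G" "dtO G" "snd f"] digraphD(7,8)[OF assms]
    by (intro iffI conjI; elim conjE; simp)
qed

lemma local_mapD:
  assumes "local_map H G f" "digraph H"
  shows "fst f \<in> dE H \<rightarrow>\<^sub>E dE G" "snd f \<in> dV H \<rightarrow>\<^sub>E dV G"
    "e \<in> dE H \<Longrightarrow> fst f e \<in> dE G" "v \<in> dV H \<Longrightarrow> snd f v \<in> dV G"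
    "e \<in> dI H \<Longrightarrow> fst f e \<in> dI G" "e \<in> dI H \<Longrightarrow> dtI G (fst f e) = snd f (dtI H e)"
    "e \<in> dO H \<Longrightarrow> fst f e \<in> dO G" "e \<in> dO H \<Longrightarrow> dtO G (fst f e) = snd f (dtO H e)"
    "v \<in> dV H \<Longrightarrow> bij_betw (fst f) (in_at H v) (in_at G (snd f v))"
    "v \<in> dV H \<Longrightarrow> bij_betw (fst f) (out_at H v) (out_at G (snd f v))"
  using assms(1) unfolding local_map_iff[OF assms(2)] by (auto simp: PiE_iff)

lemma dembeddingD:
  assumes "dembedding H G f"
  shows "connected_digraph H" "connected_digraph G" "local_map H G f" "inj_on (snd f) (dV H)"
    "dnodeless_loop H \<Longrightarrow> dnodeless_loop G" "digraph H" "digraph G"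
  using assms connected_digraphD(1) unfolding dembedding_def by auto

text \<open>\<open>(e, True)\<close> is the positive arc of \<open>e\<close>: it is a dart at the vertex that has \<open>e\<close> as an output,
  and a boundary arc if \<open>e\<close> is an input of the graph.\<close>

definition ug :: "('k, 'w) digraph \<Rightarrow> ('k \<times> bool, 'w) ugraph" where
  "ug K = \<lparr>arcs = dE K \<times> UNIV, verts = dV K,
     dag = restrict (\<lambda>(e, s). (e, \<not> s)) (dE K \<times> UNIV),
     darts = dO K \<times> {True} \<union> dI K \<times> {False},
     tgt = restrict (\<lambda>(e, s). if s then dtO K e else dtI K e) (dO K \<times> {True} \<union> dI K \<times> {False}),
     bnd = din K \<times> {True} \<union> dout K \<times> {False}\<rparr>"

definition ugm :: "('k, 'w) digraph \<Rightarrow> ('k \<Rightarrow> 'l) \<times> ('w \<Rightarrow> 'u) \<Rightarrow> ('k \<times> bool \<Rightarrow> 'l \<times> bool) \<times> ('w \<Rightarrow> 'u)" where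
  "ugm K f = (restrict (\<lambda>(e, s). (fst f e, s)) (dE K \<times> UNIV), snd f)"

lemma ug_simps [simp]:
  "arcs (ug K) = dE K \<times> UNIV" "verts (ug K) = dV K"
  "e \<in> dE K \<Longrightarrow> dag (ug K) (e, s) = (e, \<not> s)"
  "darts (ug K) = dO K \<times> {True} \<union> dI K \<times> {False}"
  "e \<in> dO K \<Longrightarrow> tgt (ug K) (e, True) = dtO K e" "e \<in> dI K \<Longrightarrow> tgt (ug K) (e, False) = dtI K e"
  "bnd (ug K) = din K \<times> {True} \<union> dout K \<times> {False}"
  by (simp_all add: ug_def)

lemma ug_nodeless: "nodeless_loop (ug K) \<longleftrightarrow> dnodeless_loop K"
  unfolding nodeless_loop_def dnodeless_loop_def by (auto simp: card_cartesian_product)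

lemma ug_ugraph: "digraph K \<Longrightarrow> ugraph (ug K)"
proof -
  assume K: "digraph K"
  note k = digraphD[OF K]
  have "tgt (ug K) \<in> darts (ug K) \<rightarrow>\<^sub>E verts (ug K)"
    using k(7,8) by (auto simp: ug_def)
  moreover have "dag (ug K) \<in> arcs (ug K) \<rightarrow>\<^sub>E arcs (ug K)" by (auto simp: ug_def)
  moreover have "bnd (ug K) = arcs (ug K) - darts (ug K) \<or> nodeless_loop (ug K)"
    using k(9) unfolding ug_nodeless by auto
  ultimately show "ugraph (ug K)" unfolding ugraph_def using k(1-4) by auto
qed

text \<open>A set of arcs closed under the involution contains both signed copies of an edge or
  neither, so it is a set of edges times \<open>UNIV\<close>, and decompositions of the two graphs
  correspond.\<close>

lemma ug_connected: "connected_digraph K \<longleftrightarrow> digraph K \<and> connected_ugraph (ug K)"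
proof (cases "digraph K")
  case True
  note k = digraphD[OF True]
  have "(\<forall>A W. A \<subseteq> dE K \<longrightarrow> W \<subseteq> dV K \<longrightarrow>
        (\<forall>e\<in>dI K. e \<in> A \<longleftrightarrow> dtI K e \<in> W) \<longrightarrow> (\<forall>e\<in>dO K. e \<in> A \<longleftrightarrow> dtO K e \<in> W) \<longrightarrow>
        (A = {} \<and> W = {}) \<or> (A = dE K \<and> W = dV K)) \<longleftrightarrow>
    (\<forall>A W. A \<subseteq> arcs (ug K) \<longrightarrow> W \<subseteq> verts (ug K) \<longrightarrow> (\<forall>a\<in>A. dag (ug K) a \<in> A) \<longrightarrow>
        (\<forall>a\<in>darts (ug K). a \<in> A \<longleftrightarrow> tgt (ug K) a \<in> W) \<longrightarrow>
        (A = {} \<and> W = {}) \<or> (A = arcs (ug K) \<and> W = verts (ug K)))" (is "?L \<longleftrightarrow> ?R")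
  proof
    assume L: ?L
    show ?R
    proof (intro allI impI)
      fix A W assume A: "A \<subseteq> arcs (ug K)" "W \<subseteq> verts (ug K)" "\<forall>a\<in>A. dag (ug K) a \<in> A"
        "\<forall>a\<in>darts (ug K). a \<in> A \<longleftrightarrow> tgt (ug K) a \<in> W"
      have s: "(e, s) \<in> A \<longleftrightarrow> (e, True) \<in> A" for e s
        using A(1,3) by (cases s) force+
      have AA: "A = {e. (e, True) \<in> A} \<times> UNIV" using s by auto
      have "{e. (e, True) \<in> A} = {} \<and> W = {} \<or> {e. (e, True) \<in> A} = dE K \<and> W = dV K"
      proof (rule L[rule_format])
        show "{e. (e, True) \<in> A} \<subseteq> dE K" using A(1) by auto
        show "e \<in> {e. (e, True) \<in> A} \<longleftrightarrow> dtI K e \<in> W" if "e \<in> dI K" for e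
          using A(4)[rule_format, of "(e, False)"] that s[of e False] by simp
        show "e \<in> {e. (e, True) \<in> A} \<longleftrightarrow> dtO K e \<in> W" if "e \<in> dO K" for e
          using A(4)[rule_format, of "(e, True)"] that by simp
      qed (use A in simp)
      then show "A = {} \<and> W = {} \<or> A = arcs (ug K) \<and> W = verts (ug K)"
        using AA by (metis Sigma_empty1 ug_simps(1,2))
    qed
  next
    assume R: ?R
    show ?L
    proof (intro allI impI)
      fix A W assume A: "A \<subseteq> dE K" "W \<subseteq> dV K" "\<forall>e\<in>dI K. e \<in> A \<longleftrightarrow> dtI K e \<in> W" "\<forall>e\<in>dO K. e \<in> A \<longleftrightarrow> dtO K e \<in> W"
      have "A \<times> (UNIV::bool set) = {} \<and> W = {} \<or> A \<times> (UNIV::bool set) = arcs (ug K) \<and> W = verts (ug K)"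
        by (rule R[rule_format]) (use A in auto)
      then show "A = {} \<and> W = {} \<or> A = dE K \<and> W = dV K" by (auto simp: times_eq_iff)
    qed
  qed
  then show ?thesis
    unfolding connected_digraph_def connected_ugraph_def using True ug_ugraph[OF True] by simp
qed (simp add: connected_digraph_def)

lemma ugm_simps [simp]:
  "e \<in> dE K \<Longrightarrow> fst (ugm K f) (e, s) = (fst f e, s)" "snd (ugm K f) = snd f"
  by (simp_all add: ugm_def)

lemma nb_ug: "nb (ug K) v = out_at K v \<times> {True} \<union> in_at K v \<times> {False}"
  unfolding nb_def in_at_def out_at_def by auto

lemma bij_betw_signed:
  fixes f :: "'a \<Rightarrow> 'c" and g :: "'a \<times> bool \<Rightarrow> 'c \<times> bool"
  assumes "\<And>e s. e \<in> A \<union> B \<Longrightarrow> g (e, s) = (f e, s)"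
  shows "bij_betw g (A \<times> {True} \<union> B \<times> {False}) (A' \<times> {True} \<union> B' \<times> {False}) \<longleftrightarrow>
    bij_betw f A A' \<and> bij_betw f B B'"
proof -
  have prod: "C \<times> {s} = (\<lambda>e. (e, s)) ` C" for C :: "'c set" and s :: bool by auto
  have prod': "C \<times> {s} = (\<lambda>e. (e, s)) ` C" for C :: "'a set" and s :: bool by auto
  have g: "g (e, s) = (f e, s)" if "e \<in> A \<or> e \<in> B" for e s using assms that by auto
  have "g ` (A \<times> {True} \<union> B \<times> {False}) = f ` A \<times> {True} \<union> f ` B \<times> {False}"
    unfolding prod prod' by (simp add: image_Un image_image g cong: image_cong)
  moreover have "f ` A \<times> {True} \<union> f ` B \<times> {False} = A' \<times> {True} \<union> B' \<times> {False} \<longleftrightarrow> f ` A = A' \<and> f ` B = B'"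
    by (auto simp: set_eq_iff)
  moreover have "inj_on g (A \<times> {True} \<union> B \<times> {False}) \<longleftrightarrow> inj_on f A \<and> inj_on f B"
    unfolding prod' inj_on_def ball_Un by (auto simp: g)
  ultimately show ?thesis unfolding bij_betw_def by auto
qed

text \<open>The darts at a vertex of \<open>ug H\<close> are its outputs with positive sign and its
  inputs with negative sign. One bijection preserving signs is therefore the same as one on outputs
  and one on inputs.\<close>

lemma ug_etale:
  assumes H: "digraph H" and G: "digraph G" and f: "fst f \<in> extensional (dE H)"
  shows "etale (ug H) (ug G) (ugm H f) \<longleftrightarrow> local_map H G f"
proof -
  note h = digraphD[OF H] and g = digraphD[OF G]
  have nb: "bij_betw (fst (ugm H f)) (nb (ug H) v) (nb (ug G) w) \<longleftrightarrow>
    bij_betw (fst f) (out_at H v) (out_at G w) \<and> bij_betw (fst f) (in_at H v) (in_at G w)" for v w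
    unfolding nb_ug by (rule bij_betw_signed) (use h(3,4) in \<open>auto simp: in_at_def out_at_def\<close>)
  have ext: "fst (ugm H f) \<in> extensional (dE H \<times> UNIV)" by (simp add: ugm_def)
  have 1: "fst (ugm H f) \<in> arcs (ug H) \<rightarrow>\<^sub>E arcs (ug G) \<longleftrightarrow> fst f \<in> dE H \<rightarrow>\<^sub>E dE G"
    using f ext by (auto simp: PiE_iff)
  have 2: "\<forall>a\<in>arcs (ug H). fst (ugm H f) (dag (ug H) a) = dag (ug G) (fst (ugm H f) a)"
    if "fst f \<in> dE H \<rightarrow>\<^sub>E dE G" using PiE_mem[OF that] by auto
  have 3: "(\<forall>a\<in>darts (ug H). fst (ugm H f) a \<in> darts (ug G) \<and>
      tgt (ug G) (fst (ugm H f) a) = snd (ugm H f) (tgt (ug H) a)) \<longleftrightarrow>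
    (\<forall>e\<in>dI H. fst f e \<in> dI G \<and> dtI G (fst f e) = snd f (dtI H e)) \<and>
    (\<forall>e\<in>dO H. fst f e \<in> dO G \<and> dtO G (fst f e) = snd f (dtO H e))" (is "?L \<longleftrightarrow> ?R")
  proof -
    have "?L \<longleftrightarrow> (\<forall>e\<in>dO H. fst (ugm H f) (e, True) \<in> darts (ug G) \<and>
      tgt (ug G) (fst (ugm H f) (e, True)) = snd (ugm H f) (tgt (ug H) (e, True))) \<and>
      (\<forall>e\<in>dI H. fst (ugm H f) (e, False) \<in> darts (ug G) \<and>
      tgt (ug G) (fst (ugm H f) (e, False)) = snd (ugm H f) (tgt (ug H) (e, False)))"
      by (simp add: ball_Un)
    also have "\<dots> \<longleftrightarrow> ?R" using h(3,4) by (auto simp: subset_iff)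
    finally show ?thesis .
  qed
  have 4: "(\<forall>v\<in>verts (ug H). bij_betw (fst (ugm H f)) (nb (ug H) v) (nb (ug G) (snd (ugm H f) v))) \<longleftrightarrow>
    (\<forall>v\<in>dV H. bij_betw (fst f) (in_at H v) (in_at G (snd f v))) \<and>
    (\<forall>v\<in>dV H. bij_betw (fst f) (out_at H v) (out_at G (snd f v)))"
    unfolding nb by auto
  have 5: "snd (ugm H f) \<in> verts (ug H) \<rightarrow>\<^sub>E verts (ug G) \<longleftrightarrow> snd f \<in> dV H \<rightarrow>\<^sub>E dV G" by simp
  show ?thesis
    unfolding local_map_iff[OF H] etale_def 1 3 4 5
    by (rule iffI; elim conjE; intro conjI; (assumption | rule 2, assumption))
qed

lemma ug_embedding:
  assumes H: "digraph H" and G: "digraph G" and f: "fst f \<in> extensional (dE H)"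
  shows "embedding (ug H) (ug G) (ugm H f) \<longleftrightarrow> dembedding H G f"
  unfolding embedding_def dembedding_def ug_nodeless ug_etale[OF H G f] ug_connected
  using H G by simp

lemma dembedding_ext: "dembedding H G f \<Longrightarrow> fst f \<in> extensional (dE H)"
proof -
  assume f: "dembedding H G f"
  have "fst f \<in> dE H \<rightarrow>\<^sub>E dE G" by (rule local_mapD(1)[OF dembeddingD(3)[OF f] dembeddingD(6)[OF f]])
  then show ?thesis by (simp add: PiE_iff)
qed

lemma dembedding_ug: "dembedding H G f \<Longrightarrow> embedding (ug H) (ug G) (ugm H f)"
  using ug_embedding dembedding_ext dembeddingD(6,7) by blast

text \<open>An edge is represented by its positive arc, so that no new elements are needed and every
  directed graph is equal, not just isomorphic, to some \<open>dg X\<close>.\<close>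

definition dg :: "('a, 'v) ograph \<Rightarrow> ('a, 'v) digraph" where
  "dg X = (let G = fst X; P = {a \<in> arcs G. snd X a = 1} in
     \<lparr>dE = P, dI = {a \<in> P. dag G a \<in> darts G}, dO = {a \<in> P. a \<in> darts G}, dV = verts G,
      dtI = restrict (\<lambda>a. tgt G (dag G a)) {a \<in> P. dag G a \<in> darts G},
      dtO = restrict (tgt G) {a \<in> P. a \<in> darts G},
      din = {a \<in> P. a \<in> bnd G}, dout = {a \<in> P. dag G a \<in> bnd G}\<rparr>)"

lemma dg_simps [simp]:
  "dE (dg X) = {a \<in> arcs (fst X). snd X a = 1}"
  "dI (dg X) = {a \<in> arcs (fst X). snd X a = 1 \<and> dag (fst X) a \<in> darts (fst X)}"
  "dO (dg X) = {a \<in> arcs (fst X). snd X a = 1 \<and> a \<in> darts (fst X)}"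
  "dV (dg X) = verts (fst X)"
  "din (dg X) = {a \<in> arcs (fst X). snd X a = 1 \<and> a \<in> bnd (fst X)}"
  "dout (dg X) = {a \<in> arcs (fst X). snd X a = 1 \<and> dag (fst X) a \<in> bnd (fst X)}"
  "dtI (dg X) = restrict (\<lambda>a. tgt (fst X) (dag (fst X) a)) {a \<in> arcs (fst X). snd X a = 1 \<and> dag (fst X) a \<in> darts (fst X)}"
  "dtO (dg X) = restrict (tgt (fst X)) {a \<in> arcs (fst X). snd X a = 1 \<and> a \<in> darts (fst X)}"
  by (simp_all add: dg_def Let_def)

section \<open>Oriented graphs and embeddings into them\<close>

locale oriented =
  fixes X :: "('a, 'v) ograph"
  assumes conn: "connected_ugraph (fst X)" and ori: "orientation (fst X) (snd X)"
begin

lemma U: "ugraph (fst X)" using conn connected_ugraphD by blast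

lemmas u = ugraphD[OF U]

lemma sign: "a \<in> arcs (fst X) \<Longrightarrow> snd X a = 1 \<or> snd X a = -1"
  and sign_dag [simp]: "a \<in> arcs (fst X) \<Longrightarrow> snd X (dag (fst X) a) = - snd X a"
  using ori unfolding orientation_def by (auto simp: PiE_iff)

lemma dg_digraph: "digraph (dg X)"
proof -
  have "card {a \<in> arcs (fst X). snd X a = 1} = 1" if n: "nodeless_loop (fst X)"
  proof -
    have "arcs (fst X) \<noteq> {}" using n unfolding nodeless_loop_def by auto
    then obtain a where a: "a \<in> arcs (fst X)" by auto
    have "verts (fst X) = {}" using n unfolding nodeless_loop_def by auto
    note A = connected_no_verts(3)[OF conn this a]
    have "{b \<in> arcs (fst X). snd X b = 1} = {if snd X a = 1 then a else dag (fst X) a}"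
      using sign[OF a] sign_dag[OF a] by (subst A) auto
    then show ?thesis by simp
  qed
  then have "dnodeless_loop (dg X)" if "nodeless_loop (fst X)"
    using that unfolding nodeless_loop_def dnodeless_loop_def by simp
  then show ?thesis
    unfolding digraph_def using u(1,2,4,9,10) by auto
qed

text \<open>Together with \<open>to_ug\<close> below, the comparison of the graph with its
  description by signed edges: \<open>(a, True)\<close> names the positive arc \<open>a\<close>, and
  \<open>(a, False)\<close> names the partner of \<open>a\<close>.\<close>

definition of_ug :: "('a \<times> bool \<Rightarrow> 'a) \<times> ('v \<Rightarrow> 'v)" where
  "of_ug = (restrict (\<lambda>(a, s). if s then a else dag (fst X) a) ({a \<in> arcs (fst X). snd X a = 1} \<times> UNIV),
    restrict id (verts (fst X)))"

definition to_ug :: "('a \<Rightarrow> 'a \<times> bool) \<times> ('v \<Rightarrow> 'v)" where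
  "to_ug = (restrict (\<lambda>a. if snd X a = 1 then (a, True) else (dag (fst X) a, False)) (arcs (fst X)),
    restrict id (verts (fst X)))"

lemma of_to [simp]: "a \<in> arcs (fst X) \<Longrightarrow> fst of_ug (fst to_ug a) = a"
  and to_of [simp]: "b \<in> arcs (ug (dg X)) \<Longrightarrow> fst to_ug (fst of_ug b) = b"
  and to_arcs: "a \<in> arcs (fst X) \<Longrightarrow> fst to_ug a \<in> arcs (ug (dg X))"
  and of_arcs: "b \<in> arcs (ug (dg X)) \<Longrightarrow> fst of_ug b \<in> arcs (fst X)"
  and of_ug_simps: "a \<in> arcs (fst X) \<Longrightarrow> snd X a = 1 \<Longrightarrow> fst of_ug (a, s) = (if s then a else dag (fst X) a)"
  and of_ug_verts [simp]: "v \<in> verts (fst X) \<Longrightarrow> snd of_ug v = v"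
  and to_ug_verts [simp]: "v \<in> verts (fst X) \<Longrightarrow> snd to_ug v = v"
  using sign u(4,5) unfolding of_ug_def to_ug_def by (auto split: if_splits)

lemma to_mem:
  "a \<in> arcs (fst X) \<Longrightarrow> fst to_ug a \<in> darts (ug (dg X)) \<longleftrightarrow> a \<in> darts (fst X)"
  "a \<in> arcs (fst X) \<Longrightarrow> fst to_ug a \<in> bnd (ug (dg X)) \<longleftrightarrow> a \<in> bnd (fst X)"
  "a \<in> darts (fst X) \<Longrightarrow> tgt (ug (dg X)) (fst to_ug a) = tgt (fst X) a"
  "a \<in> arcs (fst X) \<Longrightarrow> fst to_ug (dag (fst X) a) = dag (ug (dg X)) (fst to_ug a)"
  using sign[of a] u(4,5)[of a] u(7) unfolding to_ug_def by (auto simp: subset_iff)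

lemma to_ug_iso: "ugraph_iso (fst X) (ug (dg X)) to_ug"
proof -
  have inj: "inj_on (fst to_ug) (arcs (fst X))" by (rule inj_on_inverseI[where g = "fst of_ug"]) simp
  have surj: "b \<in> fst to_ug ` S" if "b \<in> arcs (ug (dg X))" "fst of_ug b \<in> S" for b S
    using that to_of[OF that(1)] by (metis imageI)
  have A: "fst to_ug ` arcs (fst X) = arcs (ug (dg X))" using to_arcs surj of_arcs by blast
  note w = ug_ugraph[OF dg_digraph]
  have im: "fst to_ug ` {a \<in> arcs (fst X). P a} = {b \<in> arcs (ug (dg X)). Q b}"
    if "\<And>a. a \<in> arcs (fst X) \<Longrightarrow> Q (fst to_ug a) \<longleftrightarrow> P a" for P Q
    unfolding A[symmetric] using that by auto
  have D: "fst to_ug ` darts (fst X) = darts (ug (dg X))"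
    using im[of "\<lambda>b. b \<in> darts (ug (dg X))" "\<lambda>a. a \<in> darts (fst X)"] to_mem(1) u(7) ugraphD(7)[OF w]
    by (simp add: Collect_conj_eq Int_absorb1 del: ug_simps dg_simps)
  have B: "fst to_ug ` bnd (fst X) = bnd (ug (dg X))"
    using im[of "\<lambda>b. b \<in> bnd (ug (dg X))" "\<lambda>a. a \<in> bnd (fst X)"] to_mem(2) u(11) ugraphD(11)[OF w]
    by (simp add: Collect_conj_eq Int_absorb1 del: ug_simps dg_simps)
  have nb: "bij_betw (fst to_ug) (nb (fst X) v) (nb (ug (dg X)) v)" for v
    unfolding bij_betw_def
  proof
    show "inj_on (fst to_ug) (nb (fst X) v)"
      by (rule inj_on_subset[OF inj]) (use u(7) in \<open>auto simp: nb_def\<close>)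
    have "{b \<in> darts (ug (dg X)). tgt (ug (dg X)) b = v} = fst to_ug ` {a \<in> darts (fst X). tgt (fst X) a = v}"
      unfolding D[symmetric] using to_mem(3) by auto
    then show "fst to_ug ` nb (fst X) v = nb (ug (dg X)) v" unfolding nb_def by simp
  qed
  have "etale (fst X) (ug (dg X)) to_ug"
    unfolding etale_def
  proof (intro conjI ballI)
    show "fst to_ug \<in> arcs (fst X) \<rightarrow>\<^sub>E arcs (ug (dg X))" using to_arcs by (auto simp: to_ug_def PiE_iff)
    show "snd to_ug \<in> verts (fst X) \<rightarrow>\<^sub>E verts (ug (dg X))" by (auto simp: to_ug_def)
    fix a assume a: "a \<in> darts (fst X)"
    then show "fst to_ug a \<in> darts (ug (dg X))" using D by blast
    show "tgt (ug (dg X)) (fst to_ug a) = snd to_ug (tgt (fst X) a)" using to_mem(3)[OF a] u(9)[OF a] by simp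
  qed (use to_mem(4) nb in \<open>simp_all\<close>)
  moreover have "bij_betw (snd to_ug) (verts (fst X)) (verts (ug (dg X)))"
    unfolding bij_betw_def by (auto simp: inj_on_def)
  ultimately show ?thesis unfolding ugraph_iso_def bij_betw_def[of "fst to_ug"] using inj A D B by blast
qed

lemma of_ug_iso: "ugraph_iso (ug (dg X)) (fst X) of_ug"
proof -
  have z: "etale (fst X) (ug (dg X)) to_ug" and D: "fst to_ug ` darts (fst X) = darts (ug (dg X))"
    and B: "fst to_ug ` bnd (fst X) = bnd (ug (dg X))" and A: "fst to_ug ` arcs (fst X) = arcs (ug (dg X))"
    using to_ug_iso unfolding ugraph_iso_def bij_betw_def by auto
  have im: "fst of_ug ` fst to_ug ` S = S" if "S \<subseteq> arcs (fst X)" for S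
    using that by (auto simp: image_image subset_iff cong: image_cong)
  have inj: "inj_on (fst of_ug) (arcs (ug (dg X)))" by (rule inj_on_inverseI[where g = "fst to_ug", OF to_of])
  have nb: "bij_betw (fst of_ug) (nb (ug (dg X)) v) (nb (fst X) v)" if v: "v \<in> verts (fst X)" for v
  proof -
    have e: "nb (ug (dg X)) v = fst to_ug ` nb (fst X) v"
      using bij_betw_imp_surj_on[OF etaleD(8)[OF z v]] v by simp
    have n: "nb (fst X) v \<subseteq> arcs (fst X)" using u(7) unfolding nb_def by auto
    show ?thesis unfolding bij_betw_def e im[OF n]
      by (intro conjI inj_on_subset[OF inj] refl) (use n A in blast)
  qed
  have "etale (ug (dg X)) (fst X) of_ug"
    unfolding etale_def
  proof (intro conjI ballI)
    show "fst of_ug \<in> arcs (ug (dg X)) \<rightarrow>\<^sub>E arcs (fst X)" using of_arcs by (auto simp: of_ug_def PiE_iff)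
    show "snd of_ug \<in> verts (ug (dg X)) \<rightarrow>\<^sub>E verts (fst X)" by (auto simp: of_ug_def)
    fix b assume "b \<in> arcs (ug (dg X))"
    then obtain a where a: "a \<in> arcs (fst X)" "b = fst to_ug a" using A by blast
    then show "fst of_ug (dag (ug (dg X)) b) = dag (fst X) (fst of_ug b)"
      using etaleD(5)[OF z a(1)] u(4) by (metis of_to)
  next
    fix b assume "b \<in> darts (ug (dg X))"
    then obtain a where a: "a \<in> darts (fst X)" "b = fst to_ug a" using D by blast
    then have a': "a \<in> arcs (fst X)" using u(7) by auto
    show "fst of_ug b \<in> darts (fst X)" using a a' by simp
    show "tgt (fst X) (fst of_ug b) = snd of_ug (tgt (ug (dg X)) b)"
      using to_mem(3)[OF a(1)] a a' u(9)[OF a(1)] by (simp del: ug_simps dg_simps)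
  qed (use nb in simp)
  moreover have "bij_betw (snd of_ug) (verts (ug (dg X))) (verts (fst X))"
    unfolding bij_betw_def by (auto simp: inj_on_def)
  ultimately show ?thesis unfolding ugraph_iso_def bij_betw_def[of "fst of_ug"]
    using inj A[symmetric] D[symmetric] B[symmetric] im[of "arcs (fst X)"] im[OF u(7)] im[OF u(11)] by auto
qed

lemma ug_dg_connected: "connected_ugraph (ug (dg X))"
  using ugraph_iso_connected[OF of_ug_iso ug_ugraph[OF dg_digraph] conn] .

lemma dg_connected: "connected_digraph (dg X)"
  using ug_connected dg_digraph ug_dg_connected by blast

lemma dg_nodeless: "dnodeless_loop (dg X) \<longleftrightarrow> nodeless_loop (fst X)"
  using ugraph_iso_nodeless[OF to_ug_iso] ugraph_iso_nodeless[OF of_ug_iso] ug_nodeless by blast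

text \<open>The embedding \<open>k\<close> of directed graphs read as an embedding into the
  undirected graph of \<open>X\<close>, each edge of the domain being replaced by its two signed
  arcs.\<close>

definition lift_map :: "('k, 'w) digraph \<Rightarrow> ('k \<Rightarrow> 'a) \<times> ('w \<Rightarrow> 'v) \<Rightarrow> ('k \<times> bool \<Rightarrow> 'a) \<times> ('w \<Rightarrow> 'v)" where
  "lift_map K k = comp_map (ug K) of_ug (ugm K k)"

lemma lift_embedding:
  assumes k: "dembedding K (dg X) k"
  shows "embedding (ug K) (fst X) (lift_map K k)"
    "snd (lift_map K k) ` verts (ug K) = snd k ` dV K"
    "fst (lift_map K k) ` bnd (ug K) = fst k ` din K \<union> dag (fst X) ` fst k ` dout K"
proof -
  note K = local_mapD[OF dembeddingD(3,6)[OF k]]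
  note d = digraphD[OF dembeddingD(6)[OF k]]
  show "embedding (ug K) (fst X) (lift_map K k)"
    unfolding lift_map_def
    by (rule embedding_comp[OF dembedding_ug[OF k] ugraph_iso_embedding[OF of_ug_iso ug_dg_connected conn]])
  show "snd (lift_map K k) ` verts (ug K) = snd k ` dV K"
    using K(4) unfolding lift_map_def by (auto intro!: image_cong)
  have s: "fst (lift_map K k) (e, s) = (if s then fst k e else dag (fst X) (fst k e))" if "e \<in> dE K" for e s
    using that K(3)[OF that] unfolding lift_map_def by (simp add: of_ug_simps)
  have "bnd (ug K) = (\<lambda>e. (e, True)) ` din K \<union> (\<lambda>e. (e, False)) ` dout K" by auto
  then show "fst (lift_map K k) ` bnd (ug K) = fst k ` din K \<union> dag (fst X) ` fst k ` dout K"
    using s d(10,11) by (simp add: image_Un image_image subset_iff cong: image_cong)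
qed

definition pull :: "('b, 'w) ugraph \<Rightarrow> ('b \<Rightarrow> 'a) \<times> ('w \<Rightarrow> 'v) \<Rightarrow> ('b, 'w) ograph" where
  "pull H f = (H, restrict (\<lambda>a. snd X (fst f a)) (arcs H))"

lemma pull_simps [simp]: "fst (pull H f) = H" "a \<in> arcs H \<Longrightarrow> snd (pull H f) a = snd X (fst f a)"
  by (simp_all add: pull_def)

lemma pull_oriented:
  assumes e: "embedding H (fst X) f"
  shows "oriented (pull H f)"
proof
  note ef = etaleD[OF embeddingD(3)[OF e]] and uH = ugraphD[OF connected_ugraphD(1)[OF embeddingD(1)[OF e]]]
  show "orientation (fst (pull H f)) (snd (pull H f))"
    unfolding orientation_def using sign[OF ef(3)] sign_dag[OF ef(3)] ef(5) uH(4) by (auto simp: pull_def)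
qed (simp add: embeddingD(1)[OF e])

definition pull_map :: "('b, 'w) ugraph \<Rightarrow> ('b \<Rightarrow> 'a) \<times> ('w \<Rightarrow> 'v) \<Rightarrow> ('b \<Rightarrow> 'a) \<times> ('w \<Rightarrow> 'v)" where
  "pull_map H f = (restrict (fst f) (dE (dg (pull H f))), snd f)"

lemma pull_dembedding:
  assumes e: "embedding H (fst X) f"
  shows "dembedding (dg (pull H f)) (dg X) (pull_map H f)"
    "fst f ` bnd H = fst (pull_map H f) ` din (dg (pull H f)) \<union>
      dag (fst X) ` fst (pull_map H f) ` dout (dg (pull H f))"
proof -
  note ef = etaleD[OF embeddingD(3)[OF e]] and H = embeddingD(1)[OF e]
  note uH = ugraphD[OF connected_ugraphD(1)[OF H]]
  interpret Y: oriented "pull H f" by (rule pull_oriented[OF e])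
  let ?K = "dg (pull H f)"
  define k where "k = pull_map H f"
  \<comment> \<open>Written as a composite of an isomorphism, \<open>f\<close> and an isomorphism,
    the map is an embedding without further checks, and \<open>ug_embedding\<close> carries this to
    directed graphs.\<close>
  have "ugm ?K k = comp_map (ug ?K) to_ug (comp_map (ug ?K) f Y.of_ug)" (is "?l = ?r")
  proof (rule prod_eqI; rule extensionalityI)
    show "fst ?l \<in> extensional (dE ?K \<times> UNIV)" by (simp add: ugm_def del: dg_simps)
    show "fst ?r \<in> extensional (dE ?K \<times> UNIV)" by (simp add: comp_map_def del: dg_simps)
    show "snd ?l \<in> extensional (verts H)" using ef(2) by (simp add: ugm_def k_def pull_map_def PiE_iff)
    show "snd ?r \<in> extensional (verts H)" by (simp add: comp_map_def)
    show "fst ?l p = fst ?r p" if "p \<in> dE ?K \<times> UNIV" for p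
    proof -
      obtain a s where p: "p = (a, s)" "a \<in> arcs H" "snd X (fst f a) = 1" using \<open>p \<in> dE ?K \<times> UNIV\<close> by auto
      note fa = ef(3)[OF p(2)]
      have q: "fst Y.of_ug (a, s) = (if s then a else dag H a)" using Y.of_ug_simps[of a s] p by simp
      have "fst to_ug (fst f a) = (fst f a, True)" "fst to_ug (dag (fst X) (fst f a)) = (fst f a, False)"
        using fa p u(4,5)[OF fa] by (simp_all add: to_ug_def)
      then show ?thesis using p q ef(5)[OF p(2)] by (simp add: k_def pull_map_def)
    qed
    show "snd ?l v = snd ?r v" if "v \<in> verts H" for v
      using that ef(4)[OF that] by (simp add: k_def pull_map_def)
  qed
  then have "embedding (ug ?K) (ug (dg X)) (ugm ?K k)"
    using embedding_comp[OF embedding_comp[OF ugraph_iso_embedding[OF Y.of_ug_iso Y.ug_dg_connected Y.conn], unfolded pull_simps, OF e]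
      ugraph_iso_embedding[OF to_ug_iso conn ug_dg_connected]] by simp
  then show "dembedding ?K (dg X) (pull_map H f)"
    using ug_embedding[OF Y.dg_digraph dg_digraph, of k] by (simp add: k_def pull_map_def del: dg_simps)
  \<comment> \<open>A negative boundary arc is the partner of an output; the boundary thus splits by
    sign into inputs and partners of outputs.\<close>
  have "a \<in> dag H ` dout ?K" if a: "a \<in> bnd H" "a \<notin> din ?K" for a
  proof -
    have aH: "a \<in> arcs H" using a(1) uH(11) by auto
    have "dag H a \<in> dout ?K" using a aH Y.sign[of a] Y.sign_dag[of a] uH(4,5)[OF aH] by auto
    then show ?thesis using uH(5)[OF aH] by (metis imageI)
  qed
  moreover have "din ?K \<subseteq> bnd H" "dag H ` dout ?K \<subseteq> bnd H" by auto
  ultimately have eq: "bnd H = din ?K \<union> dag H ` dout ?K" by blast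
  have "fst f ` bnd H = fst f ` din ?K \<union> fst f ` dag H ` dout ?K"
    by (subst eq) (rule image_Un)
  also have "fst f ` din ?K = fst (pull_map H f) ` din ?K" unfolding pull_map_def by (auto intro!: image_cong)
  also have "fst f ` dag H ` dout ?K = dag (fst X) ` fst (pull_map H f) ` dout ?K"
    unfolding pull_map_def image_image by (rule image_cong) (auto simp: ef(5))
  finally show "fst f ` bnd H = fst (pull_map H f) ` din ?K \<union> dag (fst X) ` fst (pull_map H f) ` dout ?K" .
qed

lemma Emb_dembedding:
  assumes c: "c \<in> Emb (fst X)"
  obtains K :: "('a, 'v) digraph" and k where "dembedding K (dg X) k" "emb_verts c = snd k ` dV K"
    "emb_bnd c = fst k ` din K \<union> dag (fst X) ` fst k ` dout K"
proof -
  obtain h where h: "h \<in> c" using EmbD(1)[OF c] ..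
  note e = EmbD(2)[OF c h]
  have V: "emb_verts c = snd (pull_map (fst h) (snd h)) ` dV (dg (pull (fst h) (snd h)))"
    using EmbD(3)[OF c h] by (simp add: pull_map_def)
  show ?thesis
    by (rule that[OF pull_dembedding(1)[OF e] V]) (use EmbD(4)[OF c h] pull_dembedding(2)[OF e] in simp)
qed

end

section \<open>Graph substitution\<close>

text \<open>With at most one successor and one predecessor, a change of direction in a zigzag
  returns to the element just left. All such turns cancel and a directed path remains.\<close>

lemma rtrancl_sym_biunique:
  assumes N: "single_valued N" "single_valued (N\<inverse>)" and "(x, y) \<in> (N \<union> N\<inverse>)\<^sup>*"
  shows "(x, y) \<in> N\<^sup>* \<or> (y, x) \<in> N\<^sup>*"
  using assms(3)
proof induction
  case (step y z)
  consider "(y, z) \<in> N" | "(z, y) \<in> N" using step(2) by auto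
  then show ?case
  proof cases
    case 1
    show ?thesis using step(3)
    proof
      assume "(y, x) \<in> N\<^sup>*"
      then show ?thesis
      proof (cases rule: converse_rtranclE)
        case base then show ?thesis using 1 by auto
      next
        case (step y') then show ?thesis using 1 N(1) by (auto dest: single_valuedD)
      qed
    qed (use 1 in auto)
  next
    case 2
    show ?thesis using step(3)
    proof
      assume "(x, y) \<in> N\<^sup>*"
      then show ?thesis
      proof (cases rule: rtranclE)
        case base then show ?thesis using 2 by auto
      next
        case (step y') then show ?thesis using 2 N(2) by (auto dest: single_valuedD)
      qed
    qed (use 2 in \<open>auto intro: converse_rtrancl_into_rtrancl\<close>)
  qed
qed simp

text \<open>Choosing a predecessor inside \<open>c\<close> is injective because successors are
  unique; on a finite set it is then surjective, so each element is the predecessor of another one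
  or of itself.\<close>

lemma all_pred_imp_all_succ:
  assumes c: "finite c" and M: "single_valued M" and p: "\<And>y. y \<in> c \<Longrightarrow> \<exists>z\<in>c. (z, y) \<in> M" and "z \<in> c"
  shows "z \<in> Domain M"
proof -
  define f where "f y = (SOME z. z \<in> c \<and> (z, y) \<in> M)" for y
  have f: "f y \<in> c \<and> (f y, y) \<in> M" if "y \<in> c" for y
    unfolding f_def by (rule someI_ex) (use p that in blast)
  have "inj_on f c" using f M by (metis inj_onI single_valuedD)
  then have "f ` c = c" using c f by (intro endo_inj_surj) auto
  then obtain y where "y \<in> c" "z = f y" using \<open>z \<in> c\<close> by (metis imageE)
  then show ?thesis using f by auto
qed

lemma connected_digraph_closed:
  assumes "connected_digraph G" "A \<subseteq> dE G" "W \<subseteq> dV G"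
    "\<And>e. e \<in> dI G \<Longrightarrow> e \<in> A \<longleftrightarrow> dtI G e \<in> W" "\<And>e. e \<in> dO G \<Longrightarrow> e \<in> A \<longleftrightarrow> dtO G e \<in> W"
    "A \<noteq> {} \<or> W \<noteq> {}"
  shows "A = dE G" "W = dV G"
  using assms unfolding connected_digraph_def by (metis (no_types))+

text \<open>An edge that is both an input and an output of the graph is attached to no vertex and
  forms a component on its own.\<close>

lemma connected_digraph_isolated_edge:
  assumes G: "connected_digraph G" and k: "k \<in> din G" "k \<in> dout G"
  shows "dE G = {k}" "dV G = {}" "dI G = {}" "dO G = {}" "din G = {k}" "dout G = {k}"
proof -
  note d = digraphD[OF connected_digraphD(1)[OF G]]
  have "{k} = dE G \<and> {} = dV G"
    by (intro conjI connected_digraph_closed[OF G, of "{k}" "{}"]) (use d(10-13) k in auto)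
  then show *: "dE G = {k}" "dV G = {}" by auto
  show "dI G = {}" "dO G = {}" using d(7,8) *(2) by auto
  show "din G = {k}" "dout G = {k}" using d(10,11) k * by auto
qed

section \<open>Edges of a substituted graph as directed paths\<close>

locale graph_substitution =
  fixes H :: "('e, 'v) digraph" and K :: "'v \<Rightarrow> ('k, 'w) digraph" and \<alpha> \<beta> :: "'v \<Rightarrow> 'k \<Rightarrow> 'e"
  assumes H: "connected_digraph H"
    and K: "v \<in> dV H \<Longrightarrow> connected_digraph (K v)"
    and \<alpha>: "v \<in> dV H \<Longrightarrow> bij_betw (\<alpha> v) (din (K v)) (in_at H v)"
    and \<beta>: "v \<in> dV H \<Longrightarrow> bij_betw (\<beta> v) (dout (K v)) (out_at H v)"
begin

abbreviation "S \<equiv> graph_subst H K \<alpha> \<beta>"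
abbreviation "q \<equiv> subst_edge H K \<alpha> \<beta>"

text \<open>One step along the orientation; as each edge of \<open>H\<close> and of the \<open>K v\<close> has at most one
  predecessor and at most one successor, the edges of the substituted graph are directed paths,
  or else there is a single one, which is a directed cycle.\<close>

definition N :: "('e + 'v \<times> 'k) rel" where
  "N = {(Inl (\<alpha> v k), Inr (v, k)) | v k. v \<in> dV H \<and> k \<in> din (K v)} \<union>
    {(Inr (v, k), Inl (\<beta> v k)) | v k. v \<in> dV H \<and> k \<in> dout (K v)}"

definition points :: "('e + 'v \<times> 'k) set" where
  "points = Inl ` dE H \<union> Inr ` (SIGMA v:dV H. dE (K v))"

lemmas h = digraphD[OF connected_digraphD(1)[OF H]]
lemmas Kd = digraphD[OF connected_digraphD(1)[OF K]]

lemma \<alpha>_in: "v \<in> dV H \<Longrightarrow> k \<in> din (K v) \<Longrightarrow> \<alpha> v k \<in> dI H \<and> dtI H (\<alpha> v k) = v"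
  using bij_betwE[OF \<alpha>] unfolding in_at_def by blast

lemma \<beta>_out: "v \<in> dV H \<Longrightarrow> k \<in> dout (K v) \<Longrightarrow> \<beta> v k \<in> dO H \<and> dtO H (\<beta> v k) = v"
  using bij_betwE[OF \<beta>] unfolding out_at_def by blast

lemma \<alpha>_surj: "e \<in> dI H \<Longrightarrow> \<exists>k\<in>din (K (dtI H e)). \<alpha> (dtI H e) k = e"
  using bij_betw_imp_surj_on[OF \<alpha>[OF h(7)]] unfolding in_at_def by (metis (mono_tags, lifting) imageE mem_Collect_eq)

lemma \<beta>_surj: "e \<in> dO H \<Longrightarrow> \<exists>k\<in>dout (K (dtO H e)). \<beta> (dtO H e) k = e"
  using bij_betw_imp_surj_on[OF \<beta>[OF h(8)]] unfolding out_at_def by (metis (mono_tags, lifting) imageE mem_Collect_eq)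

lemma N_simps:
  "(Inl e, y) \<in> N \<longleftrightarrow> (\<exists>v k. y = Inr (v, k) \<and> v \<in> dV H \<and> k \<in> din (K v) \<and> e = \<alpha> v k)"
  "(Inr p, y) \<in> N \<longleftrightarrow> fst p \<in> dV H \<and> snd p \<in> dout (K (fst p)) \<and> y = Inl (\<beta> (fst p) (snd p))"
  "(x, Inl e) \<in> N \<longleftrightarrow> (\<exists>v k. x = Inr (v, k) \<and> v \<in> dV H \<and> k \<in> dout (K v) \<and> e = \<beta> v k)"
  "(x, Inr p) \<in> N \<longleftrightarrow> fst p \<in> dV H \<and> snd p \<in> din (K (fst p)) \<and> x = Inl (\<alpha> (fst p) (snd p))"
  unfolding N_def by (cases p; auto)+

lemma Domain_N: "Inl e \<in> Domain N \<longleftrightarrow> e \<in> dI H" "Inr (v, k) \<in> Domain N \<longleftrightarrow> v \<in> dV H \<and> k \<in> dout (K v)"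
  and Range_N: "Inl e \<in> Range N \<longleftrightarrow> e \<in> dO H" "Inr (v, k) \<in> Range N \<longleftrightarrow> v \<in> dV H \<and> k \<in> din (K v)"
proof -
  show "Inl e \<in> Domain N \<longleftrightarrow> e \<in> dI H"
    unfolding Domain_iff N_simps using \<alpha>_in \<alpha>_surj[of e] h(7)[of e] by metis
  show "Inl e \<in> Range N \<longleftrightarrow> e \<in> dO H"
    unfolding Range_iff N_simps using \<beta>_out \<beta>_surj[of e] h(8)[of e] by metis
  show "Inr (v, k) \<in> Domain N \<longleftrightarrow> v \<in> dV H \<and> k \<in> dout (K v)"
    "Inr (v, k) \<in> Range N \<longleftrightarrow> v \<in> dV H \<and> k \<in> din (K v)"
    unfolding Domain_iff Range_iff N_simps by auto
qed

lemma N_points: "(x, y) \<in> N \<Longrightarrow> x \<in> points \<and> y \<in> points"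
proof -
  have 1: "Inl (\<alpha> v k) \<in> points" "Inr (v, k) \<in> points" if "v \<in> dV H" "k \<in> din (K v)" for v k
    using \<alpha>_in[OF that] h(3) Kd(10)[OF that(1)] that unfolding points_def by auto
  have 2: "Inl (\<beta> v k) \<in> points" "Inr (v, k) \<in> points" if "v \<in> dV H" "k \<in> dout (K v)" for v k
    using \<beta>_out[OF that] h(4) Kd(11)[OF that(1)] that unfolding points_def by auto
  show "(x, y) \<in> N \<Longrightarrow> x \<in> points \<and> y \<in> points" unfolding N_def using 1 2 by auto
qed

lemma finite_points: "finite points"
  unfolding points_def using h(1,2) Kd(1) by auto

lemma single_valued_N: "single_valued N" "single_valued (N\<inverse>)"
proof -
  have a: "v = v' \<and> k = k'" if "v \<in> dV H" "k \<in> din (K v)" "v' \<in> dV H" "k' \<in> din (K v')" "\<alpha> v k = \<alpha> v' k'" for v k v' k'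
  proof -
    have "v = v'" using \<alpha>_in[OF that(1,2)] \<alpha>_in[OF that(3,4)] that(5) by metis
    then show ?thesis using bij_betw_imp_inj_on[OF \<alpha>[OF that(1)]] that by (metis inj_onD)
  qed
  have b: "v = v' \<and> k = k'" if "v \<in> dV H" "k \<in> dout (K v)" "v' \<in> dV H" "k' \<in> dout (K v')" "\<beta> v k = \<beta> v' k'" for v k v' k'
  proof -
    have "v = v'" using \<beta>_out[OF that(1,2)] \<beta>_out[OF that(3,4)] that(5) by metis
    then show ?thesis using bij_betw_imp_inj_on[OF \<beta>[OF that(1)]] that by (metis inj_onD)
  qed
  show "single_valued N"
  proof (rule single_valuedI)
    fix x y z assume "(x, y) \<in> N" "(x, z) \<in> N"
    then show "y = z" by (cases x) (auto simp: N_simps dest: a)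
  qed
  show "single_valued (N\<inverse>)"
  proof (rule single_valuedI)
    fix x y z assume *: "(x, y) \<in> N\<inverse>" "(x, z) \<in> N\<inverse>"
    show "y = z" using *[unfolded converse_iff] by (cases x rule: sum.exhaust) (auto simp: N_simps dest: b)
  qed
qed

lemma subst_eq_N: "subst_eq H K \<alpha> \<beta> = (N \<union> N\<inverse>)\<^sup>*"
  unfolding subst_eq_def Let_def N_def by (rule arg_cong[where f = rtrancl]) auto

lemma mem_q: "y \<in> q x \<longleftrightarrow> (x, y) \<in> (N \<union> N\<inverse>)\<^sup>*"
  unfolding subst_edge_def subst_eq_N by simp

lemma sym_q: "(x, y) \<in> (N \<union> N\<inverse>)\<^sup>* \<Longrightarrow> (y, x) \<in> (N \<union> N\<inverse>)\<^sup>*"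
  by (rule symD[OF sym_rtrancl[OF sym_Un_converse]])

lemma q_eq: "q x = q y \<longleftrightarrow> (x, y) \<in> (N \<union> N\<inverse>)\<^sup>*"
proof
  assume "q x = q y"
  moreover have "y \<in> q y" by (simp add: mem_q)
  ultimately have "y \<in> q x" by simp
  then show "(x, y) \<in> (N \<union> N\<inverse>)\<^sup>*" by (simp add: mem_q)
next
  assume "(x, y) \<in> (N \<union> N\<inverse>)\<^sup>*"
  then show "q x = q y" unfolding set_eq_iff mem_q by (meson sym_q rtrancl_trans)
qed

lemma mem_q': "y \<in> q x \<longleftrightarrow> q x = q y" using mem_q q_eq by auto

lemma q_self: "x \<in> q x" by (simp add: mem_q)

lemma q_N: "(x, y) \<in> N \<Longrightarrow> q x = q y" by (simp add: q_eq r_into_rtrancl)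

lemma q_\<alpha>: "v \<in> dV H \<Longrightarrow> k \<in> din (K v) \<Longrightarrow> q (Inl (\<alpha> v k)) = q (Inr (v, k))"
  by (rule q_N) (auto simp: N_simps)

lemma q_\<beta>: "v \<in> dV H \<Longrightarrow> k \<in> dout (K v) \<Longrightarrow> q (Inl (\<beta> v k)) = q (Inr (v, k))"
  by (rule q_N[symmetric]) (auto simp: N_simps)

lemma q_points: "x \<in> points \<Longrightarrow> y \<in> q x \<Longrightarrow> y \<in> points"
proof -
  assume "x \<in> points" "y \<in> q x"
  then have "(x, y) \<in> (N \<union> N\<inverse>)\<^sup>*" "x \<in> points" by (auto simp: mem_q)
  then show ?thesis by (induction rule: rtrancl_induct) (auto dest: N_points)
qed

text \<open>Two elements of one class are joined by a directed path. If neither has a predecessor,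
  the path has length zero; \<open>end_unique\<close> is the dual statement for successors.\<close>

lemma start_unique:
  assumes "x \<notin> Range N" "y \<notin> Range N" "q x = q y"
  shows "x = y"
  using rtrancl_sym_biunique[OF single_valued_N assms(3)[unfolded q_eq]] assms(1,2) by (metis Range.intros rtranclE)

lemma end_unique:
  assumes "x \<notin> Domain N" "y \<notin> Domain N" "q x = q y"
  shows "x = y"
  using rtrancl_sym_biunique[OF single_valued_N assms(3)[unfolded q_eq]] assms(1,2)
  by (metis Domain.intros converse_rtranclE)

lemma S_simps [simp]:
  "dE S = q ` points" "dI S = q ` Inr ` (SIGMA v:dV H. dI (K v))" "dO S = q ` Inr ` (SIGMA v:dV H. dO (K v))"
  "dV S = (SIGMA v:dV H. dV (K v))" "din S = q ` Inl ` din H" "dout S = q ` Inl ` dout H"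
  by (simp_all add: graph_subst_def Let_def points_def)

lemma dtI_ext: "dtI S \<in> extensional (dI S)" and dtO_ext: "dtO S \<in> extensional (dO S)"
  by (simp_all add: graph_subst_def Let_def)

text \<open>An element of \<open>I(K v)\<close> is not an output of \<open>K v\<close> and so has no
  successor. It is the unique end of its class, which makes the description of the attached vertex
  definite. Dually, an element of \<open>O(K v)\<close> is the unique start.\<close>

lemma dtI_S:
  assumes v: "v \<in> dV H" and k: "k \<in> dI (K v)"
  shows "dtI S (q (Inr (v, k))) = (v, dtI (K v) k)"
proof -
  let ?c = "q (Inr (v, k))"
  have e: "Inr (v', k') \<notin> Domain N" if "v' \<in> dV H" "k' \<in> dI (K v')" for v' k'
    using Kd(13)[OF that(1)] that(2) by (auto simp: Domain_N)
  have "?c \<in> q ` Inr ` (SIGMA v:dV H. dI (K v))" using v k by auto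
  then have "dtI S ?c = (THE u. \<exists>v e. v \<in> dV H \<and> e \<in> dI (K v) \<and> Inr (v, e) \<in> ?c \<and> u = (v, dtI (K v) e))"
    by (simp add: graph_subst_def Let_def)
  also have "\<dots> = (v, dtI (K v) k)"
  proof (rule the_equality)
    show "\<exists>v' e. v' \<in> dV H \<and> e \<in> dI (K v') \<and> Inr (v', e) \<in> ?c \<and> (v, dtI (K v) k) = (v', dtI (K v') e)"
      using v k q_self by blast
    fix u assume "\<exists>v e. v \<in> dV H \<and> e \<in> dI (K v) \<and> Inr (v, e) \<in> ?c \<and> u = (v, dtI (K v) e)"
    then obtain v' k' where *: "v' \<in> dV H" "k' \<in> dI (K v')" "Inr (v', k') \<in> ?c" "u = (v', dtI (K v') k')" by blast
    have "Inr (v, k) = (Inr (v', k') :: 'e + 'v \<times> 'k)"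
      by (rule end_unique) (use e v k * in \<open>auto simp: mem_q'\<close>)
    then show "u = (v, dtI (K v) k)" using * by auto
  qed
  finally show ?thesis .
qed

lemma dtO_S:
  assumes v: "v \<in> dV H" and k: "k \<in> dO (K v)"
  shows "dtO S (q (Inr (v, k))) = (v, dtO (K v) k)"
proof -
  let ?c = "q (Inr (v, k))"
  have e: "Inr (v', k') \<notin> Range N" if "v' \<in> dV H" "k' \<in> dO (K v')" for v' k'
    using Kd(12)[OF that(1)] that(2) by (auto simp: Range_N)
  have "?c \<in> q ` Inr ` (SIGMA v:dV H. dO (K v))" using v k by auto
  then have "dtO S ?c = (THE u. \<exists>v e. v \<in> dV H \<and> e \<in> dO (K v) \<and> Inr (v, e) \<in> ?c \<and> u = (v, dtO (K v) e))"
    by (simp add: graph_subst_def Let_def)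
  also have "\<dots> = (v, dtO (K v) k)"
  proof (rule the_equality)
    show "\<exists>v' e. v' \<in> dV H \<and> e \<in> dO (K v') \<and> Inr (v', e) \<in> ?c \<and> (v, dtO (K v) k) = (v', dtO (K v') e)"
      using v k q_self by blast
    fix u assume "\<exists>v e. v \<in> dV H \<and> e \<in> dO (K v) \<and> Inr (v, e) \<in> ?c \<and> u = (v, dtO (K v) e)"
    then obtain v' k' where *: "v' \<in> dV H" "k' \<in> dO (K v')" "Inr (v', k') \<in> ?c" "u = (v', dtO (K v') k')" by blast
    have "Inr (v, k) = (Inr (v', k') :: 'e + 'v \<times> 'k)"
      by (rule start_unique) (use e v k * in \<open>auto simp: mem_q'\<close>)
    then show "u = (v, dtO (K v) k)" using * by auto
  qed
  finally show ?thesis .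
qed

lemma q_dI_inj:
  assumes "v \<in> dV H" "k \<in> dI (K v)" "v' \<in> dV H" "k' \<in> dI (K v')" "q (Inr (v, k)) = q (Inr (v', k'))"
  shows "v = v' \<and> k = k'"
  using end_unique[of "Inr (v, k)" "Inr (v', k')"] Kd(13) assms by (auto simp: Domain_N)

lemma q_dO_inj:
  assumes "v \<in> dV H" "k \<in> dO (K v)" "v' \<in> dV H" "k' \<in> dO (K v')" "q (Inr (v, k)) = q (Inr (v', k'))"
  shows "v = v' \<and> k = k'"
  using start_unique[of "Inr (v, k)" "Inr (v', k')"] Kd(12) assms by (auto simp: Range_N)

lemma q_din_inj: "inj_on (\<lambda>e. q (Inl e)) (din H)"
proof (rule inj_onI)
  fix e e' assume "e \<in> din H" "e' \<in> din H" "q (Inl e) = q (Inl e')"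
  then show "e = e'" using start_unique[of "Inl e" "Inl e'"] h(12) by (auto simp: Range_N)
qed

lemma q_dout_inj: "inj_on (\<lambda>e. q (Inl e)) (dout H)"
proof (rule inj_onI)
  fix e e' assume "e \<in> dout H" "e' \<in> dout H" "q (Inl e) = q (Inl e')"
  then show "e = e'" using end_unique[of "Inl e" "Inl e'"] h(13) by (auto simp: Domain_N)
qed

lemma in_at_S: "in_at S (v, w) = (\<lambda>k. q (Inr (v, k))) ` in_at (K v) w" if "v \<in> dV H"
  using that dtI_S unfolding in_at_def by auto

lemma out_at_S: "out_at S (v, w) = (\<lambda>k. q (Inr (v, k))) ` out_at (K v) w" if "v \<in> dV H"
  using that dtO_S unfolding out_at_def by auto

text \<open>A finite class lying in the range or in the domain of \<open>N\<close> lies in both.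
  Each edge of a piece on it is then an input and an output of that piece, so the piece is a bare
  edge. The part of \<open>H\<close> met by the class is closed under attachment and hence all of
  \<open>H\<close>, which leaves a single edge and no vertices.\<close>

lemma cycle_nodeless:
  assumes x: "x \<in> points" and c: "q x \<subseteq> Range N \<or> q x \<subseteq> Domain N"
  shows "dnodeless_loop S"
proof -
  have fin: "finite (q x)" by (rule finite_subset[OF _ finite_points]) (use q_points[OF x] in auto)
  have pred: "\<exists>z\<in>q x. (z, y) \<in> N" if "y \<in> q x" "y \<in> Range N" for y
    using that q_N mem_q' by blast
  have succ: "\<exists>z\<in>q x. (z, y) \<in> N\<inverse>" if "y \<in> q x" "y \<in> Domain N" for y
    using that q_N mem_q' by blast
  have R: "q x \<subseteq> Range N" and D: "q x \<subseteq> Domain N"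
    using c all_pred_imp_all_succ[OF fin single_valued_N(1)] all_pred_imp_all_succ[OF fin single_valued_N(2)]
      pred succ by (auto simp: subset_iff)
  have iso: "k \<in> din (K v) \<and> k \<in> dout (K v)" "v \<in> dV H" if "Inr (v, k) \<in> q x" for v k
    using subsetD[OF R that] subsetD[OF D that] by (auto simp: Domain_N Range_N)
  \<comment> \<open>The edges and vertices of \<open>H\<close> through which the class passes; the
    preceding fact \<open>iso\<close> shows that a vertex in \<open>W\<close> has one input and one
    output, both in \<open>A\<close>.\<close>
  define A W where "A = {e \<in> dE H. Inl e \<in> q x}" and "W = {v \<in> dV H. \<exists>k. Inr (v, k) \<in> q x}"
  have "A = dE H \<and> W = dV H"
  proof (intro conjI connected_digraph_closed[OF H])
    show I: "e \<in> A \<longleftrightarrow> dtI H e \<in> W" if e: "e \<in> dI H" for e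
    proof -
      obtain k where k: "k \<in> din (K (dtI H e))" "\<alpha> (dtI H e) k = e" using \<alpha>_surj[OF e] by blast
      have eq: "q (Inl e) = q (Inr (dtI H e, k))" using q_\<alpha>[OF h(7)[OF e] k(1)] k(2) by simp
      show ?thesis
      proof
        assume "e \<in> A" then show "dtI H e \<in> W" using eq h(7)[OF e] by (auto simp: A_def W_def mem_q')
      next
        assume "dtI H e \<in> W"
        then obtain k' where k': "Inr (dtI H e, k') \<in> q x" by (auto simp: W_def)
        then have "k' = k"
          using connected_digraph_isolated_edge(5)[OF K[OF h(7)[OF e]], of k'] iso(1)[OF k'] k(1) by auto
        then show "e \<in> A" using eq k' e h(3) by (auto simp: A_def mem_q')
      qed
    qed
    show OO: "e \<in> A \<longleftrightarrow> dtO H e \<in> W" if e: "e \<in> dO H" for e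
    proof -
      obtain k where k: "k \<in> dout (K (dtO H e))" "\<beta> (dtO H e) k = e" using \<beta>_surj[OF e] by blast
      have eq: "q (Inl e) = q (Inr (dtO H e, k))" using q_\<beta>[OF h(8)[OF e] k(1)] k(2) by simp
      show ?thesis
      proof
        assume "e \<in> A" then show "dtO H e \<in> W" using eq h(8)[OF e] by (auto simp: A_def W_def mem_q')
      next
        assume "dtO H e \<in> W"
        then obtain k' where k': "Inr (dtO H e, k') \<in> q x" by (auto simp: W_def)
        then have "k' = k"
          using connected_digraph_isolated_edge(6)[OF K[OF h(8)[OF e]], of k'] iso(1)[OF k'] k(1) by auto
        then show "e \<in> A" using eq k' e h(4) by (auto simp: A_def mem_q')
      qed
    qed
    show "A \<noteq> {} \<or> W \<noteq> {}" "A \<noteq> {} \<or> W \<noteq> {}"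
      using x q_self[of x] unfolding points_def A_def W_def by auto
    show "e \<in> A \<longleftrightarrow> dtI H e \<in> W" if "e \<in> dI H" for e using I[OF that] .
    show "e \<in> A \<longleftrightarrow> dtO H e \<in> W" if "e \<in> dO H" for e using OO[OF that] .
  qed (auto simp: A_def W_def)
  then have AW: "\<And>e. e \<in> dE H \<Longrightarrow> Inl e \<in> q x"
    and WV: "\<And>v. v \<in> dV H \<Longrightarrow> \<exists>k. Inr (v, k) \<in> q x" unfolding A_def W_def by blast+
  have Kiso: "\<exists>k. Inr (v, k) \<in> q x \<and> dE (K v) = {k} \<and> dV (K v) = {} \<and> dI (K v) = {} \<and> dO (K v) = {}" if v: "v \<in> dV H" for v
  proof -
    obtain k where k: "Inr (v, k) \<in> q x" using WV[OF v] by auto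
    then show ?thesis using connected_digraph_isolated_edge[OF K[OF v]] iso(1)[OF k] by blast
  qed
  have "y \<in> q x" if "y \<in> points" for y
  proof (cases y)
    case (Inl e) then show ?thesis using that AW unfolding points_def by auto
  next
    case (Inr p) then show ?thesis using that Kiso[of "fst p"] unfolding points_def by auto
  qed
  then have qc: "q y = q x" if "y \<in> points" for y using that mem_q'[of y x] by simp
  have "q ` points = (\<lambda>_. q x) ` points" by (rule image_cong[OF refl qc])
  also have "\<dots> = {q x}" by (rule image_constant[OF x])
  finally have "q ` points = {q x}" .
  moreover have "(SIGMA v:dV H. dI (K v)) = {}" "(SIGMA v:dV H. dO (K v)) = {}" "(SIGMA v:dV H. dV (K v)) = {}"
    using Kiso by fastforce+
  moreover have "din H = {}" "dout H = {}"
  proof -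
    have "e \<in> dO H \<and> e \<in> dI H" if "e \<in> dE H" for e
      using subsetD[OF R AW[OF that]] subsetD[OF D AW[OF that]] by (simp add: Domain_N Range_N)
    then show "din H = {}" "dout H = {}" using h(10-13) by blast+
  qed
  ultimately show ?thesis unfolding dnodeless_loop_def by simp
qed

section \<open>The substituted graph is a connected directed graph\<close>

text \<open>A nodeless loop has no inputs and outputs, so no edge is attached to \<open>v\<close>,
  and \<open>v\<close> alone is a component of \<open>H\<close>.\<close>

lemma nodeless_piece:
  assumes v: "v \<in> dV H" and n: "dnodeless_loop (K v)"
  shows "dnodeless_loop S"
proof -
  obtain k where k: "dE (K v) = {k}" "dV (K v) = {}" "dI (K v) = {}" "dO (K v) = {}" "din (K v) = {}" "dout (K v) = {}"
    using n unfolding dnodeless_loop_def by (auto simp: card_1_singleton_iff)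
  have at: "in_at H v = {}" "out_at H v = {}"
    using bij_betw_imp_surj_on[OF \<alpha>[OF v]] bij_betw_imp_surj_on[OF \<beta>[OF v]] k by auto
  have "{} = dE H \<and> {v} = dV H"
    by (intro conjI connected_digraph_closed[OF H, of "{}" "{v}"])
      (use v at in \<open>auto simp: in_at_def out_at_def\<close>)
  then have "dE H = {}" "dV H = {v}" "din H = {}" "dout H = {}" using h(10,11) by auto
  then show ?thesis unfolding dnodeless_loop_def using k by (simp add: points_def Sigma_def)
qed

text \<open>The usual formulas for inputs and outputs can only fail if \<open>H\<close> or a piece
  is a nodeless loop or if some class has no start or no end, and each of these turns the result
  into a nodeless loop. Otherwise membership in \<open>din S\<close> and \<open>dO S\<close> is read
  off the start of a class, and membership in \<open>dout S\<close> and \<open>dI S\<close> off its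
  end.\<close>

lemma S_digraph: "digraph S"
proof -
  have "dnodeless_loop S \<or> (din S = dE S - dO S \<and> dout S = dE S - dI S)"
  proof (cases "dnodeless_loop H \<or> (\<exists>v\<in>dV H. dnodeless_loop (K v)) \<or>
      (\<exists>x\<in>points. q x \<subseteq> Range N \<or> q x \<subseteq> Domain N)")
    case True
    then consider "dnodeless_loop H" | v where "v \<in> dV H" "dnodeless_loop (K v)"
      | x where "x \<in> points" "q x \<subseteq> Range N \<or> q x \<subseteq> Domain N" by blast
    then have "dnodeless_loop S"
    proof cases
      case 1
      then obtain e where "dE H = {e}" "dV H = {}" "din H = {}" "dout H = {}"
        unfolding dnodeless_loop_def by (auto simp: card_1_singleton_iff)
      then show ?thesis unfolding dnodeless_loop_def by (simp add: points_def)
    next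
      case (2 v)
      then show ?thesis by (rule nodeless_piece)
    next
      case (3 x) then show ?thesis by (rule cycle_nodeless)
    qed
    then show ?thesis ..
  next
    case False
    have hh: "din H = dE H - dO H" "dout H = dE H - dI H" using h(9) False by auto
    have kk: "din (K v) = dE (K v) - dO (K v)" "dout (K v) = dE (K v) - dI (K v)" if "v \<in> dV H" for v
      using Kd(9)[OF that] False that by auto
    have start: "\<exists>y\<in>points. q x = q y \<and> y \<notin> Range N" if "x \<in> points" for x
      using False that q_points[OF that] mem_q' by (metis subsetI)
    have stop: "\<exists>y\<in>points. q x = q y \<and> y \<notin> Domain N" if "x \<in> points" for x
      using False that q_points[OF that] mem_q' by (metis subsetI)
    have "c \<in> q ` Inl ` din H \<longleftrightarrow> c \<notin> q ` Inr ` (SIGMA v:dV H. dO (K v))" if c: "c \<in> q ` points" for c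
    proof -
      obtain y where y: "y \<in> points" "c = q y" "y \<notin> Range N" using c start by (metis imageE)
      have 1: "c \<in> q ` Inl ` din H \<longleftrightarrow> y \<in> Inl ` din H"
      proof
        assume "c \<in> q ` Inl ` din H"
        then obtain e where e: "e \<in> din H" "c = q (Inl e)" by auto
        have "y = Inl e" by (rule start_unique[OF y(3)]) (use e y h(12) in \<open>auto simp: Range_N\<close>)
        then show "y \<in> Inl ` din H" using e by auto
      qed (use y in auto)
      have 2: "c \<in> q ` Inr ` (SIGMA v:dV H. dO (K v)) \<longleftrightarrow> y \<in> Inr ` (SIGMA v:dV H. dO (K v))"
      proof
        assume "c \<in> q ` Inr ` (SIGMA v:dV H. dO (K v))"
        then obtain v k where vk: "v \<in> dV H" "k \<in> dO (K v)" "c = q (Inr (v, k))" by auto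
        have "y = Inr (v, k)" by (rule start_unique[OF y(3)]) (use vk y Kd(12)[OF vk(1)] in \<open>auto simp: Range_N\<close>)
        then show "y \<in> Inr ` (SIGMA v:dV H. dO (K v))" using vk by auto
      qed (use y in auto)
      show ?thesis unfolding 1 2
        using y(1,3) hh kk h(4) unfolding points_def by (auto simp: Range_N)
    qed
    moreover have "c \<in> q ` Inl ` dout H \<longleftrightarrow> c \<notin> q ` Inr ` (SIGMA v:dV H. dI (K v))" if c: "c \<in> q ` points" for c
    proof -
      obtain y where y: "y \<in> points" "c = q y" "y \<notin> Domain N" using c stop by (metis imageE)
      have 1: "c \<in> q ` Inl ` dout H \<longleftrightarrow> y \<in> Inl ` dout H"
      proof
        assume "c \<in> q ` Inl ` dout H"
        then obtain e where e: "e \<in> dout H" "c = q (Inl e)" by auto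
        have "y = Inl e" by (rule end_unique[OF y(3)]) (use e y h(13) in \<open>auto simp: Domain_N\<close>)
        then show "y \<in> Inl ` dout H" using e by auto
      qed (use y in auto)
      have 2: "c \<in> q ` Inr ` (SIGMA v:dV H. dI (K v)) \<longleftrightarrow> y \<in> Inr ` (SIGMA v:dV H. dI (K v))"
      proof
        assume "c \<in> q ` Inr ` (SIGMA v:dV H. dI (K v))"
        then obtain v k where vk: "v \<in> dV H" "k \<in> dI (K v)" "c = q (Inr (v, k))" by auto
        have "y = Inr (v, k)" by (rule end_unique[OF y(3)]) (use vk y Kd(13)[OF vk(1)] in \<open>auto simp: Domain_N\<close>)
        then show "y \<in> Inr ` (SIGMA v:dV H. dI (K v))" using vk by auto
      qed (use y in auto)
      show ?thesis unfolding 1 2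
        using y(1,3) hh kk h(3) unfolding points_def by (auto simp: Domain_N)
    qed
    moreover have "q ` Inl ` din H \<subseteq> q ` points" "q ` Inl ` dout H \<subseteq> q ` points"
      using h(10,11) unfolding points_def by auto
    ultimately have "din S = dE S - dO S" "dout S = dE S - dI S"
      unfolding S_simps set_eq_iff subset_iff Diff_iff by meson+
    then show ?thesis by blast
  qed
  moreover have "dI S \<subseteq> dE S" "dO S \<subseteq> dE S" unfolding S_simps points_def
    by (intro image_mono; use Kd(3,4) in blast)+
  moreover have "dtI S \<in> dI S \<rightarrow>\<^sub>E dV S" unfolding PiE_iff using dtI_S dtI_ext Kd(7) by auto
  moreover have "dtO S \<in> dO S \<rightarrow>\<^sub>E dV S" unfolding PiE_iff using dtO_S dtO_ext Kd(8) by auto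
  moreover have "finite (dE S)" "finite (dV S)" using finite_points h(2) Kd(2) by auto
  ultimately show ?thesis unfolding digraph_def by blast
qed

text \<open>A decomposition restricts to every piece, where it is all or nothing by connectedness.
  The pieces chosen in full then define a decomposition of \<open>H\<close>, since an edge of
  \<open>H\<close> at \<open>v\<close> is identified with an edge of the piece at
  \<open>v\<close>.\<close>

lemma S_connected: "connected_digraph S"
proof -
  have "A = {} \<and> W = {} \<or> A = dE S \<and> W = dV S"
    if A: "A \<subseteq> dE S" "W \<subseteq> dV S" "\<forall>e\<in>dI S. e \<in> A \<longleftrightarrow> dtI S e \<in> W" "\<forall>e\<in>dO S. e \<in> A \<longleftrightarrow> dtO S e \<in> W" for A W
  proof -
    define Av Wv where "Av v = {k \<in> dE (K v). q (Inr (v, k)) \<in> A}" and "Wv v = {w \<in> dV (K v). (v, w) \<in> W}" for v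
    have loc: "Av v = {} \<and> Wv v = {} \<or> Av v = dE (K v) \<and> Wv v = dV (K v)" if v: "v \<in> dV H" for v
    proof -
      have "Av v \<noteq> {} \<or> Wv v \<noteq> {} \<Longrightarrow> Av v = dE (K v) \<and> Wv v = dV (K v)"
      proof (intro conjI connected_digraph_closed[OF K[OF v]])
        show I: "k \<in> Av v \<longleftrightarrow> dtI (K v) k \<in> Wv v" if k: "k \<in> dI (K v)" for k
        proof -
          have "q (Inr (v, k)) \<in> dI S" using v k by auto
          then have "q (Inr (v, k)) \<in> A \<longleftrightarrow> (v, dtI (K v) k) \<in> W" using A(3) dtI_S[OF v k] by metis
          then show ?thesis using k Kd(3)[OF v] Kd(7)[OF v k] unfolding Av_def Wv_def by auto
        qed
        show OO: "k \<in> Av v \<longleftrightarrow> dtO (K v) k \<in> Wv v" if k: "k \<in> dO (K v)" for k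
        proof -
          have "q (Inr (v, k)) \<in> dO S" using v k by auto
          then have "q (Inr (v, k)) \<in> A \<longleftrightarrow> (v, dtO (K v) k) \<in> W" using A(4) dtO_S[OF v k] by metis
          then show ?thesis using k Kd(4)[OF v] Kd(8)[OF v k] unfolding Av_def Wv_def by auto
        qed
        show "k \<in> Av v \<longleftrightarrow> dtI (K v) k \<in> Wv v" if k: "k \<in> dI (K v)" for k using I[OF k] .
        show "k \<in> Av v \<longleftrightarrow> dtO (K v) k \<in> Wv v" if k: "k \<in> dO (K v)" for k using OO[OF k] .
      qed (auto simp: Av_def Wv_def)
      then show ?thesis by blast
    qed
    \<comment> \<open>The decomposition that is induced on \<open>H\<close>: the vertices whose
      pieces are taken entirely, and the edges whose classes are taken.\<close>
    define V0 E0 where "V0 = {v \<in> dV H. Av v = dE (K v) \<and> Wv v = dV (K v)}" and "E0 = {e \<in> dE H. q (Inl e) \<in> A}"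
    have V0: "k \<in> Av v \<longleftrightarrow> v \<in> V0" if "v \<in> dV H" "k \<in> dE (K v)" for v k
      using loc[OF that(1)] that unfolding V0_def by auto
    have V1: "w \<in> Wv v \<longleftrightarrow> v \<in> V0" if "v \<in> dV H" "w \<in> dV (K v)" for v w
      using loc[OF that(1)] that unfolding V0_def by auto
    have I: "e \<in> E0 \<longleftrightarrow> dtI H e \<in> V0" if e: "e \<in> dI H" for e
    proof -
      obtain k where k: "k \<in> din (K (dtI H e))" "\<alpha> (dtI H e) k = e" using \<alpha>_surj[OF e] by blast
      have "q (Inl e) = q (Inr (dtI H e, k))" using q_\<alpha>[OF h(7)[OF e] k(1)] k(2) by simp
      then show ?thesis
        using V0[OF h(7)[OF e], of k] k(1) Kd(10)[OF h(7)[OF e]] e h(3) unfolding E0_def Av_def by auto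
    qed
    have OO: "e \<in> E0 \<longleftrightarrow> dtO H e \<in> V0" if e: "e \<in> dO H" for e
    proof -
      obtain k where k: "k \<in> dout (K (dtO H e))" "\<beta> (dtO H e) k = e" using \<beta>_surj[OF e] by blast
      have "q (Inl e) = q (Inr (dtO H e, k))" using q_\<beta>[OF h(8)[OF e] k(1)] k(2) by simp
      then show ?thesis
        using V0[OF h(8)[OF e], of k] k(1) Kd(11)[OF h(8)[OF e]] e h(4) unfolding E0_def Av_def by auto
    qed
    have AA: "A = q ` {x \<in> points. q x \<in> A}" using A(1) by auto
    have WW: "W = {(v, w). v \<in> dV H \<and> w \<in> Wv v}" using A(2) unfolding Wv_def by auto
    have mA: "q x \<in> A \<longleftrightarrow> (case x of Inl e \<Rightarrow> e \<in> E0 | Inr (v, k) \<Rightarrow> v \<in> V0)" if "x \<in> points" for x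
      using that V0 unfolding points_def E0_def Av_def by auto
    have "E0 = {} \<and> V0 = {} \<or> E0 = dE H \<and> V0 = dV H"
    proof -
      have "E0 \<noteq> {} \<or> V0 \<noteq> {} \<Longrightarrow> E0 = dE H \<and> V0 = dV H"
        by (intro conjI connected_digraph_closed[OF H, of E0 V0]) (use I OO in \<open>auto simp: E0_def V0_def\<close>)
      then show ?thesis by blast
    qed
    then show ?thesis
    proof
      assume e: "E0 = {} \<and> V0 = {}"
      then have "{x \<in> points. q x \<in> A} = {}" using mA by (auto split: sum.splits)
      then have "A = {}" using AA by (metis image_empty)
      moreover have "W = {}" using WW V1 e unfolding Wv_def by auto
      ultimately show ?thesis by blast
    next
      assume e: "E0 = dE H \<and> V0 = dV H"
      then have "{x \<in> points. q x \<in> A} = points" using mA unfolding points_def by auto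
      then have "A = dE S" unfolding S_simps by (metis AA)
      moreover have "W = dV S" using WW V1 e unfolding Wv_def by auto
      ultimately show ?thesis by blast
    qed
  qed
  moreover have "dE S \<noteq> {} \<or> dV S \<noteq> {}"
  proof (cases "dE H = {}")
    case False then show ?thesis by (auto simp: points_def)
  next
    case True
    then obtain v where v: "v \<in> dV H" using connected_digraphD(2)[OF H] by auto
    then show ?thesis using connected_digraphD(2)[OF K[OF v]] by (auto simp: points_def)
  qed
  ultimately show ?thesis unfolding connected_digraph_def using S_digraph by blast
qed

section \<open>Local maps out of and into a substituted graph\<close>

lemma const_on_q:
  assumes "\<And>v k. v \<in> dV H \<Longrightarrow> k \<in> din (K v) \<Longrightarrow> m (Inl (\<alpha> v k)) = m (Inr (v, k))"
    and "\<And>v k. v \<in> dV H \<Longrightarrow> k \<in> dout (K v) \<Longrightarrow> m (Inl (\<beta> v k)) = m (Inr (v, k))"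
  shows "the_elem (m ` q x) = m x"
proof -
  have c: "m y = m x" if "(x, y) \<in> (N \<union> N\<inverse>)\<^sup>*" for y
    using that
  proof induction
    case (step y z) then show ?case using assms unfolding N_def by auto
  qed simp
  have "m ` q x = (\<lambda>_. m x) ` q x" by (rule image_cong[OF refl]) (rule c, simp only: mem_q)
  also have "\<dots> = {m x}" by (rule image_constant[OF q_self])
  finally have "m ` q x = {m x}" .
  then show ?thesis by simp
qed

text \<open>A vertex of the substituted graph has the inputs and outputs it has in its piece, so the
  bijections at vertices are those of the maps \<open>\<kappa> v\<close>. On edges it suffices that
  \<open>m\<close> agrees on elements that are glued.\<close>

lemma S_local_map:
  fixes G' :: "('f, 'u) digraph" and \<kappa> :: "'v \<Rightarrow> ('k \<Rightarrow> 'f) \<times> ('w \<Rightarrow> 'u)" and m :: "'e + 'v \<times> 'k \<Rightarrow> 'f"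
  assumes m: "\<And>v k. v \<in> dV H \<Longrightarrow> k \<in> din (K v) \<Longrightarrow> m (Inl (\<alpha> v k)) = m (Inr (v, k))"
      "\<And>v k. v \<in> dV H \<Longrightarrow> k \<in> dout (K v) \<Longrightarrow> m (Inl (\<beta> v k)) = m (Inr (v, k))"
    and m_H: "\<And>e. e \<in> dE H \<Longrightarrow> m (Inl e) \<in> dE G'"
    and \<kappa>: "\<And>v. v \<in> dV H \<Longrightarrow> local_map (K v) G' (\<kappa> v)"
    and m_K: "\<And>v k. v \<in> dV H \<Longrightarrow> k \<in> dE (K v) \<Longrightarrow> m (Inr (v, k)) = fst (\<kappa> v) k"
  shows "local_map S G' (restrict (\<lambda>c. the_elem (m ` c)) (dE S), restrict (\<lambda>(v, w). snd (\<kappa> v) w) (dV S))"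
    (is "local_map S G' ?f")
proof -
  note k = local_mapD[OF \<kappa> connected_digraphD(1)[OF K]]
  note s = digraphD[OF S_digraph]
  have mq: "fst ?f (q x) = m x" if "x \<in> points" for x using that const_on_q[of m, OF m] by simp
  have mqI: "fst ?f (q (Inr (v, k))) = fst (\<kappa> v) k" if "v \<in> dV H" "k \<in> dE (K v)" for v k
    using mq[of "Inr (v, k)"] that m_K unfolding points_def by auto
  have aux: "bij_betw (fst ?f) ((\<lambda>k. q (Inr (v, k))) ` B) C"
    if v: "v \<in> dV H" and B: "B \<subseteq> dE (K v)" and b: "bij_betw (fst (\<kappa> v)) B C" for v B C
  proof -
    have "inj_on (fst ?f) ((\<lambda>k. q (Inr (v, k))) ` B)"
      using b v B mqI unfolding bij_betw_def inj_on_def by (auto simp: subset_iff)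
    moreover have "fst ?f ` (\<lambda>k. q (Inr (v, k))) ` B = fst (\<kappa> v) ` B"
      unfolding image_image by (rule image_cong[OF refl]) (rule mqI[OF v], use B in auto)
    ultimately show ?thesis using b unfolding bij_betw_def by simp
  qed
  show ?thesis
    unfolding local_map_iff[OF S_digraph]
  proof (intro conjI ballI)
    have "m x \<in> dE G'" if "x \<in> points" for x
      using that m_H m_K k(3) unfolding points_def by auto
    then show "fst ?f \<in> dE S \<rightarrow>\<^sub>E dE G'" using mq by (auto simp: PiE_iff)
    show "snd ?f \<in> dV S \<rightarrow>\<^sub>E dV G'" using k(4) by (auto simp: PiE_iff)
  next
    fix c assume "c \<in> dI S"
    then obtain v j where c: "v \<in> dV H" "j \<in> dI (K v)" "c = q (Inr (v, j))" by auto
    have j: "j \<in> dE (K v)" using c Kd(3)[OF c(1)] by auto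
    show "fst ?f c \<in> dI G'" using mqI[OF c(1) j] k(5)[OF c(1,1,2)] c(3) by simp
    show "dtI G' (fst ?f c) = snd ?f (dtI S c)"
      using mqI[OF c(1) j] k(6)[OF c(1,1,2)] c dtI_S[OF c(1,2)] Kd(7)[OF c(1,2)] by simp
  next
    fix c assume "c \<in> dO S"
    then obtain v j where c: "v \<in> dV H" "j \<in> dO (K v)" "c = q (Inr (v, j))" by auto
    have j: "j \<in> dE (K v)" using c Kd(4)[OF c(1)] by auto
    show "fst ?f c \<in> dO G'" using mqI[OF c(1) j] k(7)[OF c(1,1,2)] c(3) by simp
    show "dtO G' (fst ?f c) = snd ?f (dtO S c)"
      using mqI[OF c(1) j] k(8)[OF c(1,1,2)] c dtO_S[OF c(1,2)] Kd(8)[OF c(1,2)] by simp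
  next
    fix u assume "u \<in> dV S"
    then obtain v w where u: "u = (v, w)" "v \<in> dV H" "w \<in> dV (K v)" by auto
    have e: "snd ?f u = snd (\<kappa> v) w" using u by simp
    show "bij_betw (fst ?f) (in_at S u) (in_at G' (snd ?f u))"
      unfolding e unfolding u(1) in_at_S[OF u(2)]
      by (rule aux[OF u(2)]) (use k(9)[OF u(2,2,3)] Kd(3)[OF u(2)] in \<open>auto simp: in_at_def\<close>)
    show "bij_betw (fst ?f) (out_at S u) (out_at G' (snd ?f u))"
      unfolding e unfolding u(1) out_at_S[OF u(2)]
      by (rule aux[OF u(2)]) (use k(10)[OF u(2,2,3)] Kd(4)[OF u(2)] in \<open>auto simp: out_at_def\<close>)
  qed
qed

text \<open>The inclusion of one piece. It is bijective at each vertex because elements of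
  \<open>I(K v)\<close> stay distinct as ends of their classes and those of \<open>O(K v)\<close> as
  starts; maps between substituted graphs are assembled from these inclusions.\<close>

lemma insert_local_map:
  assumes v: "v \<in> dV H"
  shows "local_map (K v) S (restrict (\<lambda>k. q (Inr (v, k))) (dE (K v)), restrict (Pair v) (dV (K v)))"
    (is "local_map _ _ ?f")
proof -
  note k = Kd[OF v]
  have bij: "bij_betw (fst ?f) B ((\<lambda>k. q (Inr (v, k))) ` B)"
    if "B \<subseteq> dE (K v)" "inj_on (\<lambda>k. q (Inr (v, k))) B" for B
    using that(2) by (rule bij_betw_cong[THEN iffD1, OF _ inj_on_imp_bij_betw, rotated]) (use that(1) in auto)
  show ?thesis
    unfolding local_map_iff[OF connected_digraphD(1)[OF K[OF v]]]
  proof (intro conjI ballI)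
    show "fst ?f \<in> dE (K v) \<rightarrow>\<^sub>E dE S" using v by (auto simp: points_def)
    show "snd ?f \<in> dV (K v) \<rightarrow>\<^sub>E dV S" using v by auto
  next
    fix j assume j: "j \<in> dI (K v)"
    then have "j \<in> dE (K v)" using k(3) by auto
    then show "fst ?f j \<in> dI S" "dtI S (fst ?f j) = snd ?f (dtI (K v) j)"
      using v j dtI_S[OF v j] k(7)[OF j] by auto
  next
    fix j assume j: "j \<in> dO (K v)"
    then have "j \<in> dE (K v)" using k(4) by auto
    then show "fst ?f j \<in> dO S" "dtO S (fst ?f j) = snd ?f (dtO (K v) j)"
      using v j dtO_S[OF v j] k(8)[OF j] by auto
  next
    fix w assume w: "w \<in> dV (K v)"
    have s: "snd ?f w = (v, w)" using w by simp
    show "bij_betw (fst ?f) (in_at (K v) w) (in_at S (snd ?f w))"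
      unfolding s in_at_S[OF v]
      by (rule bij) (use k(3) q_dI_inj[OF v _ v] in \<open>auto simp: in_at_def inj_on_def\<close>)
    show "bij_betw (fst ?f) (out_at (K v) w) (out_at S (snd ?f w))"
      unfolding s out_at_S[OF v]
      by (rule bij) (use k(4) q_dO_inj[OF v _ v] in \<open>auto simp: out_at_def inj_on_def\<close>)
  qed
qed

end

section \<open>Pieces and wheeled maps\<close>

lemma dnodeless_loop_iff:
  assumes "connected_digraph G"
  shows "dnodeless_loop G \<longleftrightarrow> dV G = {} \<and> din G = {} \<and> dout G = {}"
  using nodeless_loop_iff[of "ug G"] assms unfolding ug_connected ug_nodeless by auto

lemma signed_image:
  assumes "\<And>e s. e \<in> A \<union> B \<Longrightarrow> g (e, s) = (f e, s)"
  shows "g ` (A \<times> {True} \<union> B \<times> {False}) = f ` A \<times> {True} \<union> f ` B \<times> {False}"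
proof -
  have "A \<times> {True} \<union> B \<times> {False} = (\<lambda>e. (e, True)) ` A \<union> (\<lambda>e. (e, False)) ` B" by auto
  moreover have "f ` A \<times> {True} \<union> f ` B \<times> {False} = (\<lambda>e. (f e, True)) ` A \<union> (\<lambda>e. (f e, False)) ` B" by auto
  ultimately show ?thesis using assms by (simp add: image_Un image_image cong: image_cong)
qed

lemma signed_Times_eq:
  "A \<times> {True} \<union> B \<times> {False} = A' \<times> {True} \<union> B' \<times> {False} \<longleftrightarrow> A = A' \<and> B = B'"
  by (auto simp: set_eq_iff)

lemma dembedding_inj_din:
  assumes "dembedding H G f"
  shows "inj_on (fst f) (din H)" "inj_on (fst f) (dout H)"
proof -
  note d = digraphD[OF dembeddingD(6)[OF assms]]
  have i: "inj_on (fst (ugm H f)) (bnd (ug H))" by (rule embedding_inj_bnd[OF dembedding_ug[OF assms]])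
  show "inj_on (fst f) (din H)"
  proof (rule inj_onI)
    fix x y assume "x \<in> din H" "y \<in> din H" "fst f x = fst f y"
    then show "x = y" using inj_onD[OF i, of "(x, True)" "(y, True)"] d(10) by (auto simp: subset_iff)
  qed
  show "inj_on (fst f) (dout H)"
  proof (rule inj_onI)
    fix x y assume "x \<in> dout H" "y \<in> dout H" "fst f x = fst f y"
    then show "x = y" using inj_onD[OF i, of "(x, False)" "(y, False)"] d(11) by (auto simp: subset_iff)
  qed
qed

text \<open>The uniqueness of embeddings of undirected graphs is applied to signed arcs. The
  isomorphism obtained preserves signs because it commutes with the maps to \<open>G\<close>, which
  do.\<close>

lemma dembedding_isoI:
  assumes k: "dembedding K G k" and l: "dembedding L G l"
    and V: "snd k ` dV K = snd l ` dV L" and I: "fst k ` din K = fst l ` din L" and O: "fst k ` dout K = fst l ` dout L"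
  shows "\<exists>z. digraph_iso K L z \<and> (\<forall>e\<in>dE K. fst k e = fst l (fst z e)) \<and> (\<forall>v\<in>dV K. snd k v = snd l (snd z v))"
proof -
  note dK = digraphD[OF dembeddingD(6)[OF k]] and dL = digraphD[OF dembeddingD(6)[OF l]]
  have bk: "fst (ugm K k) ` bnd (ug K) = fst k ` din K \<times> {True} \<union> fst k ` dout K \<times> {False}"
    unfolding ug_simps by (rule signed_image) (use dK(10,11) in auto)
  have bl: "fst (ugm L l) ` bnd (ug L) = fst l ` din L \<times> {True} \<union> fst l ` dout L \<times> {False}"
    unfolding ug_simps by (rule signed_image) (use dL(10,11) in auto)
  obtain Z where Z: "ugraph_iso (ug K) (ug L) Z"
    "\<forall>a\<in>arcs (ug K). fst (ugm K k) a = fst (ugm L l) (fst Z a)"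
    "\<forall>v\<in>verts (ug K). snd (ugm K k) v = snd (ugm L l) (snd Z v)"
    using embedding_isoI[OF dembedding_ug[OF k] dembedding_ug[OF l]] V I O bk bl by auto
  have eZ: "etale (ug K) (ug L) Z" using Z(1) unfolding ugraph_iso_def by auto
  note e = etaleD[OF eZ]
  \<comment> \<open>The isomorphism of signed arcs is restricted to positive arcs; \<open>Zz\<close>
    below recovers it from there.\<close>
  define z where "z = (restrict (\<lambda>e. fst (fst Z (e, True))) (dE K), snd Z)"
  have zT: "fst Z (x, True) = (fst z x, True) \<and> fst z x \<in> dE L \<and> fst k x = fst l (fst z x)" if x: "x \<in> dE K" for x
  proof -
    have "fst Z (x, True) \<in> arcs (ug L)" using e(3)[of "(x, True)"] x by auto
    moreover have "fst (ugm K k) (x, True) = fst (ugm L l) (fst Z (x, True))" using Z(2) x by auto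
    ultimately show ?thesis using x by (cases "fst Z (x, True)") (auto simp: z_def)
  qed
  have Zz: "fst Z (x, s) = (fst z x, s)" if x: "x \<in> dE K" for x s
  proof (cases s)
    case False
    have "fst Z (dag (ug K) (x, True)) = dag (ug L) (fst Z (x, True))" using e(5)[of "(x, True)"] x by auto
    then show ?thesis using zT[OF x] x False by simp
  qed (use zT[OF x] in simp)
  have "ugm K z = Z"
  proof (rule prod_eqI)
    have "fst Z \<in> extensional (dE K \<times> UNIV)" using e(1) by (simp add: PiE_iff)
    then show "fst (ugm K z) = fst Z"
      by (intro extensionalityI[of _ "dE K \<times> UNIV"]) (auto simp: Zz ugm_def)
    show "snd (ugm K z) = snd Z" by (simp add: z_def)
  qed
  then have loc: "local_map K L z"
    using ug_etale[OF dembeddingD(6)[OF k] dembeddingD(6)[OF l], of z] eZ by (simp add: z_def)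
  have b: "bij_betw (fst Z) (arcs (ug K)) (arcs (ug L))" "bij_betw (snd Z) (verts (ug K)) (verts (ug L))"
    "fst Z ` darts (ug K) = darts (ug L)" "fst Z ` bnd (ug K) = bnd (ug L)"
    using Z(1) unfolding ugraph_iso_def by auto
  have "inj_on (fst z) (dE K)"
  proof (rule inj_onI)
    fix x y assume "x \<in> dE K" "y \<in> dE K" "fst z x = fst z y"
    then show "x = y" using inj_onD[OF bij_betw_imp_inj_on[OF b(1)], of "(x, True)" "(y, True)"] Zz by auto
  qed
  moreover have "fst z ` dE K = dE L"
  proof -
    have U: "arcs (ug M) = dE M \<times> {True} \<union> dE M \<times> {False}" for M :: "('x, 'y) digraph" by (auto simp: UNIV_bool)
    have "fst Z ` arcs (ug K) = fst z ` dE K \<times> {True} \<union> fst z ` dE K \<times> {False}"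
      unfolding U by (rule signed_image) (use Zz in auto)
    then show ?thesis using bij_betw_imp_surj_on[OF b(1)] unfolding U by (metis (no_types) signed_Times_eq)
  qed
  moreover have "fst z ` dO K = dO L \<and> fst z ` dI K = dI L"
  proof -
    have "fst Z ` darts (ug K) = fst z ` dO K \<times> {True} \<union> fst z ` dI K \<times> {False}"
      unfolding ug_simps by (rule signed_image) (use Zz dK(3,4) in auto)
    then show ?thesis using b(3) unfolding ug_simps by (metis (no_types) signed_Times_eq)
  qed
  moreover have "fst z ` din K = din L \<and> fst z ` dout K = dout L"
  proof -
    have "fst Z ` bnd (ug K) = fst z ` din K \<times> {True} \<union> fst z ` dout K \<times> {False}"
      unfolding ug_simps by (rule signed_image) (use Zz dK(10,11) in auto)
    then show ?thesis using b(4) unfolding ug_simps by (metis (no_types) signed_Times_eq)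
  qed
  ultimately have "digraph_iso K L z" unfolding digraph_iso_def using loc b(2) by (simp add: bij_betw_def z_def)
  then show ?thesis using zT Z(3) by (intro exI[of _ z]) (simp add: z_def)
qed

section \<open>Pieces and their isomorphism classes\<close>

definition piece_match :: "('e \<Rightarrow> 'e) \<Rightarrow> ('k, 'w, 'e, 'v) piece \<Rightarrow> bool" where
  "piece_match f0 P \<longleftrightarrow> (\<forall>e\<in>din (pgraph P). fst (pmap P) e = f0 (pin P e)) \<and>
     (\<forall>e\<in>dout (pgraph P). fst (pmap P) e = f0 (pout P e))"

abbreviation piece_emb :: "('k, 'w, 'e, 'v) piece \<Rightarrow> ('e, 'v) digraph \<Rightarrow> bool" where
  "piece_emb P G \<equiv> dembedding (pgraph P) G (pmap P)"

abbreviation piece_verts :: "('k, 'w, 'e, 'v) piece \<Rightarrow> 'v set" where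
  "piece_verts P \<equiv> snd (pmap P) ` dV (pgraph P)"

lemma bij_betw_factor_inj:
  assumes "bij_betw p A B" "inj_on k A" "\<And>e. e \<in> A \<Longrightarrow> k e = g (p e)"
  shows "inj_on g B" "k ` A = g ` B"
proof -
  show "inj_on g B"
    using assms unfolding bij_betw_def by (auto simp: inj_on_def)
  show "k ` A = g ` B"
    using assms unfolding bij_betw_def by (auto simp: image_image cong: image_cong)
qed

text \<open>Matching colours makes the images of the inputs \<open>f0\<close>
  A\<open>and those of the outputs\<close>f0 \<open>B\<close> for both pieces, so the two embeddings
  are isomorphic. As \<open>f0\<close> is injective on \<open>A\<close> and on \<open>B\<close>,
  that isomorphism is compatible with the bijections \<open>pin\<close> and \<open>pout\<close>
  too.\<close>

lemma piece_iso_unique: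
  assumes P: "piece_emb P G" "piece_match f0 P" "bij_betw (pin P) (din (pgraph P)) A" "bij_betw (pout P) (dout (pgraph P)) B"
    and Q: "piece_emb Q G" "piece_match f0 Q" "bij_betw (pin Q) (din (pgraph Q)) A" "bij_betw (pout Q) (dout (pgraph Q)) B"
    and V: "piece_verts P = piece_verts Q"
  shows "piece_iso P Q"
proof -
  note mP = P(2)[unfolded piece_match_def] and mQ = Q(2)[unfolded piece_match_def]
  note iP = bij_betw_factor_inj[OF P(3) dembedding_inj_din(1)[OF P(1)], of f0]
  note oP = bij_betw_factor_inj[OF P(4) dembedding_inj_din(2)[OF P(1)], of f0]
  note iQ = bij_betw_factor_inj[OF Q(3) dembedding_inj_din(1)[OF Q(1)], of f0]
  note oQ = bij_betw_factor_inj[OF Q(4) dembedding_inj_din(2)[OF Q(1)], of f0]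
  obtain z where z: "digraph_iso (pgraph P) (pgraph Q) z"
    "\<forall>e\<in>dE (pgraph P). fst (pmap P) e = fst (pmap Q) (fst z e)"
    "\<forall>v\<in>dV (pgraph P). snd (pmap P) v = snd (pmap Q) (snd z v)"
    using dembedding_isoI[OF P(1) Q(1) V] iP(2) iQ(2) oP(2) oQ(2) mP mQ by auto
  note d = digraphD[OF dembeddingD(6)[OF P(1)]]
  have zi: "fst z e \<in> din (pgraph Q)" if "e \<in> din (pgraph P)" for e
    using z(1) that unfolding digraph_iso_def by auto
  have zo: "fst z e \<in> dout (pgraph Q)" if "e \<in> dout (pgraph P)" for e
    using z(1) that unfolding digraph_iso_def by auto
  have "pin P e = pin Q (fst z e)" if e: "e \<in> din (pgraph P)" for e
  proof (rule inj_onD[OF iP(1)])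
    have "fst (pmap P) e = fst (pmap Q) (fst z e)" using z(2) d(10) e by blast
    then show "f0 (pin P e) = f0 (pin Q (fst z e))" using mP mQ e zi[OF e] by simp
    show "pin P e \<in> A" "pin Q (fst z e) \<in> A" using P(3) Q(3) e zi[OF e] by (auto dest: bij_betwE)
  qed (use mP in auto)
  moreover have "pout P e = pout Q (fst z e)" if e: "e \<in> dout (pgraph P)" for e
  proof (rule inj_onD[OF oP(1)])
    have "fst (pmap P) e = fst (pmap Q) (fst z e)" using z(2) d(11) e by blast
    then show "f0 (pout P e) = f0 (pout Q (fst z e))" using mP mQ e zo[OF e] by simp
    show "pout P e \<in> B" "pout Q (fst z e) \<in> B" using P(4) Q(4) e zo[OF e] by (auto dest: bij_betwE)
  qed (use mP in auto)
  ultimately show ?thesis unfolding piece_iso_def using z by blast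
qed

text \<open>Being embedded, the image of the vertices and the matching of colours are invariants of
  the class, so what is known of the chosen representative \<open>prep f v\<close> holds for every
  member.\<close>

lemma piece_iso_props:
  assumes iso: "piece_iso P Q"
    and P: "connected_digraph (pgraph P)" "local_map (pgraph P) G (pmap P)"
    and Q: "connected_digraph (pgraph Q)" "local_map (pgraph Q) G (pmap Q)"
  shows "piece_emb P G \<longleftrightarrow> piece_emb Q G" "piece_verts P = piece_verts Q" "piece_match f0 P \<longleftrightarrow> piece_match f0 Q"
proof -
  obtain z where z: "digraph_iso (pgraph P) (pgraph Q) z"
     "\<forall>e\<in>dE (pgraph P). fst (pmap P) e = fst (pmap Q) (fst z e)"
     "\<forall>w\<in>dV (pgraph P). snd (pmap P) w = snd (pmap Q) (snd z w)"
     "\<forall>e\<in>din (pgraph P). pin P e = pin Q (fst z e)" "\<forall>e\<in>dout (pgraph P). pout P e = pout Q (fst z e)"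
    using iso unfolding piece_iso_def by blast
  have b: "bij_betw (fst z) (dE (pgraph P)) (dE (pgraph Q))" "bij_betw (snd z) (dV (pgraph P)) (dV (pgraph Q))"
    and im: "fst z ` din (pgraph P) = din (pgraph Q)" "fst z ` dout (pgraph P) = dout (pgraph Q)"
    using z(1) unfolding digraph_iso_def by auto
  have V: "dV (pgraph Q) = snd z ` dV (pgraph P)" using b(2) by (simp add: bij_betw_def)
  show "piece_verts P = piece_verts Q"
    unfolding V image_image by (rule image_cong[OF refl]) (use z(3) in blast)
  have "inj_on (snd (pmap P)) (dV (pgraph P)) \<longleftrightarrow> inj_on (snd (pmap Q) \<circ> snd z) (dV (pgraph P))"
    by (rule inj_on_cong) (use z(3) in simp)
  also have "\<dots> \<longleftrightarrow> inj_on (snd (pmap Q)) (dV (pgraph Q))"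
    unfolding V using comp_inj_on_iff[OF bij_betw_imp_inj_on[OF b(2)]] by blast
  finally have "inj_on (snd (pmap P)) (dV (pgraph P)) \<longleftrightarrow> inj_on (snd (pmap Q)) (dV (pgraph Q))" .
  moreover have "dnodeless_loop (pgraph P) \<longleftrightarrow> dnodeless_loop (pgraph Q)"
    unfolding dnodeless_loop_iff[OF P(1)] dnodeless_loop_iff[OF Q(1)] V im[symmetric] by simp
  ultimately show "piece_emb P G \<longleftrightarrow> piece_emb Q G"
    unfolding dembedding_def using P Q by simp
  note d = digraphD[OF connected_digraphD(1)[OF P(1)]]
  show "piece_match f0 P \<longleftrightarrow> piece_match f0 Q"
    unfolding piece_match_def im[symmetric] using z(2,4,5) d(10,11) by (auto simp: subset_iff)
qed

lemma local_map_id: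
  assumes "digraph K"
  shows "local_map K K (restrict id (dE K), restrict id (dV K))"
proof -
  note d = digraphD[OF assms]
  have b: "bij_betw (restrict id (dE K)) A A" if "A \<subseteq> dE K" for A
    using that by (subst bij_betw_cong[of _ _ id]) auto
  show ?thesis unfolding local_map_iff[OF assms]
    using d(3,4,7,8) by (auto intro!: b simp: in_at_def out_at_def)
qed

lemma dembedding_id:
  assumes "connected_digraph K"
  shows "dembedding K K (restrict id (dE K), restrict id (dV K))"
  unfolding dembedding_def using assms local_map_id connected_digraphD(1) by (auto simp: inj_on_def)

lemma piece_iso_refl:
  assumes "digraph (pgraph P)"
  shows "piece_iso P P"
proof -
  note d = digraphD[OF assms]
  have "digraph_iso (pgraph P) (pgraph P) (restrict id (dE (pgraph P)), restrict id (dV (pgraph P)))"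
    unfolding digraph_iso_def using local_map_id[OF assms] d(3,4,10,11) by (force simp: bij_betw_def)
  then show ?thesis unfolding piece_iso_def using d(10,11)
    by (intro exI[of _ "(restrict id (dE (pgraph P)), restrict id (dV (pgraph P)))"]) (auto simp: subset_iff)
qed

lemma piecesD:
  assumes "P \<in> pieces G v G'"
  shows "connected_digraph (pgraph P)" "local_map (pgraph P) G' (pmap P)" "digraph (pgraph P)"
    "bij_betw (pin P) (din (pgraph P)) (in_at G v)" "bij_betw (pout P) (dout (pgraph P)) (out_at G v)"
  using assms connected_digraphD unfolding pieces_def by auto

lemma properad_mapD:
  assumes "properad_map G G' f"
  shows "fst f \<in> dE G \<rightarrow>\<^sub>E dE G'" "snd f \<in> extensional (dV G)"
    "v \<in> dV G \<Longrightarrow> \<exists>P\<in>pieces G v G'. snd f v = piece_class G v G' P"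
    "v \<in> dV G \<Longrightarrow> prep f v \<in> snd f v" "v \<in> dV G \<Longrightarrow> prep f v \<in> pieces G v G'"
    "v \<in> dV G \<Longrightarrow> P \<in> snd f v \<Longrightarrow> piece_match (fst f) P"
proof -
  show "fst f \<in> dE G \<rightarrow>\<^sub>E dE G'" "snd f \<in> extensional (dV G)"
    using assms unfolding properad_map_def by (auto simp: PiE_iff)
  show c: "\<exists>P\<in>pieces G v G'. snd f v = piece_class G v G' P" if "v \<in> dV G" for v
    using assms that unfolding properad_map_def PiE_iff by blast
  show p: "prep f v \<in> snd f v" if v: "v \<in> dV G" for v
  proof -
    obtain P where P: "P \<in> pieces G v G'" "snd f v = piece_class G v G' P" using c[OF v] by blast
    have "P \<in> snd f v" unfolding P(2) piece_class_def using P(1) piece_iso_refl[OF piecesD(3)[OF P(1)]] by simp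
    then show ?thesis unfolding prep_def by (rule someI)
  qed
  show "prep f v \<in> pieces G v G'" if v: "v \<in> dV G" for v
    using p[OF v] c[OF v] unfolding piece_class_def by auto
  show "piece_match (fst f) P" if "v \<in> dV G" "P \<in> snd f v" for v P
    using assms that unfolding properad_map_def piece_match_def by blast
qed

section \<open>Induced local maps and the condition on wheeled maps\<close>

lemma induced_substitution:
  assumes f: "properad_map G G' f" and H: "connected_digraph H" and h: "local_map H G h"
  shows "graph_substitution H (\<lambda>v. pgraph (prep f (snd h v)))
     (\<lambda>v e. inv_into (in_at H v) (fst h) (pin (prep f (snd h v)) e))
     (\<lambda>v e. inv_into (out_at H v) (fst h) (pout (prep f (snd h v)) e))"
proof
  note h' = local_mapD[OF h connected_digraphD(1)[OF H]]
  fix v assume v: "v \<in> dV H"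
  note P = piecesD[OF properad_mapD(5)[OF f h'(4)[OF v]]]
  show "connected_digraph (pgraph (prep f (snd h v)))" by (rule P(1))
  show "bij_betw (\<lambda>e. inv_into (in_at H v) (fst h) (pin (prep f (snd h v)) e))
      (din (pgraph (prep f (snd h v)))) (in_at H v)"
    using bij_betw_trans[OF P(4) bij_betw_inv_into[OF h'(9)[OF v]]] by (simp add: comp_def)
  show "bij_betw (\<lambda>e. inv_into (out_at H v) (fst h) (pout (prep f (snd h v)) e))
      (dout (pgraph (prep f (snd h v)))) (out_at H v)"
    using bij_betw_trans[OF P(5) bij_betw_inv_into[OF h'(10)[OF v]]] by (simp add: comp_def)
qed (rule H)

text \<open>The edge part of the induced local map before passing to classes, as a function on edges
  of the graph and of the pieces.\<close>

definition point_map :: "('e \<Rightarrow> 'e) \<times> ('v \<Rightarrow> 'v) \<Rightarrow> ('e, 'v) dmor \<Rightarrow> 'e + 'v \<times> 'e \<Rightarrow> 'e" where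
  "point_map h f = case_sum (\<lambda>e. fst f (fst h e)) (\<lambda>(v, k). fst (pmap (prep f (snd h v))) k)"

locale induced =
  fixes G G' :: "('e, 'v) digraph" and f :: "('e, 'v) dmor" and H :: "('e, 'v) digraph" and h
  assumes f: "properad_map G G' f" and H: "connected_digraph H" and h: "local_map H G h"
begin

abbreviation "KK v \<equiv> pgraph (prep f (snd h v))"
abbreviation "ai v e \<equiv> inv_into (in_at H v) (fst h) (pin (prep f (snd h v)) e)"
abbreviation "ao v e \<equiv> inv_into (out_at H v) (fst h) (pout (prep f (snd h v)) e)"

sublocale gs: graph_substitution H KK ai ao
  by (rule induced_substitution[OF f H h])

lemmas h' = local_mapD[OF h connected_digraphD(1)[OF H]]
lemmas P = properad_mapD(4-6)[OF f h'(4)]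
lemmas Pp = piecesD[OF P(2)]

lemma ai: "v \<in> dV H \<Longrightarrow> e \<in> din (KK v) \<Longrightarrow> ai v e \<in> in_at H v \<and> fst h (ai v e) = pin (prep f (snd h v)) e"
  using bij_betw_imp_surj_on[OF h'(9)] bij_betwE[OF Pp(4)] by (metis f_inv_into_f inv_into_into)

lemma ao: "v \<in> dV H \<Longrightarrow> e \<in> dout (KK v) \<Longrightarrow> ao v e \<in> out_at H v \<and> fst h (ao v e) = pout (prep f (snd h v)) e"
  using bij_betw_imp_surj_on[OF h'(10)] bij_betwE[OF Pp(5)] by (metis f_inv_into_f inv_into_into)

lemma graph_eq: "induced_graph H h f = gs.S"
  unfolding induced_graph_def ..

lemma map_eq: "induced_map H h f = (restrict (\<lambda>c. the_elem (point_map h f ` c)) (dE gs.S),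
    restrict (\<lambda>(v, w). snd (pmap (prep f (snd h v))) w) (dV gs.S))"
  unfolding induced_map_def graph_eq point_map_def ..

lemma point_map_N:
  "v \<in> dV H \<Longrightarrow> k \<in> din (KK v) \<Longrightarrow> point_map h f (Inl (ai v k)) = point_map h f (Inr (v, k))"
  "v \<in> dV H \<Longrightarrow> k \<in> dout (KK v) \<Longrightarrow> point_map h f (Inl (ao v k)) = point_map h f (Inr (v, k))"
  using P(3)[OF _ P(1), unfolded piece_match_def] ai ao by (simp_all add: point_map_def)

lemma local: "local_map gs.S G' (induced_map H h f)"
  unfolding map_eq
proof (rule gs.S_local_map[OF point_map_N])
  show "point_map h f (Inl e) \<in> dE G'" if "e \<in> dE H" for e
    using h'(3)[OF that] properad_mapD(1)[OF f] by (auto simp: point_map_def)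
  show "local_map (KK v) G' (pmap (prep f (snd h v)))" if "v \<in> dV H" for v by (rule Pp(2)[OF that])
qed (simp_all add: point_map_def)

lemma map_q: "x \<in> gs.points \<Longrightarrow> fst (induced_map H h f) (gs.q x) = point_map h f x"
  unfolding map_eq using gs.const_on_q[of "point_map h f", OF point_map_N] by simp

lemma map_v: "v \<in> dV H \<Longrightarrow> w \<in> dV (KK v) \<Longrightarrow> snd (induced_map H h f) (v, w) = snd (pmap (prep f (snd h v))) w"
  unfolding map_eq by simp

lemma map_Inl: "e \<in> dE H \<Longrightarrow> fst (induced_map H h f) (gs.q (Inl e)) = fst f (fst h e)"
  using map_q[of "Inl e"] by (simp add: gs.points_def point_map_def)

lemma map_din: "fst (induced_map H h f) ` din gs.S = fst f ` fst h ` din H"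
  and map_dout: "fst (induced_map H h f) ` dout gs.S = fst f ` fst h ` dout H"
  unfolding gs.S_simps image_image
  by (rule image_cong[OF refl], rule map_Inl, use gs.h(10,11) in blast)+

lemma map_verts: "snd (induced_map H h f) ` dV gs.S = (\<Union>v\<in>snd h ` dV H. piece_verts (prep f v))"
  using map_v by force

end

text \<open>One direction is the condition for the identity embedding: injectivity on pairs of
  vertices makes each piece injective and distinct pieces disjoint. Conversely, an embedding
  \<open>h\<close> is injective on vertices, so injectivity of the induced map follows from that of
  the pieces and their disjointness. If the induced graph is a nodeless loop, then \<open>H\<close>
  has no boundary, and by \<open>embedding_closed\<close> neither has \<open>G\<close>, all of whose
  vertices are met; the last condition applies.\<close>

lemma wheeled_map_iff:
  assumes f: "properad_map G G' f" and G: "connected_digraph G" and G': "connected_digraph G'"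
  shows "wheeled_map G G' f \<longleftrightarrow> (\<forall>v\<in>dV G. piece_emb (prep f v) G') \<and>
    (\<forall>v\<in>dV G. \<forall>w\<in>dV G. v \<noteq> w \<longrightarrow> piece_verts (prep f v) \<inter> piece_verts (prep f w) = {}) \<and>
    (din G = {} \<and> dout G = {} \<and> (\<forall>v\<in>dV G. piece_verts (prep f v) = {}) \<longrightarrow> dnodeless_loop G')"
    (is "_ \<longleftrightarrow> ?R")
proof
  assume w: "wheeled_map G G' f"
  obtain i where i: "dembedding G G i" and i_v: "\<And>v. v \<in> dV G \<Longrightarrow> snd i v = v"
    using dembedding_id[OF G] by force
  interpret induced G G' f G i
    by standard (use f G dembeddingD(3)[OF i] in auto)
  have e: "dembedding gs.S G' (induced_map G i f)"
    using w[unfolded wheeled_map_def, THEN conjunct2, rule_format, OF i] unfolding graph_eq .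
  have inj: "(v, a) = (w, b)"
    if "v \<in> dV G" "w \<in> dV G" "a \<in> dV (pgraph (prep f v))" "b \<in> dV (pgraph (prep f w))"
      "snd (pmap (prep f v)) a = snd (pmap (prep f w)) b" for v w a b
    by (rule inj_onD[OF dembeddingD(4)[OF e]]) (use that map_v[of v a] map_v[of w b] i_v in auto)
  have 1: "piece_emb (prep f v) G'" if v: "v \<in> dV G" for v
  proof -
    note vi = i_v[OF v]
    have "inj_on (snd (pmap (prep f v))) (dV (pgraph (prep f v)))"
      by (rule inj_onI) (use inj[OF v v] in blast)
    moreover have "dnodeless_loop G'" if "dnodeless_loop (pgraph (prep f v))"
      using gs.nodeless_piece[OF v] that dembeddingD(5)[OF e] unfolding vi by blast
    ultimately show ?thesis
      unfolding dembedding_def using Pp(1,2)[OF v, unfolded vi] G' by blast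
  qed
  have 2: "piece_verts (prep f v) \<inter> piece_verts (prep f w) = {}" if "v \<in> dV G" "w \<in> dV G" "v \<noteq> w" for v w
    using inj[OF that(1,2)] that(3) by blast
  have 3: "dnodeless_loop G'" if "din G = {}" "dout G = {}" "\<forall>v\<in>dV G. piece_verts (prep f v) = {}"
    using that dembeddingD(5)[OF e] dnodeless_loop_iff[OF gs.S_connected] i_v by (simp add: Sigma_empty_iff)
  show ?R using 1 2 3 by blast
next
  assume R: ?R
  show "wheeled_map G G' f"
    unfolding wheeled_map_def
  proof (intro conjI allI impI)
    fix H :: "('a, 'b) digraph" and h
    assume dh: "dembedding H G h"
    interpret induced G G' f H h by standard (use f dembeddingD(1,3)[OF dh] in auto)
    have "inj_on (snd (induced_map H h f)) (dV gs.S)"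
    proof (rule inj_onI)
      fix x y assume x: "x \<in> dV gs.S" and y: "y \<in> dV gs.S" and eq: "snd (induced_map H h f) x = snd (induced_map H h f) y"
      obtain v a w b where xy: "x = (v, a)" "y = (w, b)" "v \<in> dV H" "a \<in> dV (KK v)" "w \<in> dV H" "b \<in> dV (KK w)"
        using x y by auto
      have e: "snd (pmap (prep f (snd h v))) a = snd (pmap (prep f (snd h w))) b"
        using eq xy map_v by simp
      have "snd h v = snd h w"
      proof (rule ccontr)
        assume "snd h v \<noteq> snd h w"
        then have "piece_verts (prep f (snd h v)) \<inter> piece_verts (prep f (snd h w)) = {}"
          using R h'(4) xy(3,5) by blast
        then show False using e xy(4,6) by blast
      qed
      then have vw: "v = w" using dembeddingD(4)[OF dh] xy(3,5) by (meson inj_onD)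
      have "inj_on (snd (pmap (prep f (snd h w)))) (dV (KK w))" using R h'(4)[OF xy(5)] dembeddingD(4) by blast
      then have "a = b" using e xy(4,6) unfolding vw by (meson inj_onD)
      then show "x = y" using xy(1,2) vw by simp
    qed
    moreover have "dnodeless_loop G'" if n: "dnodeless_loop gs.S"
    proof -
      have n': "din H = {}" "dout H = {}" "\<And>v. v \<in> dV H \<Longrightarrow> dV (KK v) = {}"
        using n unfolding dnodeless_loop_def by auto
      have "bnd (ug H) = {}" using n' by simp
      from embedding_closed[OF dembedding_ug[OF dh] this]
      have "din G = {}" "dout G = {}" "snd h ` dV H = dV G" by auto
      then show ?thesis using R n'(3) by (metis (no_types, lifting) image_empty imageE)
    qed
    ultimately show "dembedding (induced_graph H h f) G' (induced_map H h f)"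
      unfolding graph_eq dembedding_def using gs.S_connected G' local by blast
  qed (rule f)
qed

text \<open>The pieces put in at \<open>v\<close> and at its image under \<open>j\<close> are the
  same, so \<open>j\<close> on edges and the inclusions of pieces glue to a map of substituted
  graphs. This is the source of monotonicity of the function induced on classes.\<close>

lemma induced_graph_mono:
  assumes f: "properad_map G G' f" and w: "wheeled_map G G' f"
    and j: "dembedding H L j" and l: "dembedding L G l" and h: "dembedding H G h"
    and hj: "\<And>e. e \<in> dE H \<Longrightarrow> fst h e = fst l (fst j e)" "\<And>v. v \<in> dV H \<Longrightarrow> snd h v = snd l (snd j v)"
  shows "\<exists>J. dembedding (induced_graph H h f) (induced_graph L l f) J \<and>
    (\<forall>c\<in>dE (induced_graph H h f). fst (induced_map L l f) (fst J c) = fst (induced_map H h f) c) \<and>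
    (\<forall>u\<in>dV (induced_graph H h f). snd (induced_map L l f) (snd J u) = snd (induced_map H h f) u)"
proof -
  interpret A: induced G G' f H h by standard (use f dembeddingD(1,3)[OF h] in auto)
  interpret B: induced G G' f L l by standard (use f dembeddingD(1,3)[OF l] in auto)
  note j' = local_mapD[OF dembeddingD(3,6)[OF j]]
  have KK: "A.KK v = B.KK (snd j v)" "prep f (snd h v) = prep f (snd l (snd j v))" if "v \<in> dV H" for v
    using hj(2)[OF that] by simp_all
  have ai: "fst j (A.ai v k) = B.ai (snd j v) k" if v: "v \<in> dV H" and k: "k \<in> din (A.KK v)" for v k
  proof -
    have a: "A.ai v k \<in> in_at H v" "fst h (A.ai v k) = pin (prep f (snd h v)) k" using A.ai[OF v k] by auto
    then have "fst j (A.ai v k) \<in> in_at L (snd j v)" using bij_betwE[OF j'(9)[OF v]] by blast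
    moreover have "fst l (fst j (A.ai v k)) = pin (prep f (snd l (snd j v))) k"
      using a hj(1)[of "A.ai v k"] KK(2)[OF v] A.gs.h(3) unfolding in_at_def by auto
    ultimately show ?thesis
      using inv_into_f_eq[OF bij_betw_imp_inj_on[OF B.h'(9)[OF j'(4)[OF v]]]] by metis
  qed
  have ao: "fst j (A.ao v k) = B.ao (snd j v) k" if v: "v \<in> dV H" and k: "k \<in> dout (A.KK v)" for v k
  proof -
    have a: "A.ao v k \<in> out_at H v" "fst h (A.ao v k) = pout (prep f (snd h v)) k" using A.ao[OF v k] by auto
    then have "fst j (A.ao v k) \<in> out_at L (snd j v)" using bij_betwE[OF j'(10)[OF v]] by blast
    moreover have "fst l (fst j (A.ao v k)) = pout (prep f (snd l (snd j v))) k"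
      using a hj(1)[of "A.ao v k"] KK(2)[OF v] A.gs.h(4) unfolding out_at_def by auto
    ultimately show ?thesis
      using inv_into_f_eq[OF bij_betw_imp_inj_on[OF B.h'(10)[OF j'(4)[OF v]]]] by metis
  qed
  define p where "p = case_sum (\<lambda>e. Inl (fst j e)) (\<lambda>(v, k). Inr (snd j v, k) :: 'a + 'b \<times> 'a)"
  define m where "m x = B.gs.q (p x)" for x
  define J where "J = (restrict (\<lambda>c. the_elem (m ` c)) (dE A.gs.S),
    restrict (\<lambda>(v, w). snd (restrict (\<lambda>k. B.gs.q (Inr (snd j v, k))) (dE (A.KK v)), restrict (Pair (snd j v)) (dV (A.KK v))) w) (dV A.gs.S))"
  have mN: "v \<in> dV H \<Longrightarrow> k \<in> din (A.KK v) \<Longrightarrow> m (Inl (A.ai v k)) = m (Inr (v, k))"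
    "v \<in> dV H \<Longrightarrow> k \<in> dout (A.KK v) \<Longrightarrow> m (Inl (A.ao v k)) = m (Inr (v, k))" for v k
    using B.gs.q_\<alpha>[OF j'(4)] B.gs.q_\<beta>[OF j'(4)] ai ao KK by (simp_all add: m_def p_def)
  have pp: "p x \<in> B.gs.points" if "x \<in> A.gs.points" for x
    using that j'(3,4) KK(1) by (auto simp: p_def A.gs.points_def B.gs.points_def)
  have J: "local_map A.gs.S B.gs.S J"
    unfolding J_def
  proof (rule A.gs.S_local_map[OF mN])
    show "m (Inl e) \<in> dE B.gs.S" if "e \<in> dE H" for e
      using pp[of "Inl e"] that by (auto simp: m_def A.gs.points_def)
    show "local_map (A.KK v) B.gs.S
        (restrict (\<lambda>k. B.gs.q (Inr (snd j v, k))) (dE (A.KK v)), restrict (Pair (snd j v)) (dV (A.KK v)))"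
      if "v \<in> dV H" for v
      unfolding KK(1)[OF that] by (rule B.gs.insert_local_map[OF j'(4)[OF that]])
  qed (simp_all add: m_def p_def)
  have Jq: "fst J (A.gs.q x) = B.gs.q (p x)" if "x \<in> A.gs.points" for x
    using that A.gs.const_on_q[of m, OF mN] unfolding J_def by (simp add: m_def)
  have Jv: "snd J (v, a) = (snd j v, a)" if "v \<in> dV H" "a \<in> dV (A.KK v)" for v a
    using that unfolding J_def by simp
  have c1: "fst (induced_map L l f) (fst J c) = fst (induced_map H h f) c" if c: "c \<in> dE A.gs.S" for c
  proof -
    obtain x where x: "x \<in> A.gs.points" "c = A.gs.q x" using c by auto
    have "point_map l f (p x) = point_map h f x"
      using x(1) hj by (auto simp: A.gs.points_def p_def point_map_def)
    then show ?thesis using A.map_q[OF x(1)] B.map_q[OF pp[OF x(1)]] Jq[OF x(1)] x(2) by simp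
  qed
  have c2: "snd (induced_map L l f) (snd J u) = snd (induced_map H h f) u" if u: "u \<in> dV A.gs.S" for u
  proof -
    obtain v a where v: "u = (v, a)" "v \<in> dV H" "a \<in> dV (A.KK v)" using u by auto
    then show ?thesis using Jv A.map_v B.map_v[OF j'(4)[OF v(2)], of a] KK[OF v(2)] by simp
  qed
  have eH: "dembedding A.gs.S G' (induced_map H h f)" and eL: "dembedding B.gs.S G' (induced_map L l f)"
    using w[unfolded wheeled_map_def, THEN conjunct2, rule_format, OF h]
      w[unfolded wheeled_map_def, THEN conjunct2, rule_format, OF l] unfolding A.graph_eq B.graph_eq .
  have "inj_on (snd J) (dV A.gs.S)"
  proof (rule inj_onI)
    fix x y assume x: "x \<in> dV A.gs.S" and y: "y \<in> dV A.gs.S" and "snd J x = snd J y"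
    then have "snd (induced_map H h f) x = snd (induced_map H h f) y" using c2[OF x] c2[OF y] by simp
    then show "x = y" using inj_onD[OF dembeddingD(4)[OF eH] _ x y] by blast
  qed
  \<comment> \<open>If the smaller graph is a nodeless loop, then \<open>H\<close> and hence
    \<open>L\<close> have no boundary, while \<open>G'\<close> is a nodeless loop and leaves the
    larger graph no vertices.\<close>
  moreover have "dnodeless_loop B.gs.S" if n: "dnodeless_loop A.gs.S"
  proof -
    have "din H = {}" "dout H = {}" using n unfolding dnodeless_loop_def by auto
    then have "bnd (ug H) = {}" by simp
    from embedding_closed(1)[OF dembedding_ug[OF j] this] have "din L = {}" "dout L = {}" by auto
    moreover have "dV G' = {}" using dembeddingD(5)[OF eH n] unfolding dnodeless_loop_def by auto
    then have "dV B.gs.S = {}" using local_mapD(4)[OF dembeddingD(3,6)[OF eL]] by blast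
    ultimately show ?thesis unfolding dnodeless_loop_iff[OF B.gs.S_connected] by simp
  qed
  ultimately have "dembedding A.gs.S B.gs.S J"
    unfolding dembedding_def using J A.gs.S_connected B.gs.S_connected by blast
  then show ?thesis using c1 c2 unfolding A.graph_eq B.graph_eq by blast
qed

section \<open>The functor to the wheeled properadic graphical category\<close>

text \<open>Inputs of a class as positive arcs, that is, as edges of \<open>dg X\<close>. In
  \<open>bout\<close> below, the negative boundary arcs are replaced by their partners for the same
  reason.\<close>

definition bin :: "('a, 'v) ograph \<Rightarrow> ('a, 'v) emb set \<Rightarrow> 'a set" where
  "bin X c = {a \<in> emb_bnd c. snd X a = 1}"

definition bout :: "('a, 'v) ograph \<Rightarrow> ('a, 'v) emb set \<Rightarrow> 'a set" where
  "bout X c = dag (fst X) ` {a \<in> emb_bnd c. snd X a = -1}"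

context oriented
begin

lemma bin_bout:
  assumes k: "dembedding K (dg X) k" and c: "emb_bnd c = fst k ` din K \<union> dag (fst X) ` fst k ` dout K"
  shows "bin X c = fst k ` din K" "bout X c = fst k ` dout K"
proof -
  note d = digraphD[OF dembeddingD(6)[OF k]] and l = local_mapD[OF dembeddingD(3,6)[OF k]]
  have 1: "fst k e \<in> arcs (fst X) \<and> snd X (fst k e) = 1" if "e \<in> dE K" for e using l(3)[OF that] by simp
  have s: "snd X (fst k e) = 1" "snd X (dag (fst X) (fst k e)) = -1"
    "dag (fst X) (dag (fst X) (fst k e)) = fst k e" if "e \<in> dE K" for e
    using 1[OF that] u(5) by simp_all
  show "bin X c = fst k ` din K" unfolding bin_def c using s d(10,11) by (auto simp: subset_iff)
  have "{a \<in> emb_bnd c. snd X a = -1} = dag (fst X) ` fst k ` dout K"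
    unfolding c using s d(10,11) by (auto simp: subset_iff)
  then show "bout X c = fst k ` dout K"
    unfolding bout_def using s(3) d(11) by (simp add: image_image subset_iff cong: image_cong)
qed

lemma emb_bnd_signed:
  assumes c: "c \<in> Emb (fst X)"
  shows "emb_bnd c = bin X c \<union> dag (fst X) ` bout X c" "bin X c \<subseteq> dE (dg X)" "bout X c \<subseteq> dE (dg X)"
proof -
  obtain K :: "('a, 'v) digraph" and k where k: "dembedding K (dg X) k"
    "emb_bnd c = fst k ` din K \<union> dag (fst X) ` fst k ` dout K"
    using Emb_dembedding[OF c] by metis
  note d = digraphD[OF dembeddingD(6)[OF k(1)]] and l = local_mapD[OF dembeddingD(3,6)[OF k(1)]]
  show "emb_bnd c = bin X c \<union> dag (fst X) ` bout X c" using bin_bout[OF k] k(2) by simp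
  show "bin X c \<subseteq> dE (dg X)" "bout X c \<subseteq> dE (dg X)"
    unfolding bin_bout[OF k] using d(10,11) l(3) by blast+
qed

lemma in_at_dg: "in_at (dg X) v = {a \<in> arcs (fst X). snd X a = 1 \<and> dag (fst X) a \<in> nb (fst X) v}"
  and out_at_dg: "out_at (dg X) v = {a \<in> arcs (fst X). snd X a = 1 \<and> a \<in> nb (fst X) v}"
  unfolding in_at_def out_at_def nb_def by auto

lemma nb_arcs: "a \<in> nb (fst X) v \<Longrightarrow> a \<in> arcs (fst X)"
  using u(7) unfolding nb_def by auto

end

section \<open>Arc maps and the bijection at a vertex\<close>

lemma Obj_oriented: "X \<in> Obj ext_oriented_cat \<longleftrightarrow> oriented X"
  unfolding ext_oriented_cat_def ext_graphical_cat_def oriented_def by simp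

text \<open>The arc part of an oriented graphical map on its own, since it is also constructed from
  a map of properads and from a function on edges before the vertex part is available.\<close>

locale arc_map = A: oriented X + B: oriented X' for X X' :: "('a::infinite, 'v) ograph" +
  fixes p :: "'a \<Rightarrow> 'a"
  assumes p_ext: "p \<in> arcs (fst X) \<rightarrow>\<^sub>E arcs (fst X')"
    and p_dag: "a \<in> arcs (fst X) \<Longrightarrow> p (dag (fst X) a) = dag (fst X') (p a)"
    and p_sign: "a \<in> arcs (fst X) \<Longrightarrow> snd X' (p a) = snd X a"
begin

lemma p_arcs: "a \<in> arcs (fst X) \<Longrightarrow> p a \<in> arcs (fst X')"
  using p_ext by auto

text \<open>The bijection of a graphical map passes to the partner first. A negative dart at
  \<open>v\<close> has an input of \<open>v\<close> as its partner, whose image is a positive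
  boundary arc; a positive dart is an output of \<open>v\<close>, and the image of its partner is a
  negative boundary arc, counted in \<open>bout\<close> through its own partner. As \<open>p\<close>
  preserves signs, the two halves do not mix.\<close>

lemma star_bij_iff:
  assumes c: "c \<in> Emb (fst X')"
  shows "bij_betw (\<lambda>a. p (dag (fst X) a)) (nb (fst X) v) (emb_bnd c) \<longleftrightarrow>
    bij_betw p (in_at (dg X) v) (bin X' c) \<and> bij_betw p (out_at (dg X) v) (bout X' c)"
proof
  assume b: "bij_betw (\<lambda>a. p (dag (fst X) a)) (nb (fst X) v) (emb_bnd c)"
  have inj: "a = b" if "a \<in> nb (fst X) v" "b \<in> nb (fst X) v" "p (dag (fst X) a) = p (dag (fst X) b)" for a b
    using inj_onD[OF bij_betw_imp_inj_on[OF b]] that by blast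
  have mem: "p (dag (fst X) a) \<in> emb_bnd c" if "a \<in> nb (fst X) v" for a using bij_betwE[OF b] that by blast
  have ex: "\<exists>a. a \<in> nb (fst X) v \<and> y = p (dag (fst X) a)" if "y \<in> emb_bnd c" for y
    using that bij_betw_imp_surj_on[OF b] by blast
  show "bij_betw p (in_at (dg X) v) (bin X' c) \<and> bij_betw p (out_at (dg X) v) (bout X' c)"
    unfolding bij_betw_def
  proof (intro conjI)
    show "inj_on p (in_at (dg X) v)"
    proof (rule inj_onI)
      fix a b assume a: "a \<in> in_at (dg X) v" and b: "b \<in> in_at (dg X) v" and eq: "p a = p b"
      have "dag (fst X) a = dag (fst X) b"
        by (rule inj) (use a b eq A.u(5) in \<open>auto simp: A.in_at_dg\<close>)
      then show "a = b" using a b A.u(5) unfolding A.in_at_dg by (metis (mono_tags, lifting) mem_Collect_eq)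
    qed
    show "p ` in_at (dg X) v = bin X' c"
    proof
      show "p ` in_at (dg X) v \<subseteq> bin X' c"
        unfolding A.in_at_dg bin_def using mem A.u(5) p_sign by fastforce
      show "bin X' c \<subseteq> p ` in_at (dg X) v"
      proof
        fix y assume y: "y \<in> bin X' c"
        then obtain a where a: "a \<in> nb (fst X) v" "y = p (dag (fst X) a)" using ex unfolding bin_def by blast
        then show "y \<in> p ` in_at (dg X) v"
          using y p_sign[OF A.u(4)[OF A.nb_arcs[OF a(1)]]] A.u(4,5)[OF A.nb_arcs[OF a(1)]]
          unfolding A.in_at_dg bin_def by auto
      qed
    qed
    show "inj_on p (out_at (dg X) v)"
    proof (rule inj_onI)
      fix a b assume a: "a \<in> out_at (dg X) v" and b: "b \<in> out_at (dg X) v" and eq: "p a = p b"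
      show "a = b"
        by (rule inj) (use a b eq p_dag in \<open>auto simp: A.out_at_dg\<close>)
    qed
    show "p ` out_at (dg X) v = bout X' c"
    proof
      show "p ` out_at (dg X) v \<subseteq> bout X' c"
      proof
        fix y assume "y \<in> p ` out_at (dg X) v"
        then obtain a where a: "a \<in> arcs (fst X)" "snd X a = 1" "a \<in> nb (fst X) v" "y = p a"
          unfolding A.out_at_dg by auto
        have "p (dag (fst X) a) \<in> {b \<in> emb_bnd c. snd X' b = -1}" using mem[OF a(3)] p_sign[OF A.u(4)[OF a(1)]] a by simp
        moreover have "y = dag (fst X') (p (dag (fst X) a))" using p_dag[OF A.u(4)[OF a(1)]] A.u(5)[OF a(1)] a(4) by simp
        ultimately show "y \<in> bout X' c" unfolding bout_def by blast
      qed
      show "bout X' c \<subseteq> p ` out_at (dg X) v"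
      proof
        fix y assume "y \<in> bout X' c"
        then obtain z where z: "z \<in> emb_bnd c" "snd X' z = -1" "y = dag (fst X') z" unfolding bout_def by auto
        then obtain a where a: "a \<in> nb (fst X) v" "z = p (dag (fst X) a)" using ex by blast
        note aA = A.nb_arcs[OF a(1)]
        have "snd X a = 1" using z(2) p_sign[OF A.u(4)[OF aA]] a(2) aA by simp
        moreover have "y = p a" using z(3) a(2) p_dag[OF A.u(4)[OF aA]] A.u(5)[OF aA] by simp
        ultimately show "y \<in> p ` out_at (dg X) v" unfolding A.out_at_dg using aA a(1) by blast
      qed
    qed
  qed
next
  assume b: "bij_betw p (in_at (dg X) v) (bin X' c) \<and> bij_betw p (out_at (dg X) v) (bout X' c)"
  then have bi: "bij_betw p (in_at (dg X) v) (bin X' c)" and bo: "bij_betw p (out_at (dg X) v) (bout X' c)" by auto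
  have cases: "(snd X a = -1 \<and> dag (fst X) a \<in> in_at (dg X) v) \<or> (snd X a = 1 \<and> a \<in> out_at (dg X) v)" if "a \<in> nb (fst X) v" for a
    using A.sign[OF A.nb_arcs[OF that]] A.u(4,5)[OF A.nb_arcs[OF that]] that A.sign_dag[OF A.nb_arcs[OF that]] A.nb_arcs[OF that]
    unfolding A.in_at_dg A.out_at_dg by auto
  have img: "(\<lambda>a. p (dag (fst X) a)) ` nb (fst X) v = p ` in_at (dg X) v \<union> dag (fst X') ` p ` out_at (dg X) v"
  proof
    show "(\<lambda>a. p (dag (fst X) a)) ` nb (fst X) v \<subseteq> p ` in_at (dg X) v \<union> dag (fst X') ` p ` out_at (dg X) v"
      using cases p_dag A.nb_arcs by fastforce
    show "p ` in_at (dg X) v \<union> dag (fst X') ` p ` out_at (dg X) v \<subseteq> (\<lambda>a. p (dag (fst X) a)) ` nb (fst X) v"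
    proof
      fix y assume "y \<in> p ` in_at (dg X) v \<union> dag (fst X') ` p ` out_at (dg X) v"
      then consider a where "a \<in> in_at (dg X) v" "y = p a" | a where "a \<in> out_at (dg X) v" "y = dag (fst X') (p a)" by auto
      then show "y \<in> (\<lambda>a. p (dag (fst X) a)) ` nb (fst X) v"
      proof cases
        case 1
        then have "y = p (dag (fst X) (dag (fst X) a))" "dag (fst X) a \<in> nb (fst X) v" using A.u(5) unfolding A.in_at_dg by auto
        then show ?thesis by (rule image_eqI)
      next
        case 2
        then have "y = p (dag (fst X) a)" "a \<in> nb (fst X) v" using p_dag unfolding A.out_at_dg by auto
        then show ?thesis by (rule image_eqI)
      qed
    qed
  qed
  have "inj_on (\<lambda>a. p (dag (fst X) a)) (nb (fst X) v)"
  proof (rule inj_onI)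
    fix a b assume a: "a \<in> nb (fst X) v" and b: "b \<in> nb (fst X) v" and eq: "p (dag (fst X) a) = p (dag (fst X) b)"
    note aA = A.nb_arcs[OF a] and bA = A.nb_arcs[OF b]
    have s: "snd X a = snd X b"
      using p_sign[OF A.u(4)[OF aA]] p_sign[OF A.u(4)[OF bA]] eq aA bA by simp
    show "a = b"
    proof (cases "snd X a = 1")
      case True
      have "a \<in> out_at (dg X) v" "b \<in> out_at (dg X) v" using cases[OF a] cases[OF b] True s by auto
      moreover have "p a = p b"
        using eq p_dag[OF A.u(4)[OF aA]] p_dag[OF A.u(4)[OF bA]] A.u(5)[OF aA] A.u(5)[OF bA] by metis
      ultimately show ?thesis using bij_betw_imp_inj_on[OF bo] by (meson inj_onD)
    next
      case False
      have "dag (fst X) a \<in> in_at (dg X) v" "dag (fst X) b \<in> in_at (dg X) v" using cases[OF a] cases[OF b] False s by auto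
      then have "dag (fst X) a = dag (fst X) b" using eq bij_betw_imp_inj_on[OF bi] by (meson inj_onD)
      then show ?thesis using A.u(5)[OF aA] A.u(5)[OF bA] by metis
    qed
  qed
  then show "bij_betw (\<lambda>a. p (dag (fst X) a)) (nb (fst X) v) (emb_bnd c)"
    unfolding bij_betw_def img bij_betw_imp_surj_on[OF bi] bij_betw_imp_surj_on[OF bo] B.emb_bnd_signed(1)[OF c, symmetric]
    by blast
qed

end

section \<open>The map of wheeled properads attached to an oriented graphical map\<close>

locale oriented_map = A: oriented X + B: oriented X' for X X' :: "('a::infinite, 'v) ograph" +
  fixes \<phi> :: "('a, 'v) umor"
  assumes gm: "graphical_map (fst X) (fst X') \<phi>"
    and sgn: "a \<in> arcs (fst X) \<Longrightarrow> snd X' (fst \<phi> a) = snd X a"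

lemma Hom_oriented:
  assumes "oriented X" "oriented X'"
  shows "\<phi> \<in> Hom ext_oriented_cat X X' \<longleftrightarrow> oriented_map X X' \<phi>"
  using assms unfolding ext_oriented_cat_def ext_graphical_cat_def oriented_map_def oriented_map_axioms_def by auto

text \<open>The class of pieces described by invariants and not by a chosen representative of the
  embedding, so that composites and inverse images can be compared as equal sets.\<close>

definition vertex_pieces ::
  "('a, 'v) ograph \<Rightarrow> ('a, 'v) ograph \<Rightarrow> ('a, 'v) umor \<Rightarrow> 'v \<Rightarrow> ('a, 'v, 'a, 'v) piece set" where
  "vertex_pieces X X' \<phi> v = {P \<in> pieces (dg X) v (dg X'). piece_emb P (dg X') \<and>
     piece_verts P = emb_verts (snd \<phi> v) \<and> piece_match (fst \<phi>) P}"

definition dmor_of :: "('a, 'v) ograph \<Rightarrow> ('a, 'v) ograph \<Rightarrow> ('a, 'v) umor \<Rightarrow> ('a, 'v) dmor" where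
  "dmor_of X X' \<phi> = (restrict (fst \<phi>) (dE (dg X)), restrict (vertex_pieces X X' \<phi>) (dV (dg X)))"

text \<open>\<open>R\<close> may live in other types, in particular it may be a substituted piece.
  Any piece with the same invariants is isomorphic to it by \<open>piece_iso_unique\<close>, and the
  invariants pass to isomorphic pieces.\<close>

lemma vertex_pieces_eq:
  fixes R :: "('k, 'w, 'a, 'v) piece"
  assumes R: "piece_emb R (dg X')" "piece_verts R = emb_verts (snd \<phi> v)" "piece_match (fst \<phi>) R"
    "bij_betw (pin R) (din (pgraph R)) (in_at (dg X) v)" "bij_betw (pout R) (dout (pgraph R)) (out_at (dg X) v)"
  shows "piece_class (dg X) v (dg X') R = vertex_pieces X X' \<phi> v"
proof (intro equalityI subsetI)
  fix P assume "P \<in> piece_class (dg X) v (dg X') R"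
  then have P: "P \<in> pieces (dg X) v (dg X')" "piece_iso P R" unfolding piece_class_def by auto
  note i = piece_iso_props[OF P(2) piecesD(1,2)[OF P(1)] dembeddingD(1,3)[OF R(1)]]
  show "P \<in> vertex_pieces X X' \<phi> v" unfolding vertex_pieces_def using P(1) i R by simp
next
  fix P assume "P \<in> vertex_pieces X X' \<phi> v"
  then have P: "P \<in> pieces (dg X) v (dg X')" "piece_emb P (dg X')" "piece_verts P = emb_verts (snd \<phi> v)" "piece_match (fst \<phi>) P"
    unfolding vertex_pieces_def by auto
  have "piece_iso P R"
    by (rule piece_iso_unique[OF P(2,4) piecesD(4,5)[OF P(1)] R(1,3,4,5)]) (simp add: P R)
  then show "P \<in> piece_class (dg X) v (dg X') R" unfolding piece_class_def using P(1) by simp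
qed

context oriented_map
begin

sublocale arc_map X X' "fst \<phi>"
  using gm sgn unfolding graphical_map_def by unfold_locales auto

lemma \<phi>1: "v \<in> verts (fst X) \<Longrightarrow> snd \<phi> v \<in> Emb (fst X')" "snd \<phi> \<in> extensional (verts (fst X))"
  and disj: "v \<in> verts (fst X) \<Longrightarrow> w \<in> verts (fst X) \<Longrightarrow> v \<noteq> w \<Longrightarrow> emb_verts (snd \<phi> v) \<inter> emb_verts (snd \<phi> w) = {}"
  and bij: "v \<in> verts (fst X) \<Longrightarrow> bij_betw (\<lambda>a. fst \<phi> (dag (fst X) a)) (nb (fst X) v) (emb_bnd (snd \<phi> v))"
  and closed: "bnd (fst X) = {} \<Longrightarrow> (\<And>v. v \<in> verts (fst X) \<Longrightarrow> emb_is_edge (snd \<phi> v)) \<Longrightarrow> nodeless_loop (fst X')"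
  using gm unfolding graphical_map_def by (auto simp: PiE_iff)

lemma vertex_pieces_nonempty:
  assumes v: "v \<in> verts (fst X)"
  shows "\<exists>P. P \<in> vertex_pieces X X' \<phi> v"
proof -
  obtain K :: "('a, 'v) digraph" and k where k: "dembedding K (dg X') k" "emb_verts (snd \<phi> v) = snd k ` dV K"
    "emb_bnd (snd \<phi> v) = fst k ` din K \<union> dag (fst X') ` fst k ` dout K"
    using B.Emb_dembedding[OF \<phi>1(1)[OF v]] by metis
  note bb = B.bin_bout[OF k(1,3)]
  have bi: "bij_betw (fst \<phi>) (in_at (dg X) v) (fst k ` din K)" and bo: "bij_betw (fst \<phi>) (out_at (dg X) v) (fst k ` dout K)"
    using bij[OF v] unfolding star_bij_iff[OF \<phi>1(1)[OF v]] bb by auto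
  \<comment> \<open>The bijections are forced: an input of \<open>K\<close> is matched with the
    unique input of \<open>v\<close> that has the same image under \<open>\<phi>\<close>, and
    likewise for outputs.\<close>
  define P where "P = \<lparr>pgraph = K, pmap = k,
    pin = restrict (\<lambda>e. inv_into (in_at (dg X) v) (fst \<phi>) (fst k e)) (din K),
    pout = restrict (\<lambda>e. inv_into (out_at (dg X) v) (fst \<phi>) (fst k e)) (dout K)\<rparr>"
  have P[simp]: "pgraph P = K" "pmap P = k" by (simp_all add: P_def)
  have "bij_betw (\<lambda>e. inv_into (in_at (dg X) v) (fst \<phi>) (fst k e)) (din K) (in_at (dg X) v)"
    using bij_betw_trans[OF inj_on_imp_bij_betw[OF dembedding_inj_din(1)[OF k(1)]] bij_betw_inv_into[OF bi]]
    by (simp add: comp_def)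
  then have pin: "bij_betw (pin P) (din K) (in_at (dg X) v)"
    by (rule bij_betw_cong[THEN iffD1, rotated]) (simp add: P_def)
  have "bij_betw (\<lambda>e. inv_into (out_at (dg X) v) (fst \<phi>) (fst k e)) (dout K) (out_at (dg X) v)"
    using bij_betw_trans[OF inj_on_imp_bij_betw[OF dembedding_inj_din(2)[OF k(1)]] bij_betw_inv_into[OF bo]]
    by (simp add: comp_def)
  then have pout: "bij_betw (pout P) (dout K) (out_at (dg X) v)"
    by (rule bij_betw_cong[THEN iffD1, rotated]) (simp add: P_def)
  have "P \<in> pieces (dg X) v (dg X')"
    unfolding pieces_def using dembeddingD(1,3)[OF k(1)] pin pout by (simp add: P_def)
  moreover have "piece_match (fst \<phi>) P"
    unfolding piece_match_def
    using f_inv_into_f[of _ "fst \<phi>" "in_at (dg X) v"] f_inv_into_f[of _ "fst \<phi>" "out_at (dg X) v"]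
      bij_betw_imp_surj_on[OF bi] bij_betw_imp_surj_on[OF bo] by (simp add: P_def)
  ultimately have "P \<in> vertex_pieces X X' \<phi> v" unfolding vertex_pieces_def using k by simp
  then show ?thesis ..
qed

lemma vertex_piecesD:
  assumes "P \<in> vertex_pieces X X' \<phi> v"
  shows "P \<in> pieces (dg X) v (dg X')" "piece_emb P (dg X')" "piece_verts P = emb_verts (snd \<phi> v)"
    "piece_match (fst \<phi>) P"
  using assms unfolding vertex_pieces_def by auto

abbreviation "F \<equiv> dmor_of X X' \<phi>"

lemma F_simps: "v \<in> verts (fst X) \<Longrightarrow> snd F v = vertex_pieces X X' \<phi> v" "e \<in> dE (dg X) \<Longrightarrow> fst F e = fst \<phi> e"
  unfolding dmor_of_def by simp_all

lemma F_properad: "properad_map (dg X) (dg X') F"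
  unfolding properad_map_def
proof (intro conjI ballI)
  show "fst F \<in> dE (dg X) \<rightarrow>\<^sub>E dE (dg X')"
    unfolding dmor_of_def using p_arcs p_sign by auto
  have "vertex_pieces X X' \<phi> v \<in> piece_class (dg X) v (dg X') ` pieces (dg X) v (dg X')" if v: "v \<in> verts (fst X)" for v
  proof -
    obtain P where P: "P \<in> vertex_pieces X X' \<phi> v" using vertex_pieces_nonempty[OF v] ..
    note P' = vertex_piecesD[OF P]
    show ?thesis
      using vertex_pieces_eq[OF P'(2,3,4) piecesD(4,5)[OF P'(1)]] P'(1) by (metis imageI)
  qed
  then show "snd F \<in> (\<Pi>\<^sub>E v\<in>dV (dg X). piece_class (dg X) v (dg X') ` pieces (dg X) v (dg X'))"
    by (auto simp: dmor_of_def)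
  fix v P assume v: "v \<in> dV (dg X)" and P: "P \<in> snd F v"
  have P': "P \<in> vertex_pieces X X' \<phi> v" using F_simps(1) v P by simp
  note Q = vertex_piecesD[OF P']
  fix e
  have i: "in_at (dg X) v \<subseteq> dE (dg X)" "out_at (dg X) v \<subseteq> dE (dg X)" unfolding A.in_at_dg A.out_at_dg by auto
  show "fst (pmap P) e = fst F (pin P e)" if "e \<in> din (pgraph P)"
    using Q(4) that F_simps(2) bij_betwE[OF piecesD(4)[OF Q(1)]] i(1) unfolding piece_match_def by (metis subsetD)
  show "fst (pmap P) e = fst F (pout P e)" if "e \<in> dout (pgraph P)"
    using Q(4) that F_simps(2) bij_betwE[OF piecesD(5)[OF Q(1)]] i(2) unfolding piece_match_def by (metis subsetD)
qed

lemma F_prep: "v \<in> verts (fst X) \<Longrightarrow> prep F v \<in> vertex_pieces X X' \<phi> v"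
  using properad_mapD(4)[OF F_properad, of v] F_simps(1) by simp

lemma F_wheeled: "wheeled_map (dg X) (dg X') F"
  unfolding wheeled_map_iff[OF F_properad A.dg_connected B.dg_connected]
proof (intro conjI impI ballI)
  fix v assume "v \<in> dV (dg X)"
  then show "piece_emb (prep F v) (dg X')" using vertex_piecesD(2)[OF F_prep] by simp
next
  fix v w assume "v \<in> dV (dg X)" "w \<in> dV (dg X)" "v \<noteq> w"
  then show "piece_verts (prep F v) \<inter> piece_verts (prep F w) = {}"
    using vertex_piecesD(3)[OF F_prep] disj by simp
next
  assume *: "din (dg X) = {} \<and> dout (dg X) = {} \<and> (\<forall>v\<in>dV (dg X). piece_verts (prep F v) = {})"
  have v0: "emb_verts (snd \<phi> v) = {}" if "v \<in> verts (fst X)" for v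
    using * vertex_piecesD(3)[OF F_prep[OF that]] that by auto
  have "bnd (ug (dg X)) = {}" using * by (simp del: dg_simps)
  from embedding_closed(1)[OF ugraph_iso_embedding[OF A.of_ug_iso A.ug_dg_connected A.conn] this]
  have b: "bnd (fst X) = {}" .
  have "nodeless_loop (fst X')"
  \<comment> \<open>A value without vertices and boundary already makes the codomain a nodeless
    loop; otherwise all values are edges and the last condition on graphical maps applies.\<close>
  proof (cases "\<exists>v\<in>verts (fst X). emb_bnd (snd \<phi> v) = {}")
    case True then show ?thesis using Emb_empty_nodeless[OF \<phi>1(1)] v0 by blast
  next
    case False then show ?thesis using closed[OF b] emb_is_edge_iff[OF \<phi>1(1)] v0 by blast
  qed
  then show "dnodeless_loop (dg X')" using B.dg_nodeless by blast
qed

text \<open>Substitution yields an embedding with exactly the vertex set and boundary demanded of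
  the induced function at the class of \<open>k\<close>. Its inputs and outputs are those of
  \<open>K\<close>, still distinct after substitution, so injectivity of an embedding on inputs and
  on outputs gives injectivity of \<open>\<phi>\<close> there.\<close>

lemma induced_emb:
  fixes K :: "('a, 'v) digraph"
  assumes k: "dembedding K (dg X) k"
  shows "dembedding (induced_graph K k F) (dg X') (induced_map K k F)"
    "snd (induced_map K k F) ` dV (induced_graph K k F) = (\<Union>w\<in>snd k ` dV K. emb_verts (snd \<phi> w))"
    "fst (B.lift_map (induced_graph K k F) (induced_map K k F)) ` bnd (ug (induced_graph K k F)) =
      fst \<phi> ` (fst k ` din K \<union> dag (fst X) ` fst k ` dout K)"
    "inj_on (fst \<phi>) (fst k ` din K)" "inj_on (fst \<phi>) (fst k ` dout K)"
proof -
  interpret I: induced "dg X" "dg X'" F K k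
    by standard (use F_properad dembeddingD(1,3)[OF k] in auto)
  have e: "dembedding I.gs.S (dg X') (induced_map K k F)"
    using F_wheeled[unfolded wheeled_map_def, THEN conjunct2, rule_format, OF k] unfolding I.graph_eq .
  note kd = digraphD[OF dembeddingD(6)[OF k]]
  have kE: "fst k x \<in> dE (dg X)" if "x \<in> dE K" for x using local_mapD(3)[OF dembeddingD(3,6)[OF k] that] .
  have Fk: "fst F ` fst k ` S = fst \<phi> ` fst k ` S" if "S \<subseteq> dE K" for S
    unfolding image_image by (rule image_cong[OF refl], rule F_simps(2), rule kE) (use that in blast)
  show "dembedding (induced_graph K k F) (dg X') (induced_map K k F)" using e unfolding I.graph_eq .
  have "dag (fst X') ` fst \<phi> ` fst k ` dout K = fst \<phi> ` dag (fst X) ` fst k ` dout K"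
    unfolding image_image by (rule image_cong[OF refl]) (use kE kd(11) p_dag in auto)
  then show "fst (B.lift_map (induced_graph K k F) (induced_map K k F)) ` bnd (ug (induced_graph K k F)) =
      fst \<phi> ` (fst k ` din K \<union> dag (fst X) ` fst k ` dout K)"
    unfolding I.graph_eq B.lift_embedding(3)[OF e] I.map_din I.map_dout Fk[OF kd(10)] Fk[OF kd(11)] image_Un by simp
  show "snd (induced_map K k F) ` dV (induced_graph K k F) = (\<Union>w\<in>snd k ` dV K. emb_verts (snd \<phi> w))"
    unfolding I.graph_eq I.map_verts
    by (rule SUP_cong[OF refl]) (use vertex_piecesD(3)[OF F_prep] local_mapD(4)[OF dembeddingD(3,6)[OF k]] in auto)
  show "inj_on (fst \<phi>) (fst k ` din K)"
  proof (rule inj_onI, clarify)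
    fix a b assume a: "a \<in> din K" and b: "b \<in> din K" and eq: "fst \<phi> (fst k a) = fst \<phi> (fst k b)"
    have ab: "a \<in> dE K" "b \<in> dE K" using a b kd(10) by auto
    have m: "I.gs.q (Inl a) \<in> din I.gs.S" "I.gs.q (Inl b) \<in> din I.gs.S"
      unfolding I.gs.S_simps by (rule imageI[OF imageI[OF a]]) (rule imageI[OF imageI[OF b]])
    have "fst (induced_map K k F) (I.gs.q (Inl a)) = fst (induced_map K k F) (I.gs.q (Inl b))"
      using eq I.map_Inl ab F_simps(2)[OF kE] by simp
    then have "I.gs.q (Inl a) = I.gs.q (Inl b)"
      using inj_onD[OF dembedding_inj_din(1)[OF e] _ m] by blast
    then show "fst k a = fst k b" using inj_onD[OF I.gs.q_din_inj _ a b] by simp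
  qed
  show "inj_on (fst \<phi>) (fst k ` dout K)"
  proof (rule inj_onI, clarify)
    fix a b assume a: "a \<in> dout K" and b: "b \<in> dout K" and eq: "fst \<phi> (fst k a) = fst \<phi> (fst k b)"
    have ab: "a \<in> dE K" "b \<in> dE K" using a b kd(11) by auto
    have m: "I.gs.q (Inl a) \<in> dout I.gs.S" "I.gs.q (Inl b) \<in> dout I.gs.S"
      unfolding I.gs.S_simps by (rule imageI[OF imageI[OF a]]) (rule imageI[OF imageI[OF b]])
    have "fst (induced_map K k F) (I.gs.q (Inl a)) = fst (induced_map K k F) (I.gs.q (Inl b))"
      using eq I.map_Inl ab F_simps(2)[OF kE] by simp
    then have "I.gs.q (Inl a) = I.gs.q (Inl b)"
      using inj_onD[OF dembedding_inj_din(2)[OF e] _ m] by blast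
    then show "fst k a = fst k b" using inj_onD[OF I.gs.q_dout_inj _ a b] by simp
  qed
qed

section \<open>The induced function on classes of embeddings\<close>

lemma hat_ex:
  assumes c: "c \<in> Emb (fst X)"
  shows "\<exists>d\<in>Emb (fst X'). emb_bnd d = fst \<phi> ` emb_bnd c \<and>
    emb_verts d = (\<Union>w\<in>emb_verts c. emb_verts (snd \<phi> w)) \<and> inj_on (fst \<phi>) (emb_bnd c)"
proof -
  obtain K :: "('a, 'v) digraph" and k where k: "dembedding K (dg X) k" "emb_verts c = snd k ` dV K"
    "emb_bnd c = fst k ` din K \<union> dag (fst X) ` fst k ` dout K"
    using A.Emb_dembedding[OF c] by metis
  note e = induced_emb[OF k(1)]
  obtain d where d: "d \<in> Emb (fst X')"
    and d': "emb_verts d = snd (B.lift_map (induced_graph K k F) (induced_map K k F)) ` verts (ug (induced_graph K k F)) \<and>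
      emb_bnd d = fst (B.lift_map (induced_graph K k F) (induced_map K k F)) ` bnd (ug (induced_graph K k F))"
    by (rule bexE[OF embedding_Emb[OF B.lift_embedding(1)[OF e(1)]]])
  have "inj_on (fst \<phi>) (emb_bnd c)"
  proof (rule inj_onI)
    fix a b assume a: "a \<in> emb_bnd c" and b: "b \<in> emb_bnd c" and eq: "fst \<phi> a = fst \<phi> b"
    have aA: "a \<in> arcs (fst X)" and bA: "b \<in> arcs (fst X)" using a b Emb_subset(2)[OF c] by auto
    have s: "snd X a = snd X b" using p_sign[OF aA] p_sign[OF bA] eq by simp
    note bb = A.bin_bout[OF k(1,3)]
    show "a = b"
    proof (cases "snd X a = 1")
      case True
      then have "a \<in> bin X c" "b \<in> bin X c" using a b s unfolding bin_def by auto
      then show ?thesis using inj_onD[OF e(4) eq] unfolding bb by blast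
    next
      case False
      then have "snd X a = -1" "snd X b = -1" using s A.sign[OF aA] by auto
      then have "dag (fst X) a \<in> bout X c" "dag (fst X) b \<in> bout X c" using a b unfolding bout_def by auto
      moreover have "fst \<phi> (dag (fst X) a) = fst \<phi> (dag (fst X) b)" using p_dag[OF aA] p_dag[OF bA] eq by simp
      ultimately have "dag (fst X) a = dag (fst X) b" using inj_onD[OF e(5)] unfolding bb by blast
      then show ?thesis using A.u(5)[OF aA] A.u(5)[OF bA] by metis
    qed
  qed
  moreover have "emb_bnd d = fst \<phi> ` emb_bnd c" using d' e(3) k(3) by simp
  moreover have "emb_verts d = (\<Union>w\<in>emb_verts c. emb_verts (snd \<phi> w))"
    using d' B.lift_embedding(2)[OF e(1)] e(2) k(2) by simp
  ultimately show ?thesis using d by blast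
qed

lemma hatI:
  assumes "d \<in> Emb (fst X')" "emb_bnd d = fst \<phi> ` emb_bnd c" "emb_verts d = (\<Union>w\<in>emb_verts c. emb_verts (snd \<phi> w))"
  shows "emb_hat (fst X') \<phi> c = d"
  unfolding emb_hat_def
proof (rule the_equality)
  fix e assume "e \<in> Emb (fst X') \<and> emb_bnd e = fst \<phi> ` emb_bnd c \<and>
    emb_verts e = (\<Union>w\<in>emb_verts c. emb_verts (snd \<phi> w))"
  then show "e = d" using Emb_eqI[OF _ assms(1), of e] assms(2,3) by simp
qed (use assms in simp)

lemma hat:
  assumes c: "c \<in> Emb (fst X)"
  shows "emb_hat (fst X') \<phi> c \<in> Emb (fst X')" "emb_bnd (emb_hat (fst X') \<phi> c) = fst \<phi> ` emb_bnd c"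
    "emb_verts (emb_hat (fst X') \<phi> c) = (\<Union>w\<in>emb_verts c. emb_verts (snd \<phi> w))"
    "inj_on (fst \<phi>) (emb_bnd c)"
proof -
  obtain d where d: "d \<in> Emb (fst X')" and d': "emb_bnd d = fst \<phi> ` emb_bnd c \<and>
      emb_verts d = (\<Union>w\<in>emb_verts c. emb_verts (snd \<phi> w)) \<and> inj_on (fst \<phi>) (emb_bnd c)"
    by (rule bexE[OF hat_ex[OF c]])
  have "emb_hat (fst X') \<phi> c = d" using hatI[OF d] d' by simp
  then show "emb_hat (fst X') \<phi> c \<in> Emb (fst X')" "emb_bnd (emb_hat (fst X') \<phi> c) = fst \<phi> ` emb_bnd c"
    "emb_verts (emb_hat (fst X') \<phi> c) = (\<Union>w\<in>emb_verts c. emb_verts (snd \<phi> w))"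
    "inj_on (fst \<phi>) (emb_bnd c)" using d d' by simp_all
qed

text \<open>A factorisation of representatives is oriented by pullback, and
  \<open>induced_graph_mono\<close> turns it into an embedding of the substituted graphs over the
  codomain; \<open>emb_leI\<close> then reads off the inequality of classes.\<close>

lemma hat_mono:
  assumes le: "emb_le c d" and c: "c \<in> Emb (fst X)" and d: "d \<in> Emb (fst X)"
  shows "emb_le (emb_hat (fst X') \<phi> c) (emb_hat (fst X') \<phi> d)"
proof -
  obtain h k j where hk: "h \<in> c" "k \<in> d" and j: "embedding (fst h) (fst k) j"
    and hkj: "\<And>a. a \<in> arcs (fst h) \<Longrightarrow> fst (snd h) a = fst (snd k) (fst j a)"
    "\<And>v. v \<in> verts (fst h) \<Longrightarrow> snd (snd h) v = snd (snd k) (snd j v)"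
    using emb_leE[OF le c d] by metis
  note eh = EmbD(2)[OF c hk(1)] and ek = EmbD(2)[OF d hk(2)]
  interpret Y: oriented "A.pull (fst k) (snd k)" by (rule A.pull_oriented[OF ek])
  let ?L = "dg (A.pull (fst k) (snd k))" and ?H = "dg (A.pull (fst h) (snd h))"
  let ?l = "A.pull_map (fst k) (snd k)" and ?h = "A.pull_map (fst h) (snd h)"
  have l: "dembedding ?L (dg X) ?l" and h: "dembedding ?H (dg X) ?h"
    by (rule A.pull_dembedding(1)[OF ek]) (rule A.pull_dembedding(1)[OF eh])
  have jj: "embedding (fst h) (fst (A.pull (fst k) (snd k))) j" using j by simp
  \<comment> \<open>Orienting the smaller domain in two stages through \<open>j\<close> or at once
    through \<open>h\<close> gives the same oriented graph, so \<open>j\<close> becomes an embedding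
    between the two directed graphs in use.\<close>
  have pe: "Y.pull (fst h) j = A.pull (fst h) (snd h)"
    unfolding Y.pull_def A.pull_def[of "fst h"] using hkj(1) etaleD(3)[OF embeddingD(3)[OF j]]
    by (auto simp: fun_eq_iff restrict_def)
  have jd: "dembedding ?H ?L (Y.pull_map (fst h) j)" using Y.pull_dembedding(1)[OF jj] unfolding pe .
  have jdE: "fst (Y.pull_map (fst h) j) e = fst j e" if "e \<in> dE ?H" for e
    using that unfolding Y.pull_map_def pe by (simp del: dg_simps)
  have comm: "fst ?h e = fst ?l (fst (Y.pull_map (fst h) j) e)" if e: "e \<in> dE ?H" for e
    using e jdE[OF e] local_mapD(3)[OF dembeddingD(3,6)[OF jd] e] hkj(1)[of e]
    by (simp add: A.pull_map_def)
  have commv: "snd ?h v = snd ?l (snd (Y.pull_map (fst h) j) v)" if "v \<in> dV ?H" for v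
    using that hkj(2) by (simp add: A.pull_map_def Y.pull_map_def)
  obtain J where J: "dembedding (induced_graph ?H ?h F) (induced_graph ?L ?l F) J"
    "\<forall>c\<in>dE (induced_graph ?H ?h F). fst (induced_map ?L ?l F) (fst J c) = fst (induced_map ?H ?h F) c"
    "\<forall>u\<in>dV (induced_graph ?H ?h F). snd (induced_map ?L ?l F) (snd J u) = snd (induced_map ?H ?h F) u"
    using induced_graph_mono[OF F_properad F_wheeled jd l h comm commv] by blast
  let ?SH = "induced_graph ?H ?h F" and ?SL = "induced_graph ?L ?l F"
  let ?mH = "induced_map ?H ?h F" and ?mL = "induced_map ?L ?l F"
  note iH = induced_emb[OF h] and iL = induced_emb[OF l]
  note dJ = local_mapD[OF dembeddingD(3,6)[OF J(1)]] and dH = digraphD[OF dembeddingD(6)[OF iH(1)]]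
  have hat_bnd: "emb_bnd (emb_hat (fst X') \<phi> c) = fst (B.lift_map ?SH ?mH) ` bnd (ug ?SH)"
    unfolding iH(3) hat(2)[OF c] using EmbD(4)[OF c hk(1)] A.pull_dembedding(2)[OF eh] by simp
  have hat_bnd': "emb_bnd (emb_hat (fst X') \<phi> d) = fst (B.lift_map ?SL ?mL) ` bnd (ug ?SL)"
    unfolding iL(3) hat(2)[OF d] using EmbD(4)[OF d hk(2)] A.pull_dembedding(2)[OF ek] by simp
  have hat_v: "emb_verts (emb_hat (fst X') \<phi> c) = snd ?mH ` dV ?SH"
    unfolding iH(2) hat(3)[OF c] using EmbD(3)[OF c hk(1)] by (simp add: A.pull_map_def)
  have hat_v': "emb_verts (emb_hat (fst X') \<phi> d) = snd ?mL ` dV ?SL"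
    unfolding iL(2) hat(3)[OF d] using EmbD(3)[OF d hk(2)] by (simp add: A.pull_map_def)
  have lift: "fst (B.lift_map K k) (e, s) = (if s then fst k e else dag (fst X') (fst k e))"
    if "dembedding K (dg X') k" "e \<in> dE K" for K :: "('y, 'z) digraph" and k e s
    using local_mapD(3)[OF dembeddingD(3,6)[OF that(1)] that(2)] that(2)
    unfolding B.lift_map_def by (simp add: B.of_ug_simps)
  show ?thesis
  proof (rule emb_leI[OF dembedding_ug[OF J(1)] B.lift_embedding(1)[OF iL(1)] hat(1)[OF c] _ _ hat(1)[OF d] _ hat_bnd'])
    show "emb_verts (emb_hat (fst X') \<phi> d) = snd (B.lift_map ?SL ?mL) ` verts (ug ?SL)"
      unfolding hat_v' B.lift_embedding(2)[OF iL(1)] ..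
    have "snd (B.lift_map ?SL ?mL) u = snd ?mL u" if "u \<in> dV ?SL" for u
      using local_mapD(4)[OF dembeddingD(3,6)[OF iL(1)] that] that unfolding B.lift_map_def by simp
    then show "emb_verts (emb_hat (fst X') \<phi> c) = snd (B.lift_map ?SL ?mL) ` snd (ugm ?SH J) ` verts (ug ?SH)"
      unfolding hat_v image_image by (intro image_cong) (use J(3) dJ(4) in simp_all)
    have "fst (B.lift_map ?SH ?mH) b = fst (B.lift_map ?SL ?mL) (fst (ugm ?SH J) b)" if bb: "b \<in> bnd (ug ?SH)" for b
    proof -
      obtain e s where b: "b = (e, s)" "e \<in> dE ?SH" using bb dH(10,11) by auto
      show ?thesis using lift[OF iH(1) b(2)] lift[OF iL(1) dJ(3)[OF b(2)]] J(2) b by simp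
    qed
    then show "emb_bnd (emb_hat (fst X') \<phi> c) = fst (B.lift_map ?SL ?mL) ` fst (ugm ?SH J) ` bnd (ug ?SH)"
      unfolding hat_bnd image_image by (intro image_cong refl)
  qed
qed

end

section \<open>The equivalence\<close>

text \<open>At a vertex the identity must take the class with that one vertex whose boundary
  consists of the partners of its darts, which is the star.\<close>

definition id_umor :: "('a::infinite, 'v) ograph \<Rightarrow> ('a, 'v) umor" where
  "id_umor X = (restrict id (arcs (fst X)), restrict (star_class (fst X)) (verts (fst X)))"

lemma id_umor_map:
  fixes X :: "('a::infinite, 'v) ograph"
  assumes "oriented X"
  shows "oriented_map X X (id_umor X)"
proof -
  interpret oriented X by fact
  have "bij_betw (\<lambda>a. restrict id (arcs (fst X)) (dag (fst X) a)) (nb (fst X) v) (dag (fst X) ` nb (fst X) v)" for v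
  proof (rule bij_betw_cong[THEN iffD1, rotated])
    show "bij_betw (dag (fst X)) (nb (fst X) v) (dag (fst X) ` nb (fst X) v)"
      by (rule inj_on_imp_bij_betw, rule inj_on_inverseI[of _ "dag (fst X)"]) (use nb_arcs u(5) in blast)
    show "dag (fst X) a = restrict id (arcs (fst X)) (dag (fst X) a)" if "a \<in> nb (fst X) v" for a
      using u(4)[OF nb_arcs[OF that]] by simp
  qed
  moreover have "nodeless_loop (fst X)"
    if b: "bnd (fst X) = {}" and v: "\<forall>v\<in>verts (fst X). emb_is_edge (restrict (star_class (fst X)) (verts (fst X)) v)"
  proof -
    have "verts (fst X) = {}"
    proof (rule ccontr)
      assume "verts (fst X) \<noteq> {}"
      then obtain w where w: "w \<in> verts (fst X)" by auto
      then show False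
        using v emb_is_edge_iff[OF star_class(1)[OF conn w]] star_class(2)[OF conn w] by auto
    qed
    then show ?thesis using nodeless_loop_iff[OF conn] b by blast
  qed
  ultimately have "graphical_map (fst X) (fst X) (id_umor X)"
    unfolding graphical_map_def id_umor_def using star_class[OF conn] u(4) by auto
  then show ?thesis by unfold_locales (simp_all add: id_umor_def)
qed

lemma hat_id:
  fixes X :: "('a::infinite, 'v) ograph"
  assumes "oriented X" and c: "c \<in> Emb (fst X)"
  shows "emb_hat (fst X) (id_umor X) c = c"
proof -
  interpret oriented_map X X "id_umor X" by (rule id_umor_map[OF assms(1)])
  show ?thesis
  proof (rule hatI[OF c])
    show "emb_bnd c = fst (id_umor X) ` emb_bnd c"
      using Emb_subset(2)[OF c] by (force simp: id_umor_def)
    show "emb_verts c = (\<Union>w\<in>emb_verts c. emb_verts (snd (id_umor X) w))"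
      using Emb_subset(1)[OF c] star_class(2)[OF A.conn] by (auto simp: id_umor_def subset_iff)
  qed
qed

context oriented_map
begin

text \<open>A graphical map is recovered from its induced function by evaluation at stars. This
  yields a unit law and the injectivity of \<open>induced_pair\<close>.\<close>

lemma hat_star:
  assumes v: "v \<in> verts (fst X)"
  shows "emb_hat (fst X') \<phi> (star_class (fst X) v) = snd \<phi> v"
proof (rule hatI[OF \<phi>1(1)[OF v]])
  show "emb_bnd (snd \<phi> v) = fst \<phi> ` emb_bnd (star_class (fst X) v)"
    using bij_betw_imp_surj_on[OF bij[OF v]] star_class(3)[OF A.conn v] by (simp add: image_image)
qed (simp add: star_class(2)[OF A.conn v])

end

section \<open>Composition of oriented graphical maps\<close>

locale oriented_map_pair = M: oriented_map X X' \<phi> + M': oriented_map X' X'' \<psi>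
  for X X' X'' :: "('a::infinite, 'v) ograph" and \<phi> \<psi> :: "('a, 'v) umor"
begin

abbreviation "\<chi> \<equiv> umor_comp (fst X) (fst X'') \<psi> \<phi>"

lemma \<chi>: "a \<in> arcs (fst X) \<Longrightarrow> fst \<chi> a = fst \<psi> (fst \<phi> a)"
  "v \<in> verts (fst X) \<Longrightarrow> snd \<chi> v = emb_hat (fst X'') \<psi> (snd \<phi> v)"
  by (simp_all add: umor_comp_def)

lemma comp_map: "oriented_map X X'' \<chi>"
proof -
  have bij: "bij_betw (\<lambda>a. fst \<chi> (dag (fst X) a)) (nb (fst X) v) (emb_bnd (snd \<chi> v))" if v: "v \<in> verts (fst X)" for v
  proof (rule bij_betw_cong[THEN iffD1, rotated])
    have "bij_betw (fst \<psi>) (emb_bnd (snd \<phi> v)) (emb_bnd (snd \<chi> v))"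
      using M'.hat(2,4)[OF M.\<phi>1(1)[OF v]] \<chi>(2)[OF v] unfolding bij_betw_def by simp
    then show "bij_betw (fst \<psi> \<circ> (\<lambda>a. fst \<phi> (dag (fst X) a))) (nb (fst X) v) (emb_bnd (snd \<chi> v))"
      by (rule bij_betw_trans[OF M.bij[OF v]])
  qed (use M.A.u(4) M.A.nb_arcs \<chi>(1) in auto)
  have disj: "emb_verts (snd \<chi> v) \<inter> emb_verts (snd \<chi> w) = {}"
    if v: "v \<in> verts (fst X)" and w: "w \<in> verts (fst X)" and vw: "v \<noteq> w" for v w
  proof -
    have "emb_verts (snd \<psi> a) \<inter> emb_verts (snd \<psi> b) = {}"
      if a: "a \<in> emb_verts (snd \<phi> v)" and b: "b \<in> emb_verts (snd \<phi> w)" for a b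
    proof (rule M'.disj)
      show "a \<in> verts (fst X')" "b \<in> verts (fst X')"
        using a b Emb_subset(1)[OF M.\<phi>1(1)] v w by blast+
      show "a \<noteq> b" using a b M.disj[OF v w vw] by blast
    qed
    then show ?thesis
      unfolding \<chi>(2)[OF v] \<chi>(2)[OF w] M'.hat(3)[OF M.\<phi>1(1)[OF v]] M'.hat(3)[OF M.\<phi>1(1)[OF w]] by blast
  qed
  have closed: "nodeless_loop (fst X'')"
    if b: "bnd (fst X) = {}" and v: "\<forall>v\<in>verts (fst X). emb_is_edge (snd \<chi> v)"
  proof -
    \<comment> \<open>The intermediate values need not be edges, so the condition is not applied to
      the two maps in turn. The class of all of \<open>X\<close> is sent to one with neither
      vertices nor boundary, which forces a nodeless loop.\<close>
    obtain c where c: "c \<in> Emb (fst X)" "emb_verts c = verts (fst X)" "emb_bnd c = bnd (fst X)"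
      using Emb_total[OF M.A.conn] by blast
    let ?d = "emb_hat (fst X'') \<psi> (emb_hat (fst X') \<phi> c)"
    have e: "(\<Union>w\<in>emb_verts (snd \<phi> v). emb_verts (snd \<psi> w)) = {}" if "v \<in> verts (fst X)" for v
      using v that \<chi>(2)[OF that] M'.hat(1,3)[OF M.\<phi>1(1)[OF that]] emb_is_edge_iff by metis
    have "emb_verts ?d = {}"
      unfolding M'.hat(3)[OF M.hat(1)[OF c(1)]] M.hat(3)[OF c(1)] c(2) using e by auto
    moreover have "emb_bnd ?d = {}"
      unfolding M'.hat(2)[OF M.hat(1)[OF c(1)]] M.hat(2)[OF c(1)] c(3) b by simp
    ultimately show ?thesis using Emb_empty_nodeless[OF M'.hat(1)[OF M.hat(1)[OF c(1)]]] by blast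
  qed
  have "fst \<chi> \<in> arcs (fst X) \<rightarrow>\<^sub>E arcs (fst X'')"
    using M.p_arcs M'.p_arcs by (auto simp: umor_comp_def)
  moreover have "snd \<chi> \<in> verts (fst X) \<rightarrow>\<^sub>E Emb (fst X'')"
    using M.\<phi>1(1) M'.hat(1) by (auto simp: umor_comp_def)
  moreover have "fst \<chi> (dag (fst X) a) = dag (fst X'') (fst \<chi> a)" if "a \<in> arcs (fst X)" for a
    using that M.p_dag M'.p_dag M.p_arcs M.A.u(4) \<chi>(1) by simp
  ultimately have "graphical_map (fst X) (fst X'') \<chi>"
    unfolding graphical_map_def using bij disj closed by blast
  moreover have "snd X'' (fst \<chi> a) = snd X a" if "a \<in> arcs (fst X)" for a
    using that M.p_sign M'.p_sign M.p_arcs \<chi>(1) by simp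
  ultimately show ?thesis by unfold_locales auto
qed

text \<open>Both sides have the same boundary and the same vertices, and such a class is unique. At
  the value of a map this is associativity of composition.\<close>

lemma hat_comp:
  assumes c: "c \<in> Emb (fst X)"
  shows "emb_hat (fst X'') \<chi> c = emb_hat (fst X'') \<psi> (emb_hat (fst X') \<phi> c)"
proof -
  interpret N: oriented_map X X'' \<chi> by (rule comp_map)
  show ?thesis
  proof (rule N.hatI[OF M'.hat(1)[OF M.hat(1)[OF c]]])
    show "emb_bnd (emb_hat (fst X'') \<psi> (emb_hat (fst X') \<phi> c)) = fst \<chi> ` emb_bnd c"
      unfolding M'.hat(2)[OF M.hat(1)[OF c]] M.hat(2)[OF c] image_image
      by (rule image_cong[OF refl]) (use \<chi>(1) Emb_subset(2)[OF c] in auto)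
    have "emb_verts (snd \<chi> v) = (\<Union>w\<in>emb_verts (snd \<phi> v). emb_verts (snd \<psi> w))" if "v \<in> emb_verts c" for v
    proof -
      have v: "v \<in> verts (fst X)" using that Emb_subset(1)[OF c] by blast
      show ?thesis unfolding \<chi>(2)[OF v] M'.hat(3)[OF M.\<phi>1(1)[OF v]] ..
    qed
    then show "emb_verts (emb_hat (fst X'') \<psi> (emb_hat (fst X') \<phi> c)) = (\<Union>w\<in>emb_verts c. emb_verts (snd \<chi> w))"
      unfolding M'.hat(3)[OF M.hat(1)[OF c]] M.hat(3)[OF c] by auto
  qed
qed

text \<open>The piece obtained by substituting into a representative at \<open>v\<close> is
  embedded, has the vertices of the composite at \<open>v\<close> and matches its colours, by
  \<open>induced_emb\<close>. These invariants identify its class through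
  \<open>vertex_pieces_eq\<close>.\<close>

lemma F_comp: "dmor_of X X'' \<chi> = dmor_comp (dg X) (dg X'') M'.F M.F"
proof -
  interpret N: oriented_map X X'' \<chi> by (rule comp_map)
  have "restrict (fst \<chi>) (dE (dg X)) = restrict (\<lambda>e. fst M'.F (fst M.F e)) (dE (dg X))"
  proof (rule restrict_ext)
    fix e assume e: "e \<in> dE (dg X)"
    then have "fst \<phi> e \<in> dE (dg X')" using M.p_arcs M.p_sign by auto
    then show "fst \<chi> e = fst M'.F (fst M.F e)" using M.F_simps(2)[OF e] M'.F_simps(2) \<chi>(1) e by simp
  qed
  moreover have "vertex_pieces X X'' \<chi> v = piece_class (dg X) v (dg X'') (subst_piece M'.F (prep M.F v))"
    if v: "v \<in> verts (fst X)" for v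
  proof -
    let ?P = "prep M.F v" and ?R = "subst_piece M'.F (prep M.F v)"
    note P = M.vertex_piecesD[OF M.F_prep[OF v]]
    note Pp = piecesD[OF P(1)] and Pd = digraphD[OF dembeddingD(6)[OF P(2)]]
    interpret I: induced "dg X'" "dg X''" M'.F "pgraph ?P" "pmap ?P"
      by standard (use M'.F_properad dembeddingD(1,3)[OF P(2)] in auto)
    note e = M'.induced_emb[OF P(2)]
    have R: "pgraph ?R = I.gs.S" "pmap ?R = induced_map (pgraph ?P) (pmap ?P) M'.F"
      unfolding subst_piece_def by (simp_all add: I.graph_eq)
    \<comment> \<open>Distinct inputs lie in distinct classes, so the class contains exactly one
      input and the description in \<open>subst_piece\<close> is definite.\<close>
    have pin: "pin ?R (I.gs.q (Inl x)) = pin ?P x" if x: "x \<in> din (pgraph ?P)" for x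
    proof -
      have "pin ?R (I.gs.q (Inl x)) = (THE y. \<exists>e\<in>din (pgraph ?P). Inl e \<in> I.gs.q (Inl x) \<and> y = pin ?P e)"
        by (simp add: subst_piece_def)
      also have "\<dots> = pin ?P x"
        by (rule the_equality) (use x I.gs.q_self I.gs.mem_q' inj_onD[OF I.gs.q_din_inj] in blast)+
      finally show ?thesis .
    qed
    have pout: "pout ?R (I.gs.q (Inl x)) = pout ?P x" if x: "x \<in> dout (pgraph ?P)" for x
    proof -
      have "pout ?R (I.gs.q (Inl x)) = (THE y. \<exists>e\<in>dout (pgraph ?P). Inl e \<in> I.gs.q (Inl x) \<and> y = pout ?P e)"
        by (simp add: subst_piece_def)
      also have "\<dots> = pout ?P x"
        by (rule the_equality) (use x I.gs.q_self I.gs.mem_q' inj_onD[OF I.gs.q_dout_inj] in blast)+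
      finally show ?thesis .
    qed
    have tr: "bij_betw g ((\<lambda>x. I.gs.q (Inl x)) ` D) E"
      if "inj_on (\<lambda>x. I.gs.q (Inl x)) D" "bij_betw r D E" "\<And>x. x \<in> D \<Longrightarrow> g (I.gs.q (Inl x)) = r x" for g r D E
      using that unfolding bij_betw_def inj_on_def by (auto simp: image_image cong: image_cong)
    have emb: "piece_emb ?R (dg X'')" unfolding R using e(1) unfolding I.graph_eq .
    have "bij_betw (pin ?R) (din (pgraph ?R)) (in_at (dg X) v)"
      unfolding R I.gs.S_simps image_image by (rule tr[OF I.gs.q_din_inj Pp(4) pin])
    moreover have "bij_betw (pout ?R) (dout (pgraph ?R)) (out_at (dg X) v)"
      unfolding R I.gs.S_simps image_image by (rule tr[OF I.gs.q_dout_inj Pp(5) pout])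
    moreover have "piece_verts ?R = emb_verts (snd \<chi> v)"
      unfolding R(2) using e(2) unfolding I.graph_eq R(1) \<chi>(2)[OF v] M'.hat(3)[OF M.\<phi>1(1)[OF v]] P(3) by simp
    moreover have "piece_match (fst \<chi>) ?R"
    proof -
      have kE: "fst (pmap ?P) x \<in> dE (dg X')" if "x \<in> dE (pgraph ?P)" for x
        using local_mapD(3)[OF Pp(2,3) that] .
      have i: "fst (pmap ?R) (I.gs.q (Inl x)) = fst \<chi> (pin ?R (I.gs.q (Inl x)))" if x: "x \<in> din (pgraph ?P)" for x
      proof -
        have xE: "x \<in> dE (pgraph ?P)" using x Pd(10) by auto
        have "pin ?P x \<in> arcs (fst X)" using bij_betwE[OF Pp(4)] x unfolding M.A.in_at_dg by blast
        then have "fst \<chi> (pin ?P x) = fst \<psi> (fst (pmap ?P) x)"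
          using \<chi>(1) P(4) x unfolding piece_match_def by simp
        then show ?thesis unfolding R(2) I.map_Inl[OF xE] pin[OF x] M'.F_simps(2)[OF kE[OF xE]] by simp
      qed
      have o: "fst (pmap ?R) (I.gs.q (Inl x)) = fst \<chi> (pout ?R (I.gs.q (Inl x)))" if x: "x \<in> dout (pgraph ?P)" for x
      proof -
        have xE: "x \<in> dE (pgraph ?P)" using x Pd(11) by auto
        have "pout ?P x \<in> arcs (fst X)" using bij_betwE[OF Pp(5)] x unfolding M.A.out_at_dg by blast
        then have "fst \<chi> (pout ?P x) = fst \<psi> (fst (pmap ?P) x)"
          using \<chi>(1) P(4) x unfolding piece_match_def by simp
        then show ?thesis unfolding R(2) I.map_Inl[OF xE] pout[OF x] M'.F_simps(2)[OF kE[OF xE]] by simp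
      qed
      show ?thesis unfolding piece_match_def R(1) I.gs.S_simps using i o by blast
    qed
    ultimately show ?thesis using vertex_pieces_eq[OF emb] by metis
  qed
  ultimately show ?thesis
    unfolding dmor_of_def[of X X''] dmor_comp_def by (auto intro!: restrict_ext)
qed

end

section \<open>The category of oriented graphs and the functor out of it\<close>

lemma Comp_oriented: "Comp ext_oriented_cat X X' X'' \<psi> \<phi> = umor_comp (fst X) (fst X'') \<psi> \<phi>"
  unfolding ext_oriented_cat_def ext_graphical_cat_def by simp

lemma oriented_map_ext:
  assumes "oriented_map X X' \<phi>" "oriented_map X X' \<psi>"
    and "\<And>a. a \<in> arcs (fst X) \<Longrightarrow> fst \<phi> a = fst \<psi> a" "\<And>v. v \<in> verts (fst X) \<Longrightarrow> snd \<phi> v = snd \<psi> v"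
  shows "\<phi> = \<psi>"
proof -
  interpret M: oriented_map X X' \<phi> by fact
  interpret M': oriented_map X X' \<psi> by fact
  show ?thesis
    by (intro prod_eqI; rule extensionalityI)
      (use assms(3,4) M.p_ext M'.p_ext M.\<phi>1(2) M'.\<phi>1(2) in \<open>auto simp: PiE_iff\<close>)
qed

lemma ext_oriented_category: "is_category (ext_oriented_cat :: (('a::infinite, 'v) ograph, ('a, 'v) umor) cat)"
  (is "is_category ?C")
  unfolding is_category_def
proof (intro conjI ballI)
  fix X X' X'' :: "('a, 'v) ograph" and \<phi> \<psi>
  assume o: "X \<in> Obj ?C" "X' \<in> Obj ?C" "X'' \<in> Obj ?C" and m: "\<phi> \<in> Hom ?C X X'" "\<psi> \<in> Hom ?C X' X''"
  interpret oriented_map_pair X X' X'' \<phi> \<psi>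
    using o m unfolding Obj_oriented oriented_map_pair_def by (simp add: Hom_oriented)
  show "Comp ?C X X' X'' \<psi> \<phi> \<in> Hom ?C X X''"
    unfolding Comp_oriented using comp_map o unfolding Obj_oriented by (simp add: Hom_oriented)
next
  fix X X' X'' X''' :: "('a, 'v) ograph" and \<phi> \<psi> \<theta>
  assume o: "X \<in> Obj ?C" "X' \<in> Obj ?C" "X'' \<in> Obj ?C" "X''' \<in> Obj ?C"
    and m: "\<phi> \<in> Hom ?C X X'" "\<psi> \<in> Hom ?C X' X''" "\<theta> \<in> Hom ?C X'' X'''"
  interpret A: oriented_map_pair X X' X'' \<phi> \<psi>
    using o m unfolding Obj_oriented oriented_map_pair_def by (simp add: Hom_oriented)
  interpret B: oriented_map_pair X' X'' X''' \<psi> \<theta>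
    using o m unfolding Obj_oriented oriented_map_pair_def by (simp add: Hom_oriented)
  interpret C: oriented_map_pair X X' X''' \<phi> B.\<chi>
    using B.comp_map A.M.oriented_map_axioms unfolding oriented_map_pair_def by simp
  interpret D: oriented_map_pair X X'' X''' A.\<chi> \<theta>
    using A.comp_map B.M'.oriented_map_axioms unfolding oriented_map_pair_def by simp
  show "Comp ?C X X' X''' (Comp ?C X' X'' X''' \<theta> \<psi>) \<phi> = Comp ?C X X'' X''' \<theta> (Comp ?C X X' X'' \<psi> \<phi>)"
    unfolding Comp_oriented
  proof (rule oriented_map_ext[OF C.comp_map D.comp_map])
    show "fst C.\<chi> a = fst D.\<chi> a" if "a \<in> arcs (fst X)" for a
      using that C.\<chi>(1) D.\<chi>(1) A.\<chi>(1) B.\<chi>(1) A.M.p_arcs by simp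
    show "snd C.\<chi> v = snd D.\<chi> v" if "v \<in> verts (fst X)" for v
      using C.\<chi>(2)[OF that] D.\<chi>(2)[OF that] A.\<chi>(2)[OF that] B.hat_comp[OF A.M.\<phi>1(1)[OF that]] by simp
  qed
next
  fix X :: "('a, 'v) ograph" assume X: "X \<in> Obj ?C"
  then have oX: "oriented X" unfolding Obj_oriented .
  note i = id_umor_map[OF oX]
  have "is_ident ?C X (id_umor X)"
    unfolding is_ident_def
  proof (intro conjI ballI)
    show "id_umor X \<in> Hom ?C X X" using i oX Hom_oriented by blast
  next
    fix Y :: "('a, 'v) ograph" and \<phi> assume Y: "Y \<in> Obj ?C" and m: "\<phi> \<in> Hom ?C X Y"
    interpret oriented_map_pair X X Y "id_umor X" \<phi>
      using Y m i oX unfolding Obj_oriented oriented_map_pair_def by (simp add: Hom_oriented)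
    show "Comp ?C X X Y \<phi> (id_umor X) = \<phi>"
      unfolding Comp_oriented
    proof (rule oriented_map_ext[OF comp_map M'.oriented_map_axioms])
      show "fst \<chi> a = fst \<phi> a" if "a \<in> arcs (fst X)" for a using that \<chi>(1) by (simp add: id_umor_def)
      show "snd \<chi> v = snd \<phi> v" if "v \<in> verts (fst X)" for v
        using \<chi>(2)[OF that] M'.hat_star[OF that] that by (simp add: id_umor_def)
    qed
  next
    fix Y :: "('a, 'v) ograph" and \<phi> assume Y: "Y \<in> Obj ?C" and m: "\<phi> \<in> Hom ?C Y X"
    interpret oriented_map_pair Y X X \<phi> "id_umor X"
      using Y m i oX unfolding Obj_oriented oriented_map_pair_def by (simp add: Hom_oriented)
    show "Comp ?C Y X X (id_umor X) \<phi> = \<phi>"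
      unfolding Comp_oriented
    proof (rule oriented_map_ext[OF comp_map M.oriented_map_axioms])
      show "fst \<chi> a = fst \<phi> a" if "a \<in> arcs (fst Y)" for a using that \<chi>(1) M.p_arcs by (simp add: id_umor_def)
      show "snd \<chi> v = snd \<phi> v" if "v \<in> verts (fst Y)" for v
        using \<chi>(2)[OF that] hat_id[OF oX M.\<phi>1(1)[OF that]] by simp
    qed
  qed
  then show "\<exists>i. is_ident ?C X i" ..
qed

text \<open>Values at negative arcs follow from those at their partners. A common piece at
  \<open>v\<close> fixes the vertex set of the value there, and the arc map fixes its boundary
  through the bijection at \<open>v\<close>.\<close>

lemma dmor_of_inj:
  assumes "oriented_map X X' \<phi>" "oriented_map X X' \<psi>" and eq: "dmor_of X X' \<phi> = dmor_of X X' \<psi>"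
  shows "\<phi> = \<psi>"
proof -
  interpret M: oriented_map X X' \<phi> by fact
  interpret M': oriented_map X X' \<psi> by fact
  have pos: "fst \<phi> a = fst \<psi> a" if "a \<in> arcs (fst X)" "snd X a = 1" for a
    using M.F_simps(2)[of a] M'.F_simps(2)[of a] that eq by simp
  have arcs: "fst \<phi> a = fst \<psi> a" if a: "a \<in> arcs (fst X)" for a
  proof (cases "snd X a = 1")
    case False
    then have "snd X (dag (fst X) a) = 1" using M.A.sign[OF a] M.A.sign_dag[OF a] by simp
    then have "fst \<phi> (dag (fst X) a) = fst \<psi> (dag (fst X) a)" using pos M.A.u(4)[OF a] by blast
    then show ?thesis using M.p_dag[OF a] M'.p_dag[OF a] M.B.u(5)[OF M.p_arcs[OF a]] M.B.u(5)[OF M'.p_arcs[OF a]] by metis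
  qed (use pos a in blast)
  show ?thesis
  proof (rule oriented_map_ext[OF assms(1,2) arcs])
    fix v assume v: "v \<in> verts (fst X)"
    obtain P where P: "P \<in> vertex_pieces X X' \<phi> v" using M.vertex_pieces_nonempty[OF v] ..
    then have P': "P \<in> vertex_pieces X X' \<psi> v" using M.F_simps(1)[OF v] M'.F_simps(1)[OF v] eq by simp
    show "snd \<phi> v = snd \<psi> v"
    proof (rule Emb_eqI[OF M.\<phi>1(1)[OF v] M'.\<phi>1(1)[OF v]])
      show "emb_verts (snd \<phi> v) = emb_verts (snd \<psi> v)" using M.vertex_piecesD(3)[OF P] M'.vertex_piecesD(3)[OF P'] by simp
      have "(\<lambda>a. fst \<phi> (dag (fst X) a)) ` nb (fst X) v = (\<lambda>a. fst \<psi> (dag (fst X) a)) ` nb (fst X) v"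
        by (rule image_cong[OF refl]) (use arcs M.A.u(4) M.A.nb_arcs in blast)
      then show "emb_bnd (snd \<phi> v) = emb_bnd (snd \<psi> v)"
        using bij_betw_imp_surj_on[OF M.bij[OF v]] bij_betw_imp_surj_on[OF M'.bij[OF v]] by simp
    qed
  qed
qed

text \<open>The value at \<open>v\<close> is the class of the embedding given by the chosen piece.
  Its inputs and outputs correspond to those of \<open>v\<close> by the bijections of the piece, and
  the three conditions of \<open>wheeled_map_iff\<close> supply the embedding, the disjointness and
  the condition on nodeless loops.\<close>

lemma dmor_of_surj:
  fixes X X' :: "('a::infinite, 'v) ograph"
  assumes "oriented X" "oriented X'" and w: "wheeled_map (dg X) (dg X') f"
  shows "\<exists>\<phi>. oriented_map X X' \<phi> \<and> dmor_of X X' \<phi> = f"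
proof -
  interpret A: oriented X by fact
  interpret B: oriented X' by fact
  have pm: "properad_map (dg X) (dg X') f" using w unfolding wheeled_map_def by blast
  note f = properad_mapD[OF pm]
  have pe: "piece_emb (prep f v) (dg X')" if "v \<in> verts (fst X)" for v
    using w that unfolding wheeled_map_iff[OF pm A.dg_connected B.dg_connected] by simp
  have pd: "piece_verts (prep f v) \<inter> piece_verts (prep f w) = {}"
    if "v \<in> verts (fst X)" "w \<in> verts (fst X)" "v \<noteq> w" for v w
    using w that unfolding wheeled_map_iff[OF pm A.dg_connected B.dg_connected] by simp
  have pc: "dnodeless_loop (dg X')" if "din (dg X) = {}" "dout (dg X) = {}" "\<forall>v\<in>verts (fst X). piece_verts (prep f v) = {}"
    using w that unfolding wheeled_map_iff[OF pm A.dg_connected B.dg_connected] by simp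
  \<comment> \<open>The given map only has values at edges, that is, at positive arcs; compatibility
    with the involution forces the rest.\<close>
  define p where "p = restrict (\<lambda>a. if snd X a = 1 then fst f a else dag (fst X') (fst f (dag (fst X) a))) (arcs (fst X))"
  have f0: "fst f a \<in> arcs (fst X') \<and> snd X' (fst f a) = 1" if "a \<in> arcs (fst X)" "snd X a = 1" for a
    using f(1) that by auto
  have neg: "snd X a = -1 \<and> snd X (dag (fst X) a) = 1" if "a \<in> arcs (fst X)" "snd X a \<noteq> 1" for a
    using A.sign[OF that(1)] A.sign_dag[OF that(1)] that(2) by simp
  have ppos: "p a = fst f a" if "a \<in> arcs (fst X)" "snd X a = 1" for a using that by (simp add: p_def)
  interpret arc_map X X' p
  proof
    have "p a \<in> arcs (fst X')" if a: "a \<in> arcs (fst X)" for a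
      using f0[OF a] f0[OF A.u(4)[OF a]] neg[OF a] a B.u(4) by (auto simp: p_def)
    then show "p \<in> arcs (fst X) \<rightarrow>\<^sub>E arcs (fst X')" by (auto simp: p_def)
    fix a assume a: "a \<in> arcs (fst X)"
    show "p (dag (fst X) a) = dag (fst X') (p a)"
    proof (cases "snd X a = 1")
      case True then show ?thesis using a A.u(4,5)[OF a] by (simp add: p_def)
    next
      case False
      then show ?thesis using a A.u(4)[OF a] neg[OF a] f0[OF A.u(4)[OF a]] B.u(5) by (simp add: p_def)
    qed
    show "snd X' (p a) = snd X a"
    proof (cases "snd X a = 1")
      case False
      then show ?thesis using a neg[OF a] f0[OF A.u(4)[OF a]] by (simp add: p_def)
    qed (use a f0[OF a] in \<open>simp add: p_def\<close>)
  qed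
  have "\<exists>c\<in>Emb (fst X'). emb_verts c = piece_verts (prep f v) \<and>
    emb_bnd c = fst (pmap (prep f v)) ` din (pgraph (prep f v)) \<union> dag (fst X') ` fst (pmap (prep f v)) ` dout (pgraph (prep f v))"
    if "v \<in> verts (fst X)" for v
    using embedding_Emb[OF B.lift_embedding(1)[OF pe[OF that]]] unfolding B.lift_embedding(2,3)[OF pe[OF that]] .
  then obtain C where C: "\<And>v. v \<in> verts (fst X) \<Longrightarrow> C v \<in> Emb (fst X')"
    "\<And>v. v \<in> verts (fst X) \<Longrightarrow> emb_verts (C v) = piece_verts (prep f v)"
    "\<And>v. v \<in> verts (fst X) \<Longrightarrow> emb_bnd (C v) = fst (pmap (prep f v)) ` din (pgraph (prep f v)) \<union>
      dag (fst X') ` fst (pmap (prep f v)) ` dout (pgraph (prep f v))"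
    by metis
  define \<phi> where "\<phi> = (p, restrict C (verts (fst X)))"
  have match: "piece_match p P" if v: "v \<in> verts (fst X)" and P: "P \<in> pieces (dg X) v (dg X')" and m: "piece_match (fst f) P" for v P
    using m ppos bij_betwE[OF piecesD(4)[OF P]] bij_betwE[OF piecesD(5)[OF P]]
    unfolding piece_match_def A.in_at_dg A.out_at_dg by auto
  have bij: "bij_betw (\<lambda>a. p (dag (fst X) a)) (nb (fst X) v) (emb_bnd (C v))" if v: "v \<in> verts (fst X)" for v
  proof -
    have P: "prep f v \<in> pieces (dg X) v (dg X')" using f(5) v by simp
    have m: "piece_match p (prep f v)" using match[OF v P] f(6)[OF _ f(4)] v by simp
    note bb = B.bin_bout[OF pe[OF v] C(3)[OF v]]
    note i = bij_betw_factor_inj[OF piecesD(4)[OF P] dembedding_inj_din(1)[OF pe[OF v]], of p]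
      and o = bij_betw_factor_inj[OF piecesD(5)[OF P] dembedding_inj_din(2)[OF pe[OF v]], of p]
    show ?thesis unfolding star_bij_iff[OF C(1)[OF v]] unfolding bij_betw_def bb
      using i o m unfolding piece_match_def by simp
  qed
  have closed: "nodeless_loop (fst X')" if b: "bnd (fst X) = {}" and e: "\<forall>v\<in>verts (fst X). emb_is_edge (C v)"
  proof -
    have "piece_verts (prep f v) = {}" if v: "v \<in> verts (fst X)" for v
      using e v emb_is_edge_iff[OF C(1)[OF v]] C(2)[OF v] by auto
    then have "dnodeless_loop (dg X')" using b by (intro pc) auto
    then show ?thesis using B.dg_nodeless by blast
  qed
  have "graphical_map (fst X) (fst X') \<phi>"
    unfolding graphical_map_def using p_ext p_dag C(1) bij closed pd C(2) by (auto simp: \<phi>_def)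
  then have om: "oriented_map X X' \<phi>" by unfold_locales (use p_sign in \<open>simp_all add: \<phi>_def\<close>)
  interpret M: oriented_map X X' \<phi> by (rule om)
  have "vertex_pieces X X' \<phi> v = snd f v" if v: "v \<in> verts (fst X)" for v
  proof -
    have v': "v \<in> dV (dg X)" using v by simp
    obtain P0 where P0: "P0 \<in> pieces (dg X) v (dg X')" "snd f v = piece_class (dg X) v (dg X') P0" using f(3)[OF v'] by blast
    have i: "piece_iso (prep f v) P0" using f(4)[OF v'] unfolding P0(2) piece_class_def by simp
    \<comment> \<open>The properties are known for the chosen representative and are carried to
      \<open>P0\<close>, which represents the same class.\<close>
    note pp = piece_iso_props[OF i piecesD(1,2)[OF f(5)[OF v']] piecesD(1,2)[OF P0(1)]]
    have "piece_emb P0 (dg X')" "piece_verts P0 = emb_verts (snd \<phi> v)"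
      using pp(1,2) pe[OF v] C(2)[OF v] v by (simp_all add: \<phi>_def)
    moreover have "piece_match (fst \<phi>) P0"
      using match[OF v P0(1)] pp(3) f(6)[OF v' f(4)[OF v']] by (simp add: \<phi>_def)
    ultimately show ?thesis unfolding P0(2) using vertex_pieces_eq piecesD(4,5)[OF P0(1)] by metis
  qed
  then have "snd (dmor_of X X' \<phi>) = snd f"
    by (intro extensionalityI[of _ "verts (fst X)"]) (use f(2) in \<open>simp_all add: dmor_of_def\<close>)
  moreover have "fst (dmor_of X X' \<phi>) = fst f"
    by (rule extensionalityI[of _ "dE (dg X)"]) (use f(1) ppos in \<open>auto simp: dmor_of_def \<phi>_def PiE_iff\<close>)
  ultimately show ?thesis using om prod_eqI by blast
qed

text \<open>Edges of \<open>G\<close> serve as the positive arcs and fresh elements of the infinite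
  type as their partners. Since \<open>dg\<close> represents an edge by its positive arc,
  \<open>G\<close> is recovered exactly and not just up to isomorphism.\<close>

lemma dg_surj:
  fixes G :: "('a::infinite, 'v) digraph"
  assumes G: "connected_digraph G"
  shows "\<exists>X. oriented X \<and> dg X = G"
proof -
  note d = digraphD[OF connected_digraphD(1)[OF G]]
  have "infinite (- dE G)" using d(1) infinite_UNIV by (simp add: finite_compl)
  then obtain B where B: "finite B" "card B = card (dE G)" "B \<subseteq> - dE G" using infinite_arbitrarily_large by blast
  obtain \<sigma> where \<sigma>: "bij_betw \<sigma> (dE G) B" using finite_same_card_bij[OF d(1) B(1)] B(2) by auto
  \<comment> \<open>Signed edges are renamed so that the positive copy of \<open>e\<close> is
    \<open>e\<close> itself; \<open>\<sigma>\<close> supplies the fresh negative copies.\<close>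
  define \<iota> where "\<iota> = (\<lambda>(e, s). if s then e else \<sigma> e)"
  have \<iota>s: "\<iota> (e, True) = e" "\<iota> (e, False) = \<sigma> e" for e by (simp_all add: \<iota>_def)
  have \<sigma>n: "\<sigma> e \<notin> dE G" if "e \<in> dE G" for e using bij_betwE[OF \<sigma>] B(3) that by auto
  have \<sigma>i: "\<sigma> e = \<sigma> e' \<longleftrightarrow> e = e'" if "e \<in> dE G" "e' \<in> dE G" for e e'
    using bij_betw_imp_inj_on[OF \<sigma>] that by (auto dest: inj_onD)
  have inj: "inj_on \<iota> (arcs (ug G))"
    using \<sigma>n \<sigma>i by (force simp: inj_on_def \<iota>_def)
  let ?H = "relabel \<iota> id (ug G)"
  have cug: "connected_ugraph (ug G)" using G ug_connected by blast
  obtain z where z: "ugraph ?H" "ugraph_iso ?H (ug G) z"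
    using relabel[OF connected_ugraphD(1)[OF cug] inj, of id] by auto
  have H: "connected_ugraph ?H" by (rule ugraph_iso_connected[OF z(2,1) cug])
  have inv: "inv_into (arcs (ug G)) \<iota> (\<iota> b) = b" if "b \<in> arcs (ug G)" for b using inj that by simp
  have arcsH: "a \<in> arcs ?H \<longleftrightarrow> (\<exists>e\<in>dE G. a = e \<or> a = \<sigma> e)" for a
    unfolding relabel_def by (force simp: \<iota>s image_iff ex_bool_eq)
  have dagH: "dag ?H e = \<sigma> e" "dag ?H (\<sigma> e) = e" if e: "e \<in> dE G" for e
  proof -
    have "dag ?H (\<iota> (e, s)) = \<iota> (e, \<not> s)" for s
      using e inv[of "(e, s)"] by (simp add: relabel_def)
    from this[of True] this[of False] show "dag ?H e = \<sigma> e" "dag ?H (\<sigma> e) = e" by (simp_all add: \<iota>s)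
  qed
  have mem: "e \<in> \<iota> ` (S \<times> {True} \<union> T \<times> {False}) \<longleftrightarrow> e \<in> S" "\<sigma> e \<in> \<iota> ` (S \<times> {True} \<union> T \<times> {False}) \<longleftrightarrow> e \<in> T"
    if e: "e \<in> dE G" and "S \<subseteq> dE G" "T \<subseteq> dE G" for e S T
  proof -
    have "S \<times> {True} \<union> T \<times> {False} \<subseteq> arcs (ug G)" using that by auto
    from inj_on_image_mem_iff[OF inj _ this, of "(e, True)"] inj_on_image_mem_iff[OF inj _ this, of "(e, False)"]
    show "e \<in> \<iota> ` (S \<times> {True} \<union> T \<times> {False}) \<longleftrightarrow> e \<in> S" "\<sigma> e \<in> \<iota> ` (S \<times> {True} \<union> T \<times> {False}) \<longleftrightarrow> e \<in> T"
      using e by (simp_all add: \<iota>s)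
  qed
  have dartsH: "e \<in> darts ?H \<longleftrightarrow> e \<in> dO G" "\<sigma> e \<in> darts ?H \<longleftrightarrow> e \<in> dI G"
    and bndH: "e \<in> bnd ?H \<longleftrightarrow> e \<in> din G" "\<sigma> e \<in> bnd ?H \<longleftrightarrow> e \<in> dout G" if "e \<in> dE G" for e
    using mem[OF that d(4,3)] mem[OF that d(10,11)] by (simp_all add: relabel_def)
  have tgtH: "e \<in> dO G \<Longrightarrow> tgt ?H e = dtO G e" "e \<in> dI G \<Longrightarrow> tgt ?H (\<sigma> e) = dtI G e" if "e \<in> dE G" for e
    using dartsH[OF that] inv[of "(e, True)"] inv[of "(e, False)"] that by (simp_all add: relabel_def \<iota>s)
  define X where "X = (?H, restrict (\<lambda>a. if a \<in> dE G then 1 else -1 :: int) (arcs ?H))"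
  have X: "fst X = ?H" "\<And>e. e \<in> dE G \<Longrightarrow> snd X e = 1" "\<And>e. e \<in> dE G \<Longrightarrow> snd X (\<sigma> e) = -1"
    "snd X \<in> extensional (arcs ?H)"
    using \<sigma>n arcsH by (auto simp: X_def)
  have "orientation (fst X) (snd X)"
    unfolding orientation_def X(1) using arcsH dagH X(2,3,4) by (auto simp: PiE_iff)
  then have "oriented X" using H by unfold_locales (simp_all add: X(1))
  moreover have "dg X = G"
  proof -
    have E: "a \<in> arcs ?H \<and> snd X a = 1 \<longleftrightarrow> a \<in> dE G" for a using arcsH X(2,3) by auto
    have E': "a \<in> arcs ?H \<and> snd X a = 1 \<and> Q \<longleftrightarrow> a \<in> dE G \<and> Q" for a Q using E by blast
    have I: "{a \<in> arcs ?H. snd X a = 1 \<and> dag ?H a \<in> darts ?H} = dI G"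
      unfolding E' using dagH dartsH d(3) by auto
    have O: "{a \<in> arcs ?H. snd X a = 1 \<and> a \<in> darts ?H} = dO G"
      unfolding E' using dartsH d(4) by auto
    show ?thesis
    proof (rule digraph.equality)
      show "dE (dg X) = dE G" using E by (auto simp: X(1))
      show "dI (dg X) = dI G" using I by (simp add: X(1))
      show "dO (dg X) = dO G" using O by (simp add: X(1))
      show "dV (dg X) = dV G" by (simp add: X(1) relabel_def)
      show "dtI (dg X) = dtI G"
        unfolding dg_simps X(1) I
        by (rule extensionalityI[of _ "dI G"]) (use d(3,5) dagH tgtH in \<open>auto simp: PiE_iff\<close>)
      show "dtO (dg X) = dtO G"
        unfolding dg_simps X(1) O
        by (rule extensionalityI[of _ "dO G"]) (use d(4,6) tgtH in \<open>auto simp: PiE_iff\<close>)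
      show "din (dg X) = din G" unfolding dg_simps X(1) E' using bndH d(10) by auto
      show "dout (dg X) = dout G" unfolding dg_simps X(1) E' using bndH dagH d(11) by auto
    qed simp
  qed
  ultimately show ?thesis by blast
qed

lemma oriented_wheeled_equivalence:
  "equivalent_categories
     (ext_oriented_cat :: (('a::infinite, 'v) ograph, ('a, 'v) umor) cat)
     (wheeled_properadic_cat :: (('a, 'v) digraph, ('a, 'v) dmor) cat)" (is "equivalent_categories ?C ?D")
proof (rule equivalent_categoriesI[where Fo = dg and Fm = dmor_of])
  have objD: "G \<in> Obj ?D \<longleftrightarrow> connected_digraph G" and homD: "f \<in> Hom ?D G G' \<longleftrightarrow> wheeled_map G G' f"
    and compD: "Comp ?D G G' G'' g f = dmor_comp G G'' g f" for G G' G'' f g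
    by (simp_all add: wheeled_properadic_cat_def)
  show "is_category ?C" by (rule ext_oriented_category)
  show "dg ` Obj ?C = Obj ?D"
  proof (intro equalityI subsetI)
    fix G assume "G \<in> dg ` Obj ?C"
    then obtain X where X: "X \<in> Obj ?C" "G = dg X" by (rule imageE) simp
    show "G \<in> Obj ?D" unfolding objD X(2) by (rule oriented.dg_connected[OF X(1)[unfolded Obj_oriented]])
  next
    fix G assume "G \<in> Obj ?D"
    then obtain X where X: "oriented X" "dg X = G" using dg_surj[of G] objD by auto
    show "G \<in> dg ` Obj ?C" by (rule image_eqI[of _ _ X]) (simp_all add: X Obj_oriented)
  qed
  fix X X' :: "('a, 'v) ograph" assume o: "X \<in> Obj ?C" "X' \<in> Obj ?C"
  note o' = o[unfolded Obj_oriented]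
  show "bij_betw (dmor_of X X') (Hom ?C X X') (Hom ?D (dg X) (dg X'))"
    unfolding bij_betw_def
  proof
    show "inj_on (dmor_of X X') (Hom ?C X X')"
      by (rule inj_onI, rule dmor_of_inj) (simp_all add: Hom_oriented o')
    show "dmor_of X X' ` Hom ?C X X' = Hom ?D (dg X) (dg X')"
    proof (intro equalityI subsetI)
      fix f assume "f \<in> dmor_of X X' ` Hom ?C X X'"
      then obtain \<phi> where \<phi>: "\<phi> \<in> Hom ?C X X'" "f = dmor_of X X' \<phi>" by (rule imageE) simp
      show "f \<in> Hom ?D (dg X) (dg X')"
        unfolding homD \<phi>(2) by (rule oriented_map.F_wheeled[OF \<phi>(1)[unfolded Hom_oriented[OF o']]])
    next
      fix f assume "f \<in> Hom ?D (dg X) (dg X')"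
      then obtain \<phi> where \<phi>: "oriented_map X X' \<phi>" "dmor_of X X' \<phi> = f"
        using dmor_of_surj[OF o', of f] homD by auto
      show "f \<in> dmor_of X X' ` Hom ?C X X'"
        by (rule image_eqI[of _ _ \<phi>]) (simp_all add: \<phi> Hom_oriented[OF o'])
    qed
  qed
  fix X'' :: "('a, 'v) ograph" and \<phi> \<psi>
  assume o'': "X'' \<in> Obj ?C" and m: "\<phi> \<in> Hom ?C X X'" "\<psi> \<in> Hom ?C X' X''"
  interpret oriented_map_pair X X' X'' \<phi> \<psi>
    using o o'' m unfolding Obj_oriented oriented_map_pair_def by (simp add: Hom_oriented)
  show "dmor_of X X'' (Comp ?C X X' X'' \<psi> \<phi>) = Comp ?D (dg X) (dg X') (dg X'') (dmor_of X' X'' \<psi>) (dmor_of X X' \<phi>)"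
    unfolding Comp_oriented compD by (rule F_comp)
qed

section \<open>Growing embeddings one vertex at a time\<close>

text \<open>The arcs of edges touching \<open>W\<close> complete \<open>W\<close> to a
  decomposition: closure of \<open>W\<close> along edges ensures that a dart among them sits at a
  vertex of \<open>W\<close>.\<close>

lemma connected_ugraph_verts_closed:
  assumes G: "connected_ugraph G" and W: "W \<subseteq> verts G"
    and cl: "\<And>a. a \<in> darts G \<Longrightarrow> dag G a \<in> darts G \<Longrightarrow> tgt G a \<in> W \<Longrightarrow> tgt G (dag G a) \<in> W"
  shows "W = {} \<or> W = verts G"
proof -
  note u = ugraphD[OF connected_ugraphD(1)[OF G]]
  define A where "A = {a \<in> arcs G. a \<in> darts G \<and> tgt G a \<in> W \<or> dag G a \<in> darts G \<and> tgt G (dag G a) \<in> W}"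
  have "W = verts G" if "W \<noteq> {}"
  proof (rule connected_ugraph_closed(2)[OF G, of A])
    show "dag G a \<in> A" if "a \<in> A" for a using that u(4,5) unfolding A_def by auto
    show "a \<in> A \<longleftrightarrow> tgt G a \<in> W" if a: "a \<in> darts G" for a
      using cl[of "dag G a"] a u(5)[of a] u(7) unfolding A_def by auto
  qed (use W that in \<open>auto simp: A_def\<close>)
  then show ?thesis by blast
qed

text \<open>The full subgraph on \<open>S\<close> with all edges touching it. Edges leaving
  \<open>S\<close> keep both arcs, the outer one becoming boundary, while edges inside
  \<open>S\<close> are not cut; the inclusion is thus bijective at each vertex.\<close>

definition induced_sub :: "('a, 'v) ugraph \<Rightarrow> 'v set \<Rightarrow> ('a, 'v) ugraph" where
  "induced_sub L S = (let D = {d \<in> darts L. tgt L d \<in> S}; A = {a \<in> arcs L. a \<in> D \<or> dag L a \<in> D} in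
     \<lparr>arcs = A, verts = S, dag = restrict (dag L) A, darts = D, tgt = restrict (tgt L) D, bnd = A - D\<rparr>)"

lemma induced_sub_simps [simp]:
  "darts (induced_sub L S) = {d \<in> darts L. tgt L d \<in> S}"
  "arcs (induced_sub L S) = {a \<in> arcs L. a \<in> darts L \<and> tgt L a \<in> S \<or> dag L a \<in> darts L \<and> tgt L (dag L a) \<in> S}"
  "verts (induced_sub L S) = S"
  "a \<in> arcs (induced_sub L S) \<Longrightarrow> dag (induced_sub L S) a = dag L a"
  "d \<in> darts L \<Longrightarrow> tgt L d \<in> S \<Longrightarrow> tgt (induced_sub L S) d = tgt L d"
  by (auto simp: induced_sub_def Let_def)

lemma induced_sub_ugraph:
  assumes L: "ugraph L" and S: "S \<subseteq> verts L"
  shows "ugraph (induced_sub L S)"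
proof -
  note u = ugraphD[OF L]
  have "dag (induced_sub L S) \<in> arcs (induced_sub L S) \<rightarrow>\<^sub>E arcs (induced_sub L S)"
    using u(4,5) by (auto simp: induced_sub_def Let_def)
  moreover have "tgt (induced_sub L S) \<in> darts (induced_sub L S) \<rightarrow>\<^sub>E verts (induced_sub L S)"
    by (auto simp: induced_sub_def Let_def)
  moreover have "bnd (induced_sub L S) = arcs (induced_sub L S) - darts (induced_sub L S)"
    by (simp add: induced_sub_def Let_def)
  moreover have "dag L a \<in> arcs (induced_sub L S)" if "a \<in> arcs (induced_sub L S)" for a
    using that u(4,5) by auto
  moreover have "finite S" using S u(2) finite_subset by blast
  ultimately show ?thesis unfolding ugraph_def using u(1,5,6,7) by auto
qed

lemma nb_induced_sub: "v \<in> S \<Longrightarrow> nb (induced_sub L S) v = nb L v"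
  unfolding nb_def by auto

lemma inclusion_etale:
  assumes H: "ugraph H" and sub: "arcs H \<subseteq> arcs M" "verts H \<subseteq> verts M"
    "\<And>a. a \<in> arcs H \<Longrightarrow> dag H a = dag M a" "\<And>v. v \<in> verts H \<Longrightarrow> nb H v = nb M v"
  shows "etale H M (restrict id (arcs H), restrict id (verts H))"
proof -
  note u = ugraphD[OF H]
  have d: "a \<in> darts M \<and> tgt M a = tgt H a" if "a \<in> darts H" for a
    using sub(4)[OF u(9)[OF that]] that unfolding nb_def by auto
  have "bij_betw (restrict id (arcs H)) (nb H v) (nb H v)" for v
    using u(7) by (subst bij_betw_cong[of _ _ id]) (auto simp: nb_def)
  then have "bij_betw (restrict id (arcs H)) (nb H v) (nb M v)" if "v \<in> verts H" for v
    using sub(4)[OF that] by metis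
  then show ?thesis unfolding etale_def using sub u(4,7,9) d by (auto simp: subset_iff)
qed

lemma inclusion_embedding:
  assumes H: "connected_ugraph H" and M: "connected_ugraph M" and ne: "verts H \<noteq> {}"
    and sub: "arcs H \<subseteq> arcs M" "verts H \<subseteq> verts M"
    "\<And>a. a \<in> arcs H \<Longrightarrow> dag H a = dag M a" "\<And>v. v \<in> verts H \<Longrightarrow> nb H v = nb M v"
  shows "embedding H M (restrict id (arcs H), restrict id (verts H))"
  unfolding embedding_def
  using inclusion_etale[OF connected_ugraphD(1)[OF H] sub] H M ne by (auto simp: inj_on_def nodeless_loop_def)

lemma induced_sub_singleton:
  assumes L: "connected_ugraph L" and v: "v \<in> verts L"
  shows "connected_ugraph (induced_sub L {v})"
proof (rule connected_ugraph_by_vertsI[OF induced_sub_ugraph[OF connected_ugraphD(1)[OF L]]])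
  show "a \<in> darts (induced_sub L {v}) \<or> dag (induced_sub L {v}) a \<in> darts (induced_sub L {v})"
    if "a \<in> arcs (induced_sub L {v})" for a using that by auto
qed (use v in auto)

text \<open>Connectedness of \<open>L\<close> provides an edge from \<open>S\<close> to a vertex
  outside. After adding that vertex, a vertex set closed along edges meets \<open>S\<close> in
  nothing or everything, and the edge \<open>d\<close> ties the new vertex to
  \<open>S\<close>.\<close>

lemma induced_sub_grow:
  assumes L: "connected_ugraph L" and S: "S \<subseteq> verts L" "S \<noteq> {}" "S \<noteq> verts L"
    and cS: "connected_ugraph (induced_sub L S)"
  shows "\<exists>w\<in>verts L - S. connected_ugraph (induced_sub L (insert w S))"
proof -
  note u = ugraphD[OF connected_ugraphD(1)[OF L]]
  obtain d where d: "d \<in> darts L" "dag L d \<in> darts L" "tgt L d \<in> S" "tgt L (dag L d) \<notin> S"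
    using connected_ugraph_verts_closed[OF L S(1)] S(2,3) by blast
  have dA: "d \<in> arcs L" using d u(7) by auto
  let ?w = "tgt L (dag L d)" and ?T = "insert (tgt L (dag L d)) S"
  have w: "?w \<in> verts L" using u(9)[OF d(2)] .
  have "connected_ugraph (induced_sub L ?T)"
  proof (rule connected_ugraph_by_vertsI[OF induced_sub_ugraph[OF connected_ugraphD(1)[OF L]]])
    show "?T \<subseteq> verts L" using w S by auto
    show "a \<in> darts (induced_sub L ?T) \<or> dag (induced_sub L ?T) a \<in> darts (induced_sub L ?T)"
      if "a \<in> arcs (induced_sub L ?T)" for a using that by auto
    fix W assume W: "W \<subseteq> verts (induced_sub L ?T)"
      and cl: "\<And>a. a \<in> darts (induced_sub L ?T) \<Longrightarrow> dag (induced_sub L ?T) a \<in> darts (induced_sub L ?T) \<Longrightarrow>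
        tgt (induced_sub L ?T) a \<in> W \<Longrightarrow> tgt (induced_sub L ?T) (dag (induced_sub L ?T) a) \<in> W"
    have cl': "tgt L (dag L a) \<in> W"
      if a: "a \<in> darts L" "dag L a \<in> darts L" "tgt L a \<in> W" "tgt L (dag L a) \<in> ?T" for a
    proof -
      have t: "tgt L a \<in> ?T" using W a(3) by auto
      have "a \<in> arcs (induced_sub L ?T)" using a(1) t u(7) by auto
      then have e: "dag (induced_sub L ?T) a = dag L a" by (rule induced_sub_simps(4))
      show ?thesis using cl[of a] a t unfolding e by simp
    qed
    have "W \<inter> S = {} \<or> W \<inter> S = verts (induced_sub L S)"
    proof (rule connected_ugraph_verts_closed[OF cS])
      fix a assume a: "a \<in> darts (induced_sub L S)" "dag (induced_sub L S) a \<in> darts (induced_sub L S)"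
        "tgt (induced_sub L S) a \<in> W \<inter> S"
      have "a \<in> arcs (induced_sub L S)" using a(1) u(7) by auto
      then have e: "dag (induced_sub L S) a = dag L a" by (rule induced_sub_simps(4))
      show "tgt (induced_sub L S) (dag (induced_sub L S) a) \<in> W \<inter> S"
        using cl'[of a] a unfolding e by auto
    qed auto
    then show "W = {} \<or> W = verts (induced_sub L ?T)"
    proof
      assume e: "W \<inter> S = {}"
      have "?w \<notin> W"
      proof
        assume "?w \<in> W"
        then have "tgt L d \<in> W" using cl'[of "dag L d"] d u(5)[OF dA] by auto
        then show False using e d by auto
      qed
      then show ?thesis using W e by auto
    next
      assume e: "W \<inter> S = verts (induced_sub L S)"
      then have "tgt L d \<in> W" using d by auto
      then have "?w \<in> W" using cl'[of d] d by auto
      then show ?thesis using W e by auto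
    qed
  qed (use w S in auto)
  then show ?thesis using w d by blast
qed

text \<open>The star at \<open>v\<close> embeds in \<open>M\<close>, and the bijection of
  \<open>m\<close> at \<open>v\<close> identifies its image in \<open>G\<close> with the star at the
  image vertex.\<close>

lemma star_le:
  fixes G :: "('a::infinite, 'v) ugraph"
  assumes m: "embedding M G m" and v: "v \<in> verts M"
    and d: "d \<in> Emb G" "emb_verts d = snd m ` verts M" "emb_bnd d = fst m ` bnd M"
  shows "emb_le (star_class G (snd m v)) d"
proof -
  note M = embeddingD(1)[OF m] and G = embeddingD(2)[OF m]
  note e = etaleD[OF embeddingD(3)[OF m]]
  note u = ugraphD[OF connected_ugraphD(1)[OF M]]
  note s = star_embedding[OF M v] and c = star_class[OF G e(4)[OF v]]
  show ?thesis
  proof (rule emb_leI[OF s(1) m c(1) _ _ d])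
    show "emb_verts (star_class G (snd m v)) = snd m ` snd (star_map M v) ` verts (star_graph M v)"
      unfolding s(2) c(2) by simp
    have "fst m ` dag M ` nb M v = dag G ` fst m ` nb M v"
      unfolding image_image by (rule image_cong[OF refl]) (use e(5) u(7) in \<open>auto simp: nb_def\<close>)
    then show "emb_bnd (star_class G (snd m v)) = fst m ` fst (star_map M v) ` bnd (star_graph M v)"
      unfolding s(3) c(3) using bij_betw_imp_surj_on[OF e(8)[OF v]] by simp
  qed
qed

text \<open>A domain with vertices is built as an increasing chain of connected full subgraphs. Each
  is a union of the preceding one and the star at the new vertex, so the vertices of its value are
  known by induction. A domain without vertices is an edge, whose value is an edge, or a nodeless
  loop.\<close>

lemma union_preserving_verts:
  fixes G G' :: "('a::infinite, 'v) ugraph" and \<Phi> :: "('a, 'v) emb set \<Rightarrow> ('a, 'v) emb set"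
  assumes \<Phi>: "\<And>c. c \<in> Emb G \<Longrightarrow> \<Phi> c \<in> Emb G'"
    and edge: "\<And>c. c \<in> Emb G \<Longrightarrow> emb_is_edge c \<Longrightarrow> emb_is_edge (\<Phi> c)"
    and un: "\<And>l h k. l \<in> Emb G \<Longrightarrow> h \<in> Emb G \<Longrightarrow> k \<in> Emb G \<Longrightarrow> emb_is_union l h k \<Longrightarrow>
      emb_is_union (\<Phi> l) (\<Phi> h) (\<Phi> k)"
    and c: "c \<in> Emb G"
  shows "emb_verts (\<Phi> c) = (\<Union>w\<in>emb_verts c. emb_verts (\<Phi> (star_class G w)))"
proof -
  note G = Emb_connected[OF c]
  have un': "emb_verts (\<Phi> l) = emb_verts (\<Phi> h) \<union> emb_verts (\<Phi> k)"
    if "l \<in> Emb G" "h \<in> Emb G" "k \<in> Emb G" "emb_le h l" "emb_le k l" "emb_verts l = emb_verts h \<union> emb_verts k" for l h k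
    using un[OF that(1-3)] that(4-6) unfolding emb_is_union_def by blast
  obtain h where h: "h \<in> c" using EmbD(1)[OF c] ..
  define L l where "L = fst h" and "l = snd h"
  have l: "embedding L G l" using EmbD(2)[OF c h] unfolding L_def l_def .
  have cV: "emb_verts c = snd l ` verts L" and cB: "emb_bnd c = fst l ` bnd L"
    using EmbD(3,4)[OF c h] unfolding L_def l_def by auto
  note L = embeddingD(1)[OF l]
  show ?thesis
  proof (cases "verts L = {}")
    case True
    then have v: "emb_verts c = {}" using cV by simp
    have "emb_verts (\<Phi> c) = {}"
    proof (cases "emb_bnd c = {}")
      case False
      then have "emb_is_edge c" using emb_is_edge_iff[OF c] v by blast
      then show ?thesis using edge[OF c] emb_is_edge_iff[OF \<Phi>[OF c]] by blast
    next
      case True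
      text \<open>The nodeless loop is the union of its edge with itself.\<close>
      then have n: "nodeless_loop G" by (rule Emb_empty_nodeless[OF c v])
      then have G0: "verts G = {}" "bnd G = {}" "darts G = {}" unfolding nodeless_loop_def by auto
      define H where "H = G\<lparr>bnd := arcs G\<rparr>"
      have H: "arcs H = arcs G" "verts H = {}" "dag H = dag G" "darts H = {}" "tgt H = tgt G" "bnd H = arcs G"
        using G0 by (simp_all add: H_def)
      have cH: "connected_ugraph H"
        using G unfolding connected_ugraph_def ugraph_def H G0 by auto
      note uG = ugraphD[OF connected_ugraphD(1)[OF G]]
      have e: "embedding H G (restrict id (arcs H), restrict id (verts H))" (is "embedding _ _ ?i")
        unfolding embedding_def using cH G n uG(4) by (auto simp: etale_def H G0 nodeless_loop_def)
      obtain d where d: "d \<in> Emb G" "emb_verts d = {}" "emb_bnd d = arcs G"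
        using embedding_Emb[OF e] H by auto
      let ?j = "(restrict id (arcs G), restrict id (verts G))"
      have le: "emb_le d c"
      proof (rule emb_leI[OF e embedding_id[OF G] d(1) _ _ c])
        have "fst ?j ` fst ?i ` bnd H = arcs G" by (simp add: H)
        then show "emb_bnd d = fst ?j ` fst ?i ` bnd H" using d(3) by simp
      qed (simp_all add: d v True H G0)
      have "arcs G \<noteq> {}" using n unfolding nodeless_loop_def by auto
      then have "emb_is_edge d" using emb_is_edge_iff[OF d(1)] d by blast
      then have "emb_verts (\<Phi> d) = {}" using edge[OF d(1)] emb_is_edge_iff[OF \<Phi>[OF d(1)]] by blast
      then show ?thesis using un'[OF c d(1) d(1) le le] v d(2) by simp
    qed
    then show ?thesis using v by simp
  next
    case False
    note uL = ugraphD[OF connected_ugraphD(1)[OF L]]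
    define inc where "inc S = (restrict id (arcs (induced_sub L S)), restrict id (verts (induced_sub L S)))" for S
    have incL: "embedding (induced_sub L S) L (inc S)" if "connected_ugraph (induced_sub L S)" "S \<subseteq> verts L" "S \<noteq> {}" for S
      unfolding inc_def by (rule inclusion_embedding[OF that(1) L]) (use that in \<open>auto simp: nb_induced_sub\<close>)
    have incT: "embedding (induced_sub L S) (induced_sub L T) (inc S)"
      if "connected_ugraph (induced_sub L S)" "connected_ugraph (induced_sub L T)" "S \<subseteq> T" "S \<noteq> {}" for S T
      unfolding inc_def
      by (rule inclusion_embedding[OF that(1,2)]) (use that in \<open>auto simp: subset_iff nb_induced_sub\<close>)
    define mm where "mm S = comp_map (induced_sub L S) l (inc S)" for S
    have mm: "embedding (induced_sub L S) G (mm S)" if "connected_ugraph (induced_sub L S)" "S \<subseteq> verts L" "S \<noteq> {}" for S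
      unfolding mm_def by (rule embedding_comp[OF incL[OF that] l])
    have mm0: "fst (mm S) a = fst l a" if "a \<in> arcs (induced_sub L S)" for S a
      using that unfolding mm_def inc_def comp_map_def by (simp del: induced_sub_simps)
    have mm1: "snd (mm S) v = snd l v" if "v \<in> S" for S v
      using that unfolding mm_def inc_def comp_map_def by simp
    have mmV: "snd (mm S) ` verts (induced_sub L S) = snd l ` S" for S
      using mm1 by (auto intro!: image_cong)
    have mmB: "fst (mm S) ` bnd (induced_sub L S) = fst l ` bnd (induced_sub L S)" if "S \<subseteq> verts L" for S
      by (rule image_cong[OF refl], rule mm0)
        (use ugraphD(11)[OF induced_sub_ugraph[OF connected_ugraphD(1)[OF L] that]] in blast)
    have incB: "fst (inc S) ` bnd (induced_sub L S) = bnd (induced_sub L S)"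
      and incV: "snd (inc S) ` verts (induced_sub L S) = S" if "S \<subseteq> verts L" for S
    proof -
      have "restrict id (arcs (induced_sub L S)) ` bnd (induced_sub L S) = id ` bnd (induced_sub L S)"
        by (rule image_cong[OF refl], rule restrict_apply')
          (use ugraphD(11)[OF induced_sub_ugraph[OF connected_ugraphD(1)[OF L] that]] in blast)
      then show "fst (inc S) ` bnd (induced_sub L S) = bnd (induced_sub L S)"
        "snd (inc S) ` verts (induced_sub L S) = S" by (simp_all add: inc_def)
    qed
    \<comment> \<open>The claim is stated for every class with the vertex set and boundary of the
      subgraph, so it applies to any class obtained later from those two data.\<close>
    define good where "good S \<longleftrightarrow> S \<subseteq> verts L \<and> S \<noteq> {} \<and> connected_ugraph (induced_sub L S) \<and>
      (\<forall>d\<in>Emb G. emb_verts d = snd l ` S \<longrightarrow> emb_bnd d = fst l ` bnd (induced_sub L S) \<longrightarrow>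
        emb_verts (\<Phi> d) = (\<Union>w\<in>snd l ` S. emb_verts (\<Phi> (star_class G w))))" for S
    have starle: "emb_le (star_class G (snd l v)) d"
      if "v \<in> S" "S \<subseteq> verts L" "connected_ugraph (induced_sub L S)" "d \<in> Emb G"
        "emb_verts d = snd l ` S" "emb_bnd d = fst l ` bnd (induced_sub L S)" for v S d
      using star_le[OF mm[OF that(3,2)], of v d] that mm1[OF that(1)] mmV[of S] mmB[OF that(2)] by auto
    have starG: "star_class G (snd l v) \<in> Emb G" "emb_verts (star_class G (snd l v)) = {snd l v}" if "v \<in> verts L" for v
      using star_class[OF G etaleD(4)[OF embeddingD(3)[OF l] that]] by auto
    have base: "\<exists>S. good S \<and> card S = 1"
    proof -
      obtain v where v: "v \<in> verts L" using False by auto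
      have cv: "connected_ugraph (induced_sub L {v})" by (rule induced_sub_singleton[OF L v])
      have "good {v}"
        unfolding good_def
      proof (intro conjI ballI impI)
        fix d assume d: "d \<in> Emb G" "emb_verts d = snd l ` {v}" "emb_bnd d = fst l ` bnd (induced_sub L {v})"
        \<comment> \<open>The subgraph on \<open>v\<close> alone keeps loops that the star cuts
          open. Their classes may differ, but they have the same vertices, so the former is a union
          of the star with itself.\<close>
        have le: "emb_le (star_class G (snd l v)) d" by (rule starle[of _ "{v}"]) (use v cv d in auto)
        show "emb_verts (\<Phi> d) = (\<Union>w\<in>snd l ` {v}. emb_verts (\<Phi> (star_class G w)))"
          using un'[OF d(1) starG(1)[OF v] starG(1)[OF v] le le] starG(2)[OF v] d(2) by simp
      qed (use v cv in auto)
      then show ?thesis by (intro exI[of _ "{v}"]) simp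
    qed
    have step: "\<exists>T. good T \<and> card T = Suc (card S)" if S: "good S" "S \<noteq> verts L" for S
    proof -
      have S': "S \<subseteq> verts L" "S \<noteq> {}" "connected_ugraph (induced_sub L S)" using S(1) unfolding good_def by auto
      obtain w where w: "w \<in> verts L - S" "connected_ugraph (induced_sub L (insert w S))"
        using induced_sub_grow[OF L S'(1,2) S(2) S'(3)] by blast
      let ?T = "insert w S"
      have T: "?T \<subseteq> verts L" using w S' by auto
      obtain c' where c': "c' \<in> Emb G" "emb_verts c' = snd l ` S" "emb_bnd c' = fst l ` bnd (induced_sub L S)"
        using embedding_Emb[OF mm[OF S'(3,1,2)]] mmV mmB[OF S'(1)] by auto
      have "good ?T"
        unfolding good_def
      proof (intro conjI ballI impI)
        fix d assume d: "d \<in> Emb G" "emb_verts d = snd l ` ?T" "emb_bnd d = fst l ` bnd (induced_sub L ?T)"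
        have le1: "emb_le (star_class G (snd l w)) d" by (rule starle[of _ ?T]) (use w T d in auto)
        have le2: "emb_le c' d"
        proof (rule emb_leI[OF incT[OF S'(3) w(2) _ S'(2)] mm[OF w(2) T] c'(1) _ _ d(1)])
          show "emb_verts c' = snd (mm ?T) ` snd (inc S) ` verts (induced_sub L S)"
            unfolding incV[OF S'(1)] c'(2) by (rule image_cong[OF refl]) (use mm1 in auto)
          show "emb_bnd c' = fst (mm ?T) ` fst (inc S) ` bnd (induced_sub L S)"
            unfolding incB[OF S'(1)] c'(3)
          proof (rule image_cong[OF refl])
            fix a assume "a \<in> bnd (induced_sub L S)"
            then have "a \<in> arcs (induced_sub L S)"
              using ugraphD(11)[OF induced_sub_ugraph[OF connected_ugraphD(1)[OF L] S'(1)]] by blast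
            then have "a \<in> arcs (induced_sub L ?T)" by auto
            then show "fst l a = fst (mm ?T) a" using mm0 by simp
          qed
        qed (use d mmV[of ?T] mmB[OF T] in auto)
        have "emb_verts (\<Phi> c') = (\<Union>w\<in>snd l ` S. emb_verts (\<Phi> (star_class G w)))"
          using S(1) c' unfolding good_def by blast
        then show "emb_verts (\<Phi> d) = (\<Union>w\<in>snd l ` ?T. emb_verts (\<Phi> (star_class G w)))"
          using un'[OF d(1) starG(1) c'(1) le1 le2] starG(2)[of w] w c'(2) d(2) by simp
      qed (use T w in auto)
      moreover have "card ?T = Suc (card S)" using w finite_subset[OF S'(1) uL(2)] by simp
      ultimately show ?thesis by blast
    qed
    have "\<exists>S. good S \<and> card S = Suc n" if "Suc n \<le> card (verts L)" for n
      using that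
    proof (induction n)
      case 0 then show ?case using base by simp
    next
      case (Suc n)
      then obtain S where S: "good S" "card S = Suc n" by auto
      then have "S \<noteq> verts L" using Suc.prems by auto
      then show ?case using step[OF S(1)] S(2) by simp
    qed
    moreover have "card (verts L) \<noteq> 0" using False uL(2) by simp
    then obtain n where n: "card (verts L) = Suc n" using not0_implies_Suc by blast
    ultimately obtain S where S: "good S" "card S = card (verts L)" by auto
    then have SL: "S = verts L" using card_subset_eq[OF uL(2)] unfolding good_def by blast
    have S': "S \<subseteq> verts L" "S \<noteq> {}" "connected_ugraph (induced_sub L S)" using S(1) unfolding good_def by auto
    obtain d where d: "d \<in> Emb G" "emb_verts d = snd l ` S" "emb_bnd d = fst l ` bnd (induced_sub L S)"
      using embedding_Emb[OF mm[OF S'(3,1,2)]] mmV mmB[OF S'(1)] by auto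
    \<comment> \<open>The full subgraph on all vertices lies below \<open>c\<close> and has the same
      vertices, so \<open>c\<close> is a union of \<open>d\<close> with itself and no comparison of
      boundaries is needed.\<close>
    have le: "emb_le d c"
    proof (rule emb_leI[OF incL[OF S'(3,1,2)] l d(1) _ _ c cV cB])
      show "emb_verts d = snd l ` snd (inc S) ` verts (induced_sub L S)" unfolding incV[OF S'(1)] d(2) ..
      show "emb_bnd d = fst l ` fst (inc S) ` bnd (induced_sub L S)" unfolding incB[OF S'(1)] d(3) ..
    qed
    have "emb_verts (\<Phi> d) = (\<Union>w\<in>snd l ` S. emb_verts (\<Phi> (star_class G w)))"
      using S(1) d unfolding good_def by blast
    then show ?thesis using un'[OF c d(1) d(1) le le] d(2) cV SL by simp
  qed
qed

section \<open>Graphical maps as pairs of functions\<close>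

lemma edge_of_dag: "ugraph G \<Longrightarrow> a \<in> arcs G \<Longrightarrow> edge_of G (dag G a) = edge_of G a"
  unfolding edge_of_def using ugraphD(5)[of G a] by auto

context oriented
begin

lemma edge_of_eq:
  assumes "a \<in> arcs (fst X)" "b \<in> arcs (fst X)" "edge_of (fst X) a = edge_of (fst X) b" "snd X a = snd X b"
  shows "a = b"
proof -
  have "a = b \<or> a = dag (fst X) b" using assms(3) unfolding edge_of_def by auto
  then show ?thesis using assms sign_dag[OF assms(2)] sign[OF assms(2)] by auto
qed

lemma edge_of_inj: "inj_on (edge_of (fst X)) (dE (dg X))"
  by (rule inj_onI, rule edge_of_eq) auto

lemma emb_in_eq: "c \<in> Emb (fst X) \<Longrightarrow> emb_in X c = mset_set (edge_of (fst X) ` bin X c)"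
proof -
  assume c: "c \<in> Emb (fst X)"
  have "emb_bnd c \<inter> {a \<in> arcs (fst X). snd X a = 1} = bin X c" using Emb_subset(2)[OF c] unfolding bin_def by auto
  then show ?thesis unfolding emb_in_def by simp
qed

lemma emb_out_eq: "c \<in> Emb (fst X) \<Longrightarrow> emb_out X c = mset_set (edge_of (fst X) ` bout X c)"
proof -
  assume c: "c \<in> Emb (fst X)"
  have "emb_bnd c \<inter> {a \<in> arcs (fst X). snd X a = -1} = {a \<in> emb_bnd c. snd X a = -1}" using Emb_subset(2)[OF c] by auto
  moreover have "edge_of (fst X) ` bout X c = edge_of (fst X) ` {a \<in> emb_bnd c. snd X a = -1}"
    unfolding bout_def image_image
    by (rule image_cong[OF refl], rule edge_of_dag[OF U]) (use Emb_subset(2)[OF c] in auto)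
  ultimately show ?thesis unfolding emb_out_def by simp
qed

lemma bin_star: "v \<in> verts (fst X) \<Longrightarrow> c \<in> Emb (fst X) \<Longrightarrow> emb_bnd c = dag (fst X) ` nb (fst X) v \<Longrightarrow> bin X c = in_at (dg X) v"
  and bout_star: "v \<in> verts (fst X) \<Longrightarrow> c \<in> Emb (fst X) \<Longrightarrow> emb_bnd c = dag (fst X) ` nb (fst X) v \<Longrightarrow> bout X c = out_at (dg X) v"
proof -
  assume c: "emb_bnd c = dag (fst X) ` nb (fst X) v"
  have n: "dag (fst X) (dag (fst X) a) = a" "a \<in> arcs (fst X)" "dag (fst X) a \<in> arcs (fst X)" "snd X (dag (fst X) a) = - snd X a"
    if "a \<in> nb (fst X) v" for a
    using nb_arcs[OF that] u(4,5) by auto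
  have "a \<in> dag (fst X) ` nb (fst X) v" if "a \<in> arcs (fst X)" "dag (fst X) a \<in> nb (fst X) v" for a
    using that u(5)[OF that(1)] by (metis imageI)
  then show "bin X c = in_at (dg X) v" unfolding bin_def in_at_dg c using n by auto
  have "{a \<in> emb_bnd c. snd X a = -1} = dag (fst X) ` {a \<in> nb (fst X) v. snd X a = 1}"
    unfolding c using n by auto
  moreover have "dag (fst X) ` dag (fst X) ` {a \<in> nb (fst X) v. snd X a = 1} = id ` {a \<in> nb (fst X) v. snd X a = 1}"
    unfolding image_image by (rule image_cong) (use n in auto)
  ultimately have "bout X c = {a \<in> nb (fst X) v. snd X a = 1}" unfolding bout_def by simp
  then show "bout X c = out_at (dg X) v" unfolding out_at_dg using n by auto
qed

lemma finite_bin: "c \<in> Emb (fst X) \<Longrightarrow> finite (bin X c)" "c \<in> Emb (fst X) \<Longrightarrow> finite (bout X c)"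
  by (auto simp: bin_def bout_def dest: Emb_subset(3))

end

section \<open>Edge multisets and bijections of arcs\<close>

context arc_map
begin

lemma image_edge_of: "a \<in> arcs (fst X) \<Longrightarrow> p ` edge_of (fst X) a = edge_of (fst X') (p a)"
  unfolding edge_of_def using p_dag by auto

text \<open>The image multiset counts multiplicities while the left side has none. Comparing
  supports gives that \<open>p\<close> maps \<open>S\<close> onto \<open>T\<close>, and comparing
  sizes gives injectivity.\<close>

lemma mset_edge_iff:
  assumes e: "\<And>a. a \<in> arcs (fst X) \<Longrightarrow> e (edge_of (fst X) a) = edge_of (fst X') (p a)"
    and S: "finite S" "S \<subseteq> dE (dg X)" and T: "finite T" "T \<subseteq> dE (dg X')"
  shows "mset_set (edge_of (fst X') ` T) = image_mset e (mset_set (edge_of (fst X) ` S)) \<longleftrightarrow> bij_betw p S T"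
proof -
  have iS: "inj_on (edge_of (fst X)) S" and iT: "inj_on (edge_of (fst X')) T"
    using inj_on_subset[OF A.edge_of_inj S(2)] inj_on_subset[OF B.edge_of_inj T(2)] by auto
  have pS: "p ` S \<subseteq> dE (dg X')" using S(2) p_arcs p_sign by auto
  have eS: "e ` edge_of (fst X) ` S = edge_of (fst X') ` p ` S"
    unfolding image_image by (rule image_cong[OF refl], rule e) (use S(2) in auto)
  have img: "edge_of (fst X') ` T = edge_of (fst X') ` p ` S \<longleftrightarrow> T = p ` S"
    by (rule inj_on_image_eq_iff[OF B.edge_of_inj T(2) pS])
  show ?thesis
  proof
    assume m: "mset_set (edge_of (fst X') ` T) = image_mset e (mset_set (edge_of (fst X) ` S))"
    from arg_cong[OF m, of set_mset] have "edge_of (fst X') ` T = e ` edge_of (fst X) ` S" using S T by simp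
    then have T': "T = p ` S" using img eS by simp
    from arg_cong[OF m, of size] have "card (edge_of (fst X') ` T) = card (edge_of (fst X) ` S)" using S T by simp
    then have "card T = card S" using card_image[OF iS] card_image[OF iT] by simp
    then show "bij_betw p S T" unfolding T' bij_betw_def using eq_card_imp_inj_on[OF S(1)] by simp
  next
    assume b: "bij_betw p S T"
    then have T': "T = p ` S" and ip: "inj_on p S" by (auto simp: bij_betw_def)
    have ie: "inj_on e (edge_of (fst X) ` S)"
    proof (rule inj_onI, clarify)
      fix a b assume a: "a \<in> S" and b: "b \<in> S" and eq: "e (edge_of (fst X) a) = e (edge_of (fst X) b)"
      have "edge_of (fst X') (p a) = edge_of (fst X') (p b)" using eq e a b S(2) by auto
      then have "p a = p b" using inj_onD[OF B.edge_of_inj] pS a b by blast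
      then show "edge_of (fst X) a = edge_of (fst X) b" using inj_onD[OF ip _ a b] by simp
    qed
    show "mset_set (edge_of (fst X') ` T) = image_mset e (mset_set (edge_of (fst X) ` S))"
      unfolding image_mset_mset_set[OF ie] eS T' ..
  qed
qed

end

context oriented_map
begin

lemma bin_hat: "c \<in> Emb (fst X) \<Longrightarrow> bij_betw (fst \<phi>) (bin X c) (bin X' (emb_hat (fst X') \<phi> c))"
  and bout_hat: "c \<in> Emb (fst X) \<Longrightarrow> bij_betw (fst \<phi>) (bout X c) (bout X' (emb_hat (fst X') \<phi> c))"
proof -
  assume c: "c \<in> Emb (fst X)"
  note h = hat[OF c]
  have arcs: "a \<in> arcs (fst X)" if "a \<in> emb_bnd c" for a using that Emb_subset(2)[OF c] by auto
  show "bij_betw (fst \<phi>) (bin X c) (bin X' (emb_hat (fst X') \<phi> c))"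
    unfolding bij_betw_def bin_def h(2)
    by (intro conjI inj_on_subset[OF h(4)]) (use p_sign arcs in auto)
  have inj: "inj_on (fst \<phi>) (bout X c)"
  proof (rule inj_onI)
    fix a b assume "a \<in> bout X c" "b \<in> bout X c" and eq: "fst \<phi> a = fst \<phi> b"
    then obtain a' b' where ab: "a' \<in> emb_bnd c" "a = dag (fst X) a'" "b' \<in> emb_bnd c" "b = dag (fst X) b'"
      unfolding bout_def by auto
    have "dag (fst X') (fst \<phi> a') = dag (fst X') (fst \<phi> b')" using eq ab p_dag arcs by simp
    then have "fst \<phi> a' = fst \<phi> b'" using B.u(5)[OF p_arcs] arcs ab by metis
    then show "a = b" using inj_onD[OF h(4) _ ab(1,3)] ab by simp
  qed
  have "{b \<in> fst \<phi> ` emb_bnd c. snd X' b = -1} = fst \<phi> ` {a \<in> emb_bnd c. snd X a = -1}"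
    using p_sign arcs by auto
  moreover have "fst \<phi> ` dag (fst X) ` {a \<in> emb_bnd c. snd X a = -1} =
    dag (fst X') ` fst \<phi> ` {a \<in> emb_bnd c. snd X a = -1}"
    unfolding image_image by (rule image_cong) (use p_dag arcs in auto)
  ultimately have "fst \<phi> ` bout X c = bout X' (emb_hat (fst X') \<phi> c)"
    unfolding bout_def h(2) by simp
  then show "bij_betw (fst \<phi>) (bout X c) (bout X' (emb_hat (fst X') \<phi> c))" unfolding bij_betw_def using inj by blast
qed

lemma induced_edge: "a \<in> arcs (fst X) \<Longrightarrow> fst (induced_pair X X' \<phi>) (edge_of (fst X) a) = edge_of (fst X') (fst \<phi> a)"
  unfolding induced_pair_def edges_def using image_edge_of by simp

text \<open>Unions combine the formula for vertices with \<open>hat_mono\<close>, disjointness comes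
  from that of the values at vertices, and the multiset equations express that \<open>\<phi>\<close>
  is bijective on inputs and on outputs of each class.\<close>

lemma induced_pair: "edge_emb_pair X X' (induced_pair X X' \<phi>)"
proof -
  let ?h = "emb_hat (fst X') \<phi>"
  have s: "snd (induced_pair X X' \<phi>) c = ?h c" if "c \<in> Emb (fst X)" for c
    using that by (simp add: induced_pair_def)
  show ?thesis
    unfolding edge_emb_pair_def
  proof (intro conjI ballI impI)
    show "fst (induced_pair X X' \<phi>) \<in> edges (fst X) \<rightarrow>\<^sub>E edges (fst X')"
      using image_edge_of p_arcs by (auto simp: induced_pair_def edges_def)
    show "snd (induced_pair X X' \<phi>) \<in> Emb (fst X) \<rightarrow>\<^sub>E Emb (fst X')"
      using hat(1) by (auto simp: induced_pair_def)
  next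
    fix c assume c: "c \<in> Emb (fst X)" and "emb_is_edge c"
    then have "emb_verts c = {}" "emb_bnd c \<noteq> {}" using emb_is_edge_iff[OF c] by auto
    then show "emb_is_edge (snd (induced_pair X X' \<phi>) c)"
      unfolding s[OF c] emb_is_edge_iff[OF hat(1)[OF c]] hat(2,3)[OF c] by simp
  next
    fix l h k assume o: "l \<in> Emb (fst X)" "h \<in> Emb (fst X)" "k \<in> Emb (fst X)" and un: "emb_is_union l h k"
    then show "emb_is_union (snd (induced_pair X X' \<phi>) l) (snd (induced_pair X X' \<phi>) h) (snd (induced_pair X X' \<phi>) k)"
      unfolding emb_is_union_def s[OF o(1)] s[OF o(2)] s[OF o(3)] hat(3)[OF o(1)] hat(3)[OF o(2)] hat(3)[OF o(3)]
      using hat_mono[OF _ o(2,1)] hat_mono[OF _ o(3,1)] by auto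
  next
    fix h k assume o: "h \<in> Emb (fst X)" "k \<in> Emb (fst X)" and d: "emb_vdisjoint h k"
    have "emb_verts (snd \<phi> v) \<inter> emb_verts (snd \<phi> w) = {}" if "v \<in> emb_verts h" "w \<in> emb_verts k" for v w
      using disj[of v w] that d Emb_subset(1)[OF o(1)] Emb_subset(1)[OF o(2)] unfolding emb_vdisjoint_def by blast
    then show "emb_vdisjoint (snd (induced_pair X X' \<phi>) h) (snd (induced_pair X X' \<phi>) k)"
      unfolding emb_vdisjoint_def s[OF o(1)] s[OF o(2)] hat(3)[OF o(1)] hat(3)[OF o(2)] by blast
  next
    fix c assume c: "c \<in> Emb (fst X)"
    note m = mset_edge_iff[OF induced_edge]
    show "emb_in X' (snd (induced_pair X X' \<phi>) c) = image_mset (fst (induced_pair X X' \<phi>)) (emb_in X c)"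
      unfolding s[OF c] A.emb_in_eq[OF c] B.emb_in_eq[OF hat(1)[OF c]]
      by (rule m[THEN iffD2, OF _ A.finite_bin(1)[OF c] A.emb_bnd_signed(2)[OF c] B.finite_bin(1)[OF hat(1)[OF c]]
        B.emb_bnd_signed(2)[OF hat(1)[OF c]] bin_hat[OF c]])
    show "emb_out X' (snd (induced_pair X X' \<phi>) c) = image_mset (fst (induced_pair X X' \<phi>)) (emb_out X c)"
      unfolding s[OF c] A.emb_out_eq[OF c] B.emb_out_eq[OF hat(1)[OF c]]
      by (rule m[THEN iffD2, OF _ A.finite_bin(2)[OF c] A.emb_bnd_signed(3)[OF c] B.finite_bin(2)[OF hat(1)[OF c]]
        B.emb_bnd_signed(3)[OF hat(1)[OF c]] bout_hat[OF c]])
  qed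
qed

end

text \<open>An arc is determined by its edge and its sign, and the value of the map at a vertex is
  the value of the induced function at the star.\<close>

lemma induced_pair_inj:
  assumes "oriented_map X X' \<phi>" "oriented_map X X' \<psi>" and eq: "induced_pair X X' \<phi> = induced_pair X X' \<psi>"
  shows "\<phi> = \<psi>"
proof -
  interpret M: oriented_map X X' \<phi> by fact
  interpret M': oriented_map X X' \<psi> by fact
  show ?thesis
  proof (rule oriented_map_ext[OF assms(1,2)])
    fix a assume a: "a \<in> arcs (fst X)"
    show "fst \<phi> a = fst \<psi> a"
      by (rule M.B.edge_of_eq)
        (use M.induced_edge[OF a] M'.induced_edge[OF a] eq M.p_arcs[OF a] M'.p_arcs[OF a] M.p_sign[OF a] M'.p_sign[OF a] in auto)
  next
    fix v assume v: "v \<in> verts (fst X)"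
    have "snd (induced_pair X X' \<phi>) (star_class (fst X) v) = snd (induced_pair X X' \<psi>) (star_class (fst X) v)" using eq by simp
    then show "snd \<phi> v = snd \<psi> v"
      using M.hat_star[OF v] M'.hat_star[OF v] star_class(1)[OF M.A.conn v] by (simp add: induced_pair_def)
  qed
qed

text \<open>The vertex part is \<open>\<Phi>\<close> at stars. The multiset equations make the
  lifted arc map bijective on inputs and outputs, which is the condition at a vertex, and disjoint
  stars give disjoint values. Then \<open>\<Phi>\<close> has the vertices and boundary of the
  induced function at every class, by \<open>union_preserving_verts\<close> for the
  vertices.\<close>

lemma induced_pair_surj:
  fixes X X' :: "('a::infinite, 'v) ograph"
  assumes "oriented X" "oriented X'" and ee: "edge_emb_pair X X' (e, \<Phi>)"
  shows "\<exists>\<phi>. oriented_map X X' \<phi> \<and> induced_pair X X' \<phi> = (e, \<Phi>)"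
proof -
  interpret A: oriented X by fact
  interpret B: oriented X' by fact
  have e: "e \<in> edges (fst X) \<rightarrow>\<^sub>E edges (fst X')" and \<Phi>e: "\<Phi> \<in> Emb (fst X) \<rightarrow>\<^sub>E Emb (fst X')"
    and edge: "\<And>h. h \<in> Emb (fst X) \<Longrightarrow> emb_is_edge h \<Longrightarrow> emb_is_edge (\<Phi> h)"
    and un: "\<And>l h k. l \<in> Emb (fst X) \<Longrightarrow> h \<in> Emb (fst X) \<Longrightarrow> k \<in> Emb (fst X) \<Longrightarrow>
      emb_is_union l h k \<Longrightarrow> emb_is_union (\<Phi> l) (\<Phi> h) (\<Phi> k)"
    and dis: "\<And>h k. h \<in> Emb (fst X) \<Longrightarrow> k \<in> Emb (fst X) \<Longrightarrow> emb_vdisjoint h k \<Longrightarrow> emb_vdisjoint (\<Phi> h) (\<Phi> k)"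
    and inn: "\<And>h. h \<in> Emb (fst X) \<Longrightarrow> emb_in X' (\<Phi> h) = image_mset e (emb_in X h)"
    and out: "\<And>h. h \<in> Emb (fst X) \<Longrightarrow> emb_out X' (\<Phi> h) = image_mset e (emb_out X h)"
    using ee unfolding edge_emb_pair_def by auto
  have \<Phi>: "\<Phi> c \<in> Emb (fst X')" if "c \<in> Emb (fst X)" for c using \<Phi>e that by auto
  \<comment> \<open>An edge has one arc of each sign, so the value of \<open>e\<close> together with
    the sign determines the arc.\<close>
  have "\<exists>b. b \<in> arcs (fst X') \<and> edge_of (fst X') b = e (edge_of (fst X) a) \<and> snd X' b = snd X a"
    if a: "a \<in> arcs (fst X)" for a
  proof -
    have "e (edge_of (fst X) a) \<in> edges (fst X')" using e a unfolding edges_def by auto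
    then obtain b where b: "b \<in> arcs (fst X')" "edge_of (fst X') b = e (edge_of (fst X) a)" unfolding edges_def by auto
    show ?thesis
    proof (cases "snd X' b = snd X a")
      case False
      then have "snd X' (dag (fst X') b) = snd X a" using A.sign[OF a] B.sign[OF b(1)] B.sign_dag[OF b(1)] by auto
      then show ?thesis using b edge_of_dag[OF B.U b(1)] B.u(4)[OF b(1)] by metis
    qed (use b in blast)
  qed
  then obtain p' where p': "\<And>a. a \<in> arcs (fst X) \<Longrightarrow>
    p' a \<in> arcs (fst X') \<and> edge_of (fst X') (p' a) = e (edge_of (fst X) a) \<and> snd X' (p' a) = snd X a" by metis
  define p where "p = restrict p' (arcs (fst X))"
  have pp: "p a \<in> arcs (fst X')" "edge_of (fst X') (p a) = e (edge_of (fst X) a)" "snd X' (p a) = snd X a"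
    if "a \<in> arcs (fst X)" for a using p'[OF that] that by (simp_all add: p_def)
  interpret arc_map X X' p
  proof
    show "p \<in> arcs (fst X) \<rightarrow>\<^sub>E arcs (fst X')" using pp(1) by (auto simp: p_def)
    fix a assume a: "a \<in> arcs (fst X)"
    show "p (dag (fst X) a) = dag (fst X') (p a)"
      by (rule B.edge_of_eq)
        (use pp[OF a] pp[OF A.u(4)[OF a]] a edge_of_dag[OF A.U a] edge_of_dag[OF B.U pp(1)[OF a]] B.u(4) in auto)
  qed (rule pp(3))
  have m: "mset_set (edge_of (fst X') ` T) = image_mset e (mset_set (edge_of (fst X) ` S)) \<longleftrightarrow> bij_betw p S T"
    if "finite S" "S \<subseteq> dE (dg X)" "finite T" "T \<subseteq> dE (dg X')" for S T
    by (rule mset_edge_iff[OF _ that]) (simp add: pp(2))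
  have bi: "bij_betw p (bin X c) (bin X' (\<Phi> c))" if c: "c \<in> Emb (fst X)" for c
    using inn[OF c] unfolding A.emb_in_eq[OF c] B.emb_in_eq[OF \<Phi>[OF c]]
      m[OF A.finite_bin(1)[OF c] A.emb_bnd_signed(2)[OF c] B.finite_bin(1)[OF \<Phi>[OF c]] B.emb_bnd_signed(2)[OF \<Phi>[OF c]]] .
  have bo: "bij_betw p (bout X c) (bout X' (\<Phi> c))" if c: "c \<in> Emb (fst X)" for c
    using out[OF c] unfolding A.emb_out_eq[OF c] B.emb_out_eq[OF \<Phi>[OF c]]
      m[OF A.finite_bin(2)[OF c] A.emb_bnd_signed(3)[OF c] B.finite_bin(2)[OF \<Phi>[OF c]] B.emb_bnd_signed(3)[OF \<Phi>[OF c]]] .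
  have bnd: "emb_bnd (\<Phi> c) = p ` emb_bnd c" if c: "c \<in> Emb (fst X)" for c
  proof -
    have "dag (fst X') ` p ` bout X c = p ` dag (fst X) ` bout X c"
      unfolding image_image by (rule image_cong[OF refl]) (use p_dag A.emb_bnd_signed(3)[OF c] in auto)
    then show ?thesis
      unfolding B.emb_bnd_signed(1)[OF \<Phi>[OF c]] A.emb_bnd_signed(1)[OF c] image_Un
        bij_betw_imp_surj_on[OF bi[OF c], symmetric] bij_betw_imp_surj_on[OF bo[OF c], symmetric] by simp
  qed
  have verts: "emb_verts (\<Phi> c) = (\<Union>w\<in>emb_verts c. emb_verts (\<Phi> (star_class (fst X) w)))" if c: "c \<in> Emb (fst X)" for c
    by (rule union_preserving_verts[OF \<Phi> edge un c])
  note st = star_class[OF A.conn]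
  define \<phi> where "\<phi> = (p, restrict (\<lambda>v. \<Phi> (star_class (fst X) v)) (verts (fst X)))"
  have \<phi>: "fst \<phi> = p" "\<And>v. v \<in> verts (fst X) \<Longrightarrow> snd \<phi> v = \<Phi> (star_class (fst X) v)"
    by (simp_all add: \<phi>_def)
  have "graphical_map (fst X) (fst X') \<phi>"
    unfolding graphical_map_def
  proof (intro conjI ballI impI)
    show "snd \<phi> \<in> verts (fst X) \<rightarrow>\<^sub>E Emb (fst X')" using st(1) \<Phi> by (auto simp: \<phi>_def)
  next
    fix v w assume v: "v \<in> verts (fst X)" and w: "w \<in> verts (fst X)" and "v \<noteq> w"
    then have "emb_vdisjoint (star_class (fst X) v) (star_class (fst X) w)"
      unfolding emb_vdisjoint_def using st(2) by simp
    then show "emb_verts (snd \<phi> v) \<inter> emb_verts (snd \<phi> w) = {}"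
      using dis[OF st(1)[OF v] st(1)[OF w]] unfolding emb_vdisjoint_def \<phi>(2)[OF v] \<phi>(2)[OF w] by blast
  next
    fix v assume v: "v \<in> verts (fst X)"
    show "bij_betw (\<lambda>a. fst \<phi> (dag (fst X) a)) (nb (fst X) v) (emb_bnd (snd \<phi> v))"
      unfolding \<phi>(1) \<phi>(2)[OF v] star_bij_iff[OF \<Phi>[OF st(1)[OF v]]]
      using bi[OF st(1)[OF v]] bo[OF st(1)[OF v]]
      unfolding A.bin_star[OF v st(1)[OF v] st(3)[OF v]] A.bout_star[OF v st(1)[OF v] st(3)[OF v]] by blast
  next
    assume b: "bnd (fst X) = {} \<and> (\<forall>v\<in>verts (fst X). emb_is_edge (snd \<phi> v))"
    \<comment> \<open>Collapsing all stars leaves the value at the class of the identity without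
      vertices, and without boundary because \<open>X\<close> has none.\<close>
    obtain c where c: "c \<in> Emb (fst X)" "emb_verts c = verts (fst X)" "emb_bnd c = bnd (fst X)"
      using Emb_total[OF A.conn] by blast
    have "emb_verts (\<Phi> (star_class (fst X) v)) = {}" if v: "v \<in> verts (fst X)" for v
      using b v emb_is_edge_iff[OF \<Phi>[OF st(1)[OF v]]] \<phi>(2)[OF v] by auto
    then have "emb_verts (\<Phi> c) = {}" using verts[OF c(1)] c(2) by simp
    moreover have "emb_bnd (\<Phi> c) = {}" using bnd[OF c(1)] c(3) b by simp
    ultimately show "nodeless_loop (fst X')" by (rule Emb_empty_nodeless[OF \<Phi>[OF c(1)]])
  qed (use p_ext p_dag \<phi>(1) in auto)
  then have om: "oriented_map X X' \<phi>" by unfold_locales (use p_sign \<phi>(1) in simp_all)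
  interpret M: oriented_map X X' \<phi> by (rule om)
  have "emb_hat (fst X') \<phi> c = \<Phi> c" if c: "c \<in> Emb (fst X)" for c
  proof (rule M.hatI[OF \<Phi>[OF c]])
    show "emb_bnd (\<Phi> c) = fst \<phi> ` emb_bnd c" using bnd[OF c] \<phi>(1) by simp
    show "emb_verts (\<Phi> c) = (\<Union>w\<in>emb_verts c. emb_verts (snd \<phi> w))"
      unfolding verts[OF c] by (rule SUP_cong[OF refl]) (use \<phi>(2) Emb_subset(1)[OF c] in auto)
  qed
  then have "snd (induced_pair X X' \<phi>) = \<Phi>"
    by (intro extensionalityI[of _ "Emb (fst X)"]) (use \<Phi>e in \<open>auto simp: induced_pair_def PiE_iff\<close>)
  moreover have "fst (induced_pair X X' \<phi>) = e"
  proof (rule extensionalityI[of _ "edges (fst X)"])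
    show "fst (induced_pair X X' \<phi>) x = e x" if "x \<in> edges (fst X)" for x
      using that M.induced_edge pp(2) \<phi>(1) unfolding edges_def by auto
  qed (use e in \<open>auto simp: induced_pair_def PiE_iff\<close>)
  ultimately show ?thesis using om by (intro exI[of _ \<phi>]) (auto intro: prod_eqI)
qed

theorem theoremC14:
  shows "equivalent_categories
           (ext_oriented_cat :: (('a::infinite, 'v::infinite) ograph, ('a, 'v) umor) cat)
           (wheeled_properadic_cat :: (('a, 'v) digraph, ('a, 'v) dmor) cat) \<and>
         (\<forall>X \<in> Obj (ext_oriented_cat :: (('a, 'v) ograph, ('a, 'v) umor) cat).
          \<forall>X' \<in> Obj ext_oriented_cat.
            bij_betw (induced_pair X X') (Hom ext_oriented_cat X X') {p. edge_emb_pair X X' p})"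
proof (intro conjI ballI)
  fix X X' :: "('a, 'v) ograph"
  assume "X \<in> Obj (ext_oriented_cat :: (('a, 'v) ograph, ('a, 'v) umor) cat)"
    and "X' \<in> Obj (ext_oriented_cat :: (('a, 'v) ograph, ('a, 'v) umor) cat)"
  then have o: "oriented X" "oriented X'" unfolding Obj_oriented by auto
  note hom = Hom_oriented[OF o]
  show "bij_betw (induced_pair X X') (Hom ext_oriented_cat X X') {p. edge_emb_pair X X' p}"
    unfolding bij_betw_def
  proof (intro conjI equalityI subsetI)
    show "inj_on (induced_pair X X') (Hom ext_oriented_cat X X')"
      by (rule inj_onI, rule induced_pair_inj) (simp_all add: hom)
  next
    fix p assume "p \<in> induced_pair X X' ` Hom ext_oriented_cat X X'"
    then obtain \<phi> where \<phi>: "\<phi> \<in> Hom ext_oriented_cat X X'" "p = induced_pair X X' \<phi>" by (rule imageE) simp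
    then show "p \<in> {p. edge_emb_pair X X' p}"
      using oriented_map.induced_pair[OF \<phi>(1)[unfolded hom]] by simp
  next
    fix p assume "p \<in> {p. edge_emb_pair X X' p}"
    then obtain \<phi> where \<phi>: "oriented_map X X' \<phi>" "induced_pair X X' \<phi> = p"
      using induced_pair_surj[OF o, of "fst p" "snd p"] by auto
    show "p \<in> induced_pair X X' ` Hom ext_oriented_cat X X'"
      by (rule image_eqI[of _ _ \<phi>]) (simp_all add: \<phi> hom)
  qed
qed (rule oriented_wheeled_equivalence)

end
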